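(* Let $\ell$ and $p$ be distinct primes, $A=(A_1,\dots,A_n)\in\Gamma_{\ell,p}^n$, $Q\in\mathcal{Q}$, $v\in\mathbf{Q}^n$. For any $P\in\mathcal{P}$, $a\in\mathbf{Z}^n$ and $M\in M_n(\mathbf{Z})\cap\Gamma_{\ell,p}$, $$\int_{v+a+M(\mathbf{X})}P(x)\,d\mu_\ell(A,Q,v)(x)=\mathrm{sgn}(\det M)\cdot\Psi_\ell(M^{-1}A,\,M^tP,\,M^{-1}Q,\,M^{-1}(v+a)),$$ where $M^{-1}A=(M^{-1}A_1,\dots,M^{-1}A_n)$.
   Context: Notation: $\mathcal{P}=\mathbf{Q}[X_1,\dots,X_n]$ with action $(BP)(X)=P(XB)$ ($X$ a row vector), so $(M^tP)(X)=P(XM^t)$. $\mathcal{Q}$: tuples $Q=(Q_1,\dots,Q_m)$ of real linear forms $Q_i(x)=\sum_jQ_{ij}x_j$, each nonvanishing on $\mathbf{Q}^n\setminus0$, with action $(BQ)(x)=Q(xB)$. $\Gamma_\ell$ is the group of $A\in\mathrm{GL}_n(\mathbf{Z}_{(\ell)})$ whose first column has all entries but the first divisible by $\ell$; $\Gamma_{\ell,p}=\Gamma_\ell\cap\mathrm{GL}_n(\mathbf{Z}[1/p])$; $\pi_\ell=\mathrm{diag}(\ell,1,\dots,1)$. Bernoulli: $B_k(y)=b_k(\{y\})$ for $k\ne1$ ($b_k$ Bernoulli polynomials), $B_1(y)=\{y\}-\frac12$ for $y\notin\mathbf{Z}$, $0$ for $y\in\mathbf{Z}$; for a positive $n$-tuple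 $e$, $\underline e=\sum e_j$, $w\in\mathbf{R}^n$, $J=\{j:e_j=1,w_j\in\mathbf{Z}\}$: $\mathbf{B}_e(w,Q)=\frac1m\sum_i\prod_{j\in J}\frac{\mathrm{sgn}Q_{ij}}2\prod_{j\notin J}B_{e_j}(w_j)$. For $B=(B_1,\dots,B_n)$ a tuple of matrices in $\mathrm{GL}_n(\mathbf{Q})$ with first columns in suitable form, let $\sigma$ be the matrix whose $i$-th column is the first column of $B_i$, $\sigma_\ell=\ell^{-1}\pi_\ell\sigma$, $\mathbf{D}_\ell(\sigma,e,Q,v)=\sum_{x\in\mathbf{Z}^n/\sigma_\ell\mathbf{Z}^n}\mathbf{B}_e(\sigma_\ell^{-1}(x+\pi_\ell v),\sigma^{-1}Q)-\ell^{1-n+\underline e}\sum_{x\in\mathbf{Z}^n/\sigma\mathbf{Z}^n}\mathbf{B}_e(\sigma^{-1}(x+v),\sigma^{-1}Q)$ ($0$ if $\det\sigma=0$), and for homogeneous $P$ with $P(X\sigma^t)=\sum_rP_r(\sigma)X^r/r!$: $\Psi_\ell(B,P,Q,v)=(-1)^n\mathrm{sgn}(\det\sigma)\sum_r\frac{P_r(\sigma)}{(r+\mathbf{1})!\ell^{\underline r}}\mathbf{D}_\ell(\sigma,\mathbf{1}+r,Q,v)$, extended linearly in $P$ ($\mathbf{1}=(1,\dots,1)$, $(r+\mathbf{1})!=\prod(r_j+1)!$). Measures: $\mathbf{X}=\mathbf{Z}_p^n$ (column vectors), $\mathbf{X}_v=v+\mathbf{X}$, $M(\mathbf{X})=M\mathbf{Z}_p^n$.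 $\mu_\ell(A,Q,v)$ is the measure on $\mathbf{X}_v$ which is $0$ if $\det\sigma=0$ and otherwise is determined by $\mu_\ell(A,Q,v)(v+a+p^k\mathbf{X})=\Psi_\ell(A,1,Q,\frac{v+a}{p^k})$ for $a\in\mathbf{Z}^n$, $k\ge0$. *)

theory Defs
  imports
    "HOL-Analysis.Analysis"
    "HOL-Library.Poly_Mapping"
    "Berlekamp_Zassenhaus.Finite_Field"
begin

section \<open>The field of p-adic numbers\<close>

text \<open>
  The prime is carried by a type (every prime number is the cardinality of some type): for \<open>'p :: prime_card\<close> the type \<open>'p padic\<close> below is the
  completion of the rationals with respect to the absolute value attached to the prime
  \<open>CARD('p)\<close>, built from Cauchy sequences modulo null sequences. It is an instance of
  \<open>field_char_0\<close>, so the rationals embed by \<open>of_rat\<close>, and of \<open>complete_space\<close>; density of the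
  rationals is \<open>padic_rat_dense\<close>.
\<close>

definition padic_abs :: "nat \<Rightarrow> rat \<Rightarrow> real" where
  "padic_abs p x = (if x = 0 then 0 else
     real p powi (int (multiplicity (int p) (snd (quotient_of x)))
                - int (multiplicity (int p) (fst (quotient_of x)))))"

lemma padic_abs_0 [simp]: "padic_abs p 0 = 0"
  by (simp add: padic_abs_def)

lemma padic_abs_nonneg [simp]: "padic_abs p x \<ge> 0"
  by (simp add: padic_abs_def)

lemma padic_abs_frac:
  assumes "prime p" "a \<noteq> 0" "b \<noteq> 0"
  shows "padic_abs p (of_int a / of_int b)
    = real p powi (int (multiplicity (int p) b) - int (multiplicity (int p) a))"
proof -
  let ?x = "of_int a / of_int b :: rat"
  obtain n d where nd: "quotient_of ?x = (n, d)" by force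
  have d: "d > 0" using quotient_of_denom_pos[OF nd] .
  have x: "?x = of_int n / of_int d" using quotient_of_div[OF nd] .
  have "of_int (a * d) = (of_int (n * b) :: rat)"
    using x assms d by (simp add: field_simps)
  hence e: "a * d = n * b" by (simp only: of_int_eq_iff)
  have n: "n \<noteq> 0" using e assms d by auto
  have pe: "prime_elem (int p)" using assms(1) by simp
  have "multiplicity (int p) (a * d) = multiplicity (int p) (n * b)" using e by simp
  hence "multiplicity (int p) a + multiplicity (int p) d
      = multiplicity (int p) n + multiplicity (int p) b"
    using pe assms d n by (simp add: prime_elem_multiplicity_mult_distrib)
  moreover have "?x \<noteq> 0" using assms by simp
  ultimately show ?thesis
    using nd by (simp add: padic_abs_def del: divide_eq_0_iff) (smt (verit) of_nat_add)
qed

lemma rat_common_denom: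
  fixes x y :: rat
  obtains a b c :: int where "c \<noteq> 0" "x = of_int a / of_int c" "y = of_int b / of_int c"
proof -
  obtain a c where 1: "quotient_of x = (a, c)" by force
  obtain b d where 2: "quotient_of y = (b, d)" by force
  have p: "c > 0" "d > 0" using 1 2 quotient_of_denom_pos by auto
  show ?thesis
    by (rule that[of "c * d" "a * d" "b * c"])
       (use p quotient_of_div[OF 1] quotient_of_div[OF 2] in auto)
qed

lemma padic_abs_pos:
  assumes "prime p" "x \<noteq> 0" shows "padic_abs p x > 0"
  using assms by (auto simp: padic_abs_def prime_gt_0_nat)

lemma padic_abs_eq_0_iff [simp]: "prime p \<Longrightarrow> padic_abs p x = 0 \<longleftrightarrow> x = 0"
  using padic_abs_pos[of p x] by (cases "x = 0") auto

lemma padic_abs_1 [simp]: "padic_abs p 1 = 1"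
  by (simp add: padic_abs_def)

lemma padic_abs_mult:
  assumes "prime p" shows "padic_abs p (x * y) = padic_abs p x * padic_abs p y"
proof (cases "x = 0 \<or> y = 0")
  case False
  obtain a b c :: int where c: "c \<noteq> 0" "x = of_int a / of_int c" "y = of_int b / of_int c"
    by (rule rat_common_denom)
  have ab: "a \<noteq> 0" "b \<noteq> 0" using False c by auto
  have xy: "x * y = of_int (a * b) / of_int (c * c)" using c by simp
  have pe: "prime_elem (int p)" using assms by simp
  have p: "real p \<noteq> 0" using prime_gt_0_nat[OF assms] by simp
  have "padic_abs p (x * y) = real p powi (int (multiplicity (int p) (c * c)) - int (multiplicity (int p) (a * b)))"
    unfolding xy by (rule padic_abs_frac) (use assms ab c in auto)
  also have "\<dots> = real p powi ((int (multiplicity (int p) c) - int (multiplicity (int p) a)) + (int (multiplicity (int p) c) - int (multiplicity (int p) b)))"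
    using pe ab c by (simp add: prime_elem_multiplicity_mult_distrib algebra_simps)
  also have "\<dots> = padic_abs p x * padic_abs p y"
  proof -
    have "padic_abs p x = real p powi (int (multiplicity (int p) c) - int (multiplicity (int p) a))"
      "padic_abs p y = real p powi (int (multiplicity (int p) c) - int (multiplicity (int p) b))"
      unfolding c(2,3) by (rule padic_abs_frac; use assms ab c in simp)+
    thus ?thesis by (subst power_int_add) (use p in auto)
  qed
  finally show ?thesis .
qed auto

lemma padic_abs_minus [simp]: "padic_abs p (- x) = padic_abs p x"
  by (cases "x = 0") (auto simp: padic_abs_def rat_uminus_code Let_def multiplicity_times_unit_right[of "-1::int", simplified]
      split: prod.splits)

lemma padic_abs_add_le_max:
  assumes "prime p" shows "padic_abs p (x + y) \<le> max (padic_abs p x) (padic_abs p y)"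
proof (cases "x = 0 \<or> y = 0 \<or> x + y = 0")
  case False
  obtain a b c :: int where c: "c \<noteq> 0" "x = of_int a / of_int c" "y = of_int b / of_int c"
    by (rule rat_common_denom)
  have xy: "x + y = of_int (a + b) / of_int c" using c by (simp add: add_divide_distrib)
  have ab: "a \<noteq> 0" "b \<noteq> 0" "a + b \<noteq> 0" using False c xy by auto
  let ?m = "multiplicity (int p)"
  have nu: "\<not> is_unit (int p)" using assms by (metis not_prime_unit prime_nat_int_transfer)
  have "int p ^ min (?m a) (?m b) dvd a + b"
    by (intro dvd_add multiplicity_dvd') auto
  hence m: "min (?m a) (?m b) \<le> ?m (a + b)"
    by (intro multiplicity_geI) (use ab nu in auto)
  have p: "real p \<ge> 1" using prime_ge_1_nat[OF assms] by simp
  have axy: "padic_abs p (x + y) = real p powi (int (?m c) - int (?m (a + b)))"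
    unfolding xy by (rule padic_abs_frac[OF assms ab(3) c(1)])
  have le: "padic_abs p (x + y) \<le> real p powi (int (?m c) - int (?m d))"
    if "?m d \<le> ?m (a + b)" for d
    unfolding axy by (rule power_int_increasing) (use p that in auto)
  have ax: "padic_abs p x = real p powi (int (?m c) - int (?m a))"
    and ay: "padic_abs p y = real p powi (int (?m c) - int (?m b))"
    unfolding c(2,3) using assms ab c(1) by (simp_all add: padic_abs_frac)
  show ?thesis
  proof (cases "?m a \<le> ?m b")
    case True
    thus ?thesis using m le[of a] ax by (simp add: le_max_iff_disj)
  next
    case False
    thus ?thesis using m le[of b] ay by (simp add: le_max_iff_disj)
  qed
qed (auto simp: max_def)

lemma padic_abs_inverse:
  assumes "prime p" shows "padic_abs p (inverse x) = inverse (padic_abs p x)"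
proof (cases "x = 0")
  case False
  have "padic_abs p x * padic_abs p (inverse x) = 1"
    using False padic_abs_mult[OF assms, of x "inverse x"] by simp
  thus ?thesis by (simp add: inverse_unique)
qed auto

lemma padic_abs_minus_commute: "padic_abs p (x - y) = padic_abs p (y - x)"
  using padic_abs_minus[of p "x - y"] by simp

lemma padic_abs_triangle:
  assumes "prime p" shows "padic_abs p (x + y) \<le> padic_abs p x + padic_abs p y"
  using padic_abs_add_le_max[OF assms, of x y] padic_abs_nonneg[of p x] padic_abs_nonneg[of p y]
  by linarith

lemma padic_abs_diff_le:
  assumes "prime p" shows "\<bar>padic_abs p x - padic_abs p y\<bar> \<le> padic_abs p (x - y)"
  using padic_abs_triangle[OF assms, of y "x - y"] padic_abs_triangle[OF assms, of x "y - x"]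
  by (simp add: padic_abs_minus_commute[of p y x] abs_le_iff)

definition padic_Cauchy :: "nat \<Rightarrow> (nat \<Rightarrow> rat) \<Rightarrow> bool" where
  "padic_Cauchy p X \<longleftrightarrow> (\<forall>e>0. \<exists>N. \<forall>m\<ge>N. \<forall>n\<ge>N. padic_abs p (X m - X n) < e)"

lemma padic_Cauchy_const: "padic_Cauchy p (\<lambda>_. q)"
  by (simp add: padic_Cauchy_def)

lemma padic_Cauchy_convergent:
  assumes "prime p" "padic_Cauchy p X" shows "convergent (\<lambda>n. padic_abs p (X n))"
proof (rule Cauchy_convergent, rule metric_CauchyI)
  fix e :: real assume "e > 0"
  then obtain N where N: "\<And>m n. m \<ge> N \<Longrightarrow> n \<ge> N \<Longrightarrow> padic_abs p (X m - X n) < e"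
    using assms(2) unfolding padic_Cauchy_def by blast
  show "\<exists>N. \<forall>m\<ge>N. \<forall>n\<ge>N. dist (padic_abs p (X m)) (padic_abs p (X n)) < e"
    unfolding dist_real_def using N padic_abs_diff_le[OF assms(1)] by (blast intro: le_less_trans)
qed

lemma padic_Cauchy_bounded:
  assumes "prime p" "padic_Cauchy p X" obtains B where "B > 0" "\<And>n. padic_abs p (X n) \<le> B"
proof -
  have "Bseq (\<lambda>n. padic_abs p (X n))"
    using padic_Cauchy_convergent[OF assms] by (rule convergent_imp_Bseq)
  thus ?thesis using that by (auto simp: Bseq_def)
qed

lemma padic_Cauchy_add:
  assumes p: "prime p" and X: "padic_Cauchy p X" and Y: "padic_Cauchy p Y"
  shows "padic_Cauchy p (\<lambda>n. X n + Y n)"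
  unfolding padic_Cauchy_def
proof (intro allI impI)
  fix e :: real assume e: "e > 0"
  obtain N where N: "\<And>m n. m \<ge> N \<Longrightarrow> n \<ge> N \<Longrightarrow> padic_abs p (X m - X n) < e"
    using X e unfolding padic_Cauchy_def by blast
  obtain K where K: "\<And>m n. m \<ge> K \<Longrightarrow> n \<ge> K \<Longrightarrow> padic_abs p (Y m - Y n) < e"
    using Y e unfolding padic_Cauchy_def by blast
  show "\<exists>N. \<forall>m\<ge>N. \<forall>n\<ge>N. padic_abs p ((X m + Y m) - (X n + Y n)) < e"
  proof (intro exI[of _ "max N K"] allI impI)
    fix m n assume mn: "max N K \<le> m" "max N K \<le> n"
    have "(X m + Y m) - (X n + Y n) = (X m - X n) + (Y m - Y n)" by simp
    also have "padic_abs p \<dots> \<le> max (padic_abs p (X m - X n)) (padic_abs p (Y m - Y n))"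
      by (rule padic_abs_add_le_max[OF p])
    also have "\<dots> < e" using N[of m n] K[of m n] mn by simp
    finally show "padic_abs p ((X m + Y m) - (X n + Y n)) < e" .
  qed
qed

lemma padic_Cauchy_minus: "padic_Cauchy p X \<Longrightarrow> padic_Cauchy p (\<lambda>n. - X n)"
proof -
  have "padic_abs p (- X m - - X n) = padic_abs p (X m - X n)" for m n
    using padic_abs_minus[of p "X m - X n"] by simp
  thus "padic_Cauchy p X \<Longrightarrow> padic_Cauchy p (\<lambda>n. - X n)" by (simp add: padic_Cauchy_def)
qed

lemma padic_Cauchy_mult:
  assumes p: "prime p" and X: "padic_Cauchy p X" and Y: "padic_Cauchy p Y"
  shows "padic_Cauchy p (\<lambda>n. X n * Y n)"
proof -
  obtain B where B: "B > 0" "\<And>n. padic_abs p (X n) \<le> B" using padic_Cauchy_bounded[OF p X] by blast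
  obtain C where C: "C > 0" "\<And>n. padic_abs p (Y n) \<le> C" using padic_Cauchy_bounded[OF p Y] by blast
  show ?thesis unfolding padic_Cauchy_def
  proof (intro allI impI)
    fix e :: real assume e: "e > 0"
    obtain N where N: "\<And>m n. m \<ge> N \<Longrightarrow> n \<ge> N \<Longrightarrow> padic_abs p (X m - X n) < e / C"
      using X e C unfolding padic_Cauchy_def by (meson divide_pos_pos)
    obtain K where K: "\<And>m n. m \<ge> K \<Longrightarrow> n \<ge> K \<Longrightarrow> padic_abs p (Y m - Y n) < e / B"
      using Y e B unfolding padic_Cauchy_def by (meson divide_pos_pos)
    show "\<exists>N. \<forall>m\<ge>N. \<forall>n\<ge>N. padic_abs p (X m * Y m - X n * Y n) < e"
    proof (intro exI[of _ "max N K"] allI impI)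
      fix m n assume mn: "max N K \<le> m" "max N K \<le> n"
      have "padic_abs p ((X m - X n) * Y m) < e"
      proof -
        have "padic_abs p (X m - X n) * padic_abs p (Y m) \<le> padic_abs p (X m - X n) * C"
          by (intro mult_left_mono C) auto
        also have "\<dots> < e" using N[of m n] mn C by (simp add: pos_less_divide_eq)
        finally show ?thesis by (simp add: padic_abs_mult[OF p])
      qed
      moreover have "padic_abs p (X n * (Y m - Y n)) < e"
      proof -
        have "padic_abs p (X n) * padic_abs p (Y m - Y n) \<le> B * padic_abs p (Y m - Y n)"
          by (intro mult_right_mono B) auto
        also have "\<dots> < e" using K[of m n] mn B by (simp add: pos_less_divide_eq mult.commute)
        finally show ?thesis by (simp add: padic_abs_mult[OF p])
      qed
      ultimately have lt: "max (padic_abs p ((X m - X n) * Y m)) (padic_abs p (X n * (Y m - Y n))) < e"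
        by simp
      have "X m * Y m - X n * Y n = (X m - X n) * Y m + X n * (Y m - Y n)"
        by (simp add: algebra_simps)
      also have "padic_abs p \<dots> \<le> max (padic_abs p ((X m - X n) * Y m)) (padic_abs p (X n * (Y m - Y n)))"
        by (rule padic_abs_add_le_max[OF p])
      also note lt
      finally show "padic_abs p (X m * Y m - X n * Y n) < e" .
    qed
  qed
qed

lemma padic_Cauchy_inverse:
  assumes p: "prime p" and X: "padic_Cauchy p X" and nz: "\<not> (\<lambda>n. padic_abs p (X n)) \<longlonglongrightarrow> 0"
  shows "padic_Cauchy p (\<lambda>n. inverse (X n))"
proof -
  obtain L where L: "(\<lambda>n. padic_abs p (X n)) \<longlonglongrightarrow> L"
    using padic_Cauchy_convergent[OF p X] by (auto simp: convergent_def)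
  have "L \<ge> 0" by (rule LIMSEQ_le_const[OF L]) auto
  with L nz have L0: "L > 0" by (cases "L = 0") auto
  hence "\<forall>\<^sub>F n in sequentially. padic_abs p (X n) > L / 2"
    by (intro order_tendstoD(1)[OF L]) auto
  then obtain N where N: "\<And>n. n \<ge> N \<Longrightarrow> padic_abs p (X n) > L / 2"
    by (auto simp: eventually_sequentially)
  show ?thesis unfolding padic_Cauchy_def
  proof (intro allI impI)
    fix e :: real assume e: "e > 0"
    obtain K where K: "\<And>m n. m \<ge> K \<Longrightarrow> n \<ge> K \<Longrightarrow> padic_abs p (X m - X n) < e * (L/2 * (L/2))"
      using X e L0 unfolding padic_Cauchy_def by (meson half_gt_zero mult_pos_pos)
    show "\<exists>N. \<forall>m\<ge>N. \<forall>n\<ge>N. padic_abs p (inverse (X m) - inverse (X n)) < e"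
    proof (intro exI[of _ "max N K"] allI impI)
      fix m n assume mn: "max N K \<le> m" "max N K \<le> n"
      have a: "padic_abs p (X m) > L/2" "padic_abs p (X n) > L/2" using N mn by auto
      hence nz': "X m \<noteq> 0" "X n \<noteq> 0" using L0 by auto
      have pp: "padic_abs p (X m) * padic_abs p (X n) > 0"
        using nz' p by (simp add: padic_abs_pos)
      have "inverse (X m) - inverse (X n) = (X n - X m) * (inverse (X m) * inverse (X n))"
        using nz' by (simp add: field_simps)
      hence "padic_abs p (inverse (X m) - inverse (X n))
          = padic_abs p (X n - X m) / (padic_abs p (X m) * padic_abs p (X n))"
        by (simp add: padic_abs_mult[OF p] padic_abs_inverse[OF p] divide_inverse)
      also have "\<dots> < e"
      proof -
        have "padic_abs p (X n - X m) < e * (L/2 * (L/2))" using K[of n m] mn by auto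
        also have "\<dots> \<le> e * (padic_abs p (X m) * padic_abs p (X n))"
          using a L0 e by (intro mult_left_mono mult_mono) auto
        finally show ?thesis using pp by (simp add: pos_divide_less_eq)
      qed
      finally show "padic_abs p (inverse (X m) - inverse (X n)) < e" .
    qed
  qed
qed

typedef 'p padic_seq = "{X. padic_Cauchy CARD('p::prime_card) X}"
  by (rule exI[of _ "\<lambda>_. 0"]) (simp add: padic_Cauchy_const)

setup_lifting type_definition_padic_seq

instantiation padic_seq :: (prime_card) comm_ring_1
begin
lift_definition zero_padic_seq :: "'a padic_seq" is "\<lambda>_. 0" by (rule padic_Cauchy_const)
lift_definition one_padic_seq :: "'a padic_seq" is "\<lambda>_. 1" by (rule padic_Cauchy_const)
lift_definition plus_padic_seq :: "'a padic_seq \<Rightarrow> 'a padic_seq \<Rightarrow> 'a padic_seq"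
  is "\<lambda>X Y n. X n + Y n" by (rule padic_Cauchy_add[OF prime_card])
lift_definition uminus_padic_seq :: "'a padic_seq \<Rightarrow> 'a padic_seq"
  is "\<lambda>X n. - X n" by (rule padic_Cauchy_minus)
lift_definition times_padic_seq :: "'a padic_seq \<Rightarrow> 'a padic_seq \<Rightarrow> 'a padic_seq"
  is "\<lambda>X Y n. X n * Y n" by (rule padic_Cauchy_mult[OF prime_card])
definition minus_padic_seq :: "'a padic_seq \<Rightarrow> 'a padic_seq \<Rightarrow> 'a padic_seq"
  where "minus_padic_seq X Y = X + - Y"
instance
proof
  fix a b c :: "'a padic_seq"
  show "a + b + c = a + (b + c)" by transfer (simp add: algebra_simps)
  show "a + b = b + a" by transfer (simp add: algebra_simps)
  show "0 + a = a" by transfer simp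
  show "- a + a = 0" by transfer simp
  show "a - b = a + - b" by (rule minus_padic_seq_def)
  show "a * b * c = a * (b * c)" by transfer (simp add: algebra_simps)
  show "a * b = b * a" by transfer (simp add: algebra_simps)
  show "1 * a = a" by transfer simp
  show "(a + b) * c = a * c + b * c" by transfer (simp add: algebra_simps)
  show "(0 :: 'a padic_seq) \<noteq> 1" by transfer (simp add: fun_eq_iff)
qed
end

lift_definition padic_seq_norm :: "'p::prime_card padic_seq \<Rightarrow> real"
  is "\<lambda>X. lim (\<lambda>n. padic_abs CARD('p) (X n))" .

lift_definition padic_seq_inverse :: "'p::prime_card padic_seq \<Rightarrow> 'p padic_seq"
  is "\<lambda>X. if (\<lambda>n. padic_abs CARD('p) (X n)) \<longlonglongrightarrow> 0 then (\<lambda>_. 0) else (\<lambda>n. inverse (X n))"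
proof -
  fix X assume "padic_Cauchy CARD('p) X"
  thus "padic_Cauchy CARD('p) (if (\<lambda>n. padic_abs CARD('p) (X n)) \<longlonglongrightarrow> 0
      then (\<lambda>_. 0) else (\<lambda>n. inverse (X n)))"
    by (cases "(\<lambda>n. padic_abs CARD('p) (X n)) \<longlonglongrightarrow> 0")
       (simp_all add: padic_Cauchy_const padic_Cauchy_inverse[OF prime_card])
qed

lemma Rep_padic_seq_minus: "Rep_padic_seq (X - Y) n = Rep_padic_seq X n - Rep_padic_seq Y n"
  unfolding minus_padic_seq_def by (simp only: plus_padic_seq.rep_eq uminus_padic_seq.rep_eq)

lemma padic_seq_norm_LIMSEQ:
  "(\<lambda>n. padic_abs CARD('p) (Rep_padic_seq X n)) \<longlonglongrightarrow> padic_seq_norm (X :: 'p::prime_card padic_seq)"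
proof -
  have "convergent (\<lambda>n. padic_abs CARD('p) (Rep_padic_seq X n))"
    using padic_Cauchy_convergent[OF prime_card, of "Rep_padic_seq X"] Rep_padic_seq[of X] by simp
  thus ?thesis unfolding padic_seq_norm.rep_eq by (rule convergent_LIMSEQ_iff[THEN iffD1])
qed

lemma padic_seq_norm_eq_0_iff:
  "padic_seq_norm (X :: 'p::prime_card padic_seq) = 0 \<longleftrightarrow>
     (\<lambda>n. padic_abs CARD('p) (Rep_padic_seq X n)) \<longlonglongrightarrow> 0"
  using padic_seq_norm_LIMSEQ[of X] LIMSEQ_unique[OF padic_seq_norm_LIMSEQ[of X]] by metis

lemma padic_seq_norm_nonneg: "padic_seq_norm X \<ge> 0"
  by (rule LIMSEQ_le_const[OF padic_seq_norm_LIMSEQ]) auto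

lemma padic_seq_norm_mult: "padic_seq_norm (X * Y) = padic_seq_norm X * padic_seq_norm Y"
  by (rule LIMSEQ_unique[OF padic_seq_norm_LIMSEQ])
     (use tendsto_mult[OF padic_seq_norm_LIMSEQ[of X] padic_seq_norm_LIMSEQ[of Y]]
      in \<open>simp add: times_padic_seq.rep_eq padic_abs_mult[OF prime_card]\<close>)

lemma padic_seq_norm_add: "padic_seq_norm (X + Y) \<le> max (padic_seq_norm X) (padic_seq_norm Y)"
  by (rule LIMSEQ_le[OF padic_seq_norm_LIMSEQ
        tendsto_max[OF padic_seq_norm_LIMSEQ[of X] padic_seq_norm_LIMSEQ[of Y]]])
     (simp add: plus_padic_seq.rep_eq padic_abs_add_le_max[OF prime_card])

lemma padic_seq_norm_minus: "padic_seq_norm (- X) = padic_seq_norm X"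
  by (simp add: padic_seq_norm.rep_eq uminus_padic_seq.rep_eq)

definition padic_rel :: "'p::prime_card padic_seq \<Rightarrow> 'p padic_seq \<Rightarrow> bool" where
  "padic_rel X Y \<longleftrightarrow> padic_seq_norm (X - Y) = 0"

lemma padic_rel_ideal:
  "padic_seq_norm X = 0 \<Longrightarrow> padic_seq_norm Y = 0 \<Longrightarrow> padic_seq_norm (X + Y) = 0"
  using padic_seq_norm_add[of X Y] padic_seq_norm_nonneg[of "X + Y"] by simp

lemma padic_rel_norm: "padic_rel X Y \<Longrightarrow> padic_seq_norm X = padic_seq_norm Y"
  using padic_seq_norm_add[of Y "X - Y"] padic_seq_norm_add[of X "Y - X"]
    padic_seq_norm_minus[of "X - Y"] padic_seq_norm_nonneg[of X] padic_seq_norm_nonneg[of Y]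
  by (simp add: padic_rel_def)

quotient_type 'p padic = "'p::prime_card padic_seq" / padic_rel
proof (rule equivpI)
  have "padic_seq_norm (0 :: 'p padic_seq) = 0"
    by (simp add: padic_seq_norm_eq_0_iff zero_padic_seq.rep_eq)
  thus "reflp (padic_rel :: 'p padic_seq \<Rightarrow> _)" by (simp add: reflp_def padic_rel_def)
  show "symp (padic_rel :: 'p padic_seq \<Rightarrow> _)"
    by (rule sympI) (metis padic_rel_def padic_seq_norm_minus minus_diff_eq)
  show "transp (padic_rel :: 'p padic_seq \<Rightarrow> _)"
  proof (rule transpI)
    fix X Y Z :: "'p padic_seq"
    assume "padic_rel X Y" "padic_rel Y Z"
    hence "padic_seq_norm ((X - Y) + (Y - Z)) = 0" unfolding padic_rel_def by (rule padic_rel_ideal)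
    thus "padic_rel X Z" by (simp add: padic_rel_def)
  qed
qed

lemma padic_seq_right_inverse:
  assumes "padic_seq_norm X \<noteq> 0" shows "padic_rel (X * padic_seq_inverse X) (1 :: 'p::prime_card padic_seq)"
proof -
  have nz: "\<not> (\<lambda>n. padic_abs CARD('p) (Rep_padic_seq X n)) \<longlonglongrightarrow> 0"
    using assms by (simp add: padic_seq_norm_eq_0_iff)
  have "padic_seq_norm X > 0" using assms padic_seq_norm_nonneg[of X] by simp
  hence "\<forall>\<^sub>F n in sequentially. padic_abs CARD('p) (Rep_padic_seq X n) > 0"
    by (rule order_tendstoD(1)[OF padic_seq_norm_LIMSEQ])
  hence "\<forall>\<^sub>F n in sequentially. padic_abs CARD('p) (Rep_padic_seq (X * padic_seq_inverse X - 1) n) = 0"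
  proof eventually_elim
    case (elim n)
    hence "Rep_padic_seq X n \<noteq> 0" by auto
    thus ?case using nz
      by (simp add: Rep_padic_seq_minus times_padic_seq.rep_eq padic_seq_inverse.rep_eq one_padic_seq.rep_eq)
  qed
  thus ?thesis unfolding padic_rel_def padic_seq_norm_eq_0_iff by (rule tendsto_eventually)
qed

lemma padic_seq_inverse_cong:
  assumes "padic_rel X Y" shows "padic_rel (padic_seq_inverse X) (padic_seq_inverse Y)"
proof (cases "padic_seq_norm X = 0")
  case True
  moreover have "padic_seq_norm Y = 0" using True padic_rel_norm[OF assms] by simp
  ultimately have "padic_seq_inverse X = padic_seq_inverse Y"
    by (simp add: padic_seq_norm_eq_0_iff padic_seq_inverse_def)
  thus ?thesis using padic.abs_eq_iff by metis
next
  case False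
  let ?X = "padic_seq_inverse X" and ?Y = "padic_seq_inverse Y"
  have FY: "padic_seq_norm Y \<noteq> 0" using False padic_rel_norm[OF assms] by simp
  have z: "padic_seq_norm (A * B) = 0" if "padic_seq_norm A = 0" for A B :: "'a padic_seq"
    using that by (simp add: padic_seq_norm_mult)
  have "?X - ?Y = (X * ?X - 1) * ?Y + (Y * ?Y - 1) * (- ?X) + (X - Y) * (- (?X * ?Y))"
    by (simp add: algebra_simps)
  moreover have "padic_seq_norm \<dots> = 0"
    using assms padic_seq_right_inverse[OF False] padic_seq_right_inverse[OF FY]
    unfolding padic_rel_def by (intro padic_rel_ideal z) auto
  ultimately show ?thesis by (simp add: padic_rel_def)
qed

instantiation padic :: (prime_card) field
begin
lift_definition zero_padic :: "'a padic" is 0 .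
lift_definition one_padic :: "'a padic" is 1 .
lift_definition plus_padic :: "'a padic \<Rightarrow> 'a padic \<Rightarrow> 'a padic" is "(+)"
proof -
  fix X X' Y Y' :: "'a padic_seq"
  assume "padic_rel X X'" "padic_rel Y Y'"
  hence "padic_seq_norm ((X - X') + (Y - Y')) = 0"
    unfolding padic_rel_def by (rule padic_rel_ideal)
  thus "padic_rel (X + Y) (X' + Y')" by (simp add: padic_rel_def add_diff_add)
qed
lift_definition uminus_padic :: "'a padic \<Rightarrow> 'a padic" is uminus
proof -
  fix X Y :: "'a padic_seq"
  assume "padic_rel X Y"
  moreover have "- X - - Y = - (X - Y)" by simp
  ultimately show "padic_rel (- X) (- Y)" by (simp only: padic_rel_def padic_seq_norm_minus)
qed
definition minus_padic :: "'a padic \<Rightarrow> 'a padic \<Rightarrow> 'a padic"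
  where "minus_padic x y = x + - y"
lift_definition times_padic :: "'a padic \<Rightarrow> 'a padic \<Rightarrow> 'a padic" is "(*)"
proof -
  fix X X' Y Y' :: "'a padic_seq"
  assume "padic_rel X X'" "padic_rel Y Y'"
  hence "padic_seq_norm ((X - X') * Y + X' * (Y - Y')) = 0"
    unfolding padic_rel_def by (intro padic_rel_ideal) (simp_all add: padic_seq_norm_mult)
  thus "padic_rel (X * Y) (X' * Y')" by (simp add: padic_rel_def algebra_simps)
qed
lift_definition inverse_padic :: "'a padic \<Rightarrow> 'a padic" is padic_seq_inverse
  by (rule padic_seq_inverse_cong)
definition divide_padic :: "'a padic \<Rightarrow> 'a padic \<Rightarrow> 'a padic"
  where "divide_padic x y = x * inverse y"
instance
proof
  fix a b c :: "'a padic"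
  have eqI: "padic_rel X Y" if "X = Y" for X Y :: "'a padic_seq"
    using that padic.abs_eq_iff by metis
  show "a + b + c = a + (b + c)" by transfer (rule eqI, simp add: algebra_simps)
  show "a + b = b + a" by transfer (rule eqI, simp add: algebra_simps)
  show "0 + a = a" by transfer (rule eqI, simp add: algebra_simps)
  show "- a + a = 0" by transfer (rule eqI, simp add: algebra_simps)
  show "a - b = a + - b" by (rule minus_padic_def)
  show "a * b * c = a * (b * c)" by transfer (rule eqI, simp add: algebra_simps)
  show "a * b = b * a" by transfer (rule eqI, simp add: algebra_simps)
  show "1 * a = a" by transfer (rule eqI, simp add: algebra_simps)
  show "(a + b) * c = a * c + b * c" by transfer (rule eqI, simp add: algebra_simps)
  show "(0 :: 'a padic) \<noteq> 1"
  proof transfer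
    show "\<not> padic_rel 0 (1 :: 'a padic_seq)"
      unfolding padic_rel_def padic_seq_norm_eq_0_iff Rep_padic_seq_minus
        zero_padic_seq.rep_eq one_padic_seq.rep_eq by (simp add: LIMSEQ_const_iff)
  qed
  show "inverse a * a = 1" if "a \<noteq> 0"
    using that
  proof transfer
    fix X :: "'a padic_seq"
    assume "\<not> padic_rel X 0"
    thus "padic_rel (padic_seq_inverse X * X) 1"
      using padic_seq_right_inverse[of X] by (simp add: padic_rel_def mult.commute)
  qed
  show "a div b = a * inverse b" by (rule divide_padic_def)
  show "inverse (0 :: 'a padic) = 0"
  proof transfer
    have "padic_seq_inverse 0 = (0 :: 'a padic_seq)"
      by (rule Rep_padic_seq_inject[THEN iffD1])
         (simp add: padic_seq_inverse.rep_eq zero_padic_seq.rep_eq)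
    thus "padic_rel (padic_seq_inverse 0) (0 :: 'a padic_seq)" by (rule eqI)
  qed
qed
end

lift_definition padic_norm :: "'p::prime_card padic \<Rightarrow> real" is padic_seq_norm
  by (rule padic_rel_norm)

lemma padic_norm_nonneg [simp]: "padic_norm (x :: 'p::prime_card padic) \<ge> 0"
  by transfer (rule padic_seq_norm_nonneg)

lemma padic_norm_eq_0_iff [simp]: "padic_norm (x :: 'p::prime_card padic) = 0 \<longleftrightarrow> x = 0"
  by transfer (simp add: padic_rel_def)

lemma padic_norm_mult: "padic_norm (x * y :: 'p::prime_card padic) = padic_norm x * padic_norm y"
  by transfer (rule padic_seq_norm_mult)

lemma padic_norm_add_le_max: "padic_norm (x + y :: 'p::prime_card padic) \<le> max (padic_norm x) (padic_norm y)"
  by transfer (rule padic_seq_norm_add)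

lemma padic_norm_minus [simp]: "padic_norm (- x :: 'p::prime_card padic) = padic_norm x"
  by transfer (rule padic_seq_norm_minus)

lift_definition padic_seq_const :: "rat \<Rightarrow> 'p::prime_card padic_seq" is "\<lambda>q _. q"
  by (rule padic_Cauchy_const)

lift_definition padic_const :: "rat \<Rightarrow> 'p::prime_card padic" is padic_seq_const .

lemma padic_norm_const: "padic_norm (padic_const q :: 'p::prime_card padic) = padic_abs CARD('p) q"
  by transfer (simp add: padic_seq_norm.rep_eq padic_seq_const.rep_eq)

lemma padic_const_simps:
  "padic_const 0 = (0 :: 'p::prime_card padic)" "padic_const 1 = (1 :: 'p padic)"
  "padic_const (a + b) = (padic_const a + padic_const b :: 'p padic)"
  "padic_const (a * b) = (padic_const a * padic_const b :: 'p padic)"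
proof -
  have 1: "padic_seq_const 0 = (0 :: 'p padic_seq)" "padic_seq_const 1 = (1 :: 'p padic_seq)"
    "padic_seq_const (a + b) = (padic_seq_const a + padic_seq_const b :: 'p padic_seq)"
    "padic_seq_const (a * b) = (padic_seq_const a * padic_seq_const b :: 'p padic_seq)"
    by (transfer; simp)+
  show "padic_const 0 = (0 :: 'p padic)" "padic_const 1 = (1 :: 'p padic)"
    unfolding padic_const.abs_eq zero_padic_def one_padic_def by (simp_all only: 1)
  show "padic_const (a + b) = (padic_const a + padic_const b :: 'p padic)"
    unfolding padic_const.abs_eq plus_padic.abs_eq by (simp only: 1)
  show "padic_const (a * b) = (padic_const a * padic_const b :: 'p padic)"
    unfolding padic_const.abs_eq times_padic.abs_eq by (simp only: 1)
qed

lemma padic_const_of_nat: "padic_const (of_nat n) = of_nat n"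
  by (induction n) (simp_all add: padic_const_simps)

instance padic :: (prime_card) field_char_0
proof
  show "inj (of_nat :: nat \<Rightarrow> 'a padic)"
  proof (rule injI)
    fix m n :: nat
    assume eq: "of_nat m = (of_nat n :: 'a padic)"
    have *: "m = n" if "m \<le> n" "of_nat m = (of_nat n :: 'a padic)" for m n
    proof -
      have "(of_nat (n - m) :: 'a padic) = 0" using that by (simp add: of_nat_diff)
      hence "padic_norm (padic_const (of_nat (n - m)) :: 'a padic) = 0"
        by (simp add: padic_const_of_nat)
      hence "of_nat (n - m) = (0 :: rat)"
        by (simp only: padic_norm_const padic_abs_eq_0_iff[OF prime_card])
      hence "n - m = 0" by (simp only: of_nat_eq_0_iff)
      thus ?thesis using that by simp
    qed
    show "m = n" using *[of m n] *[of n m] eq by (cases "m \<le> n") auto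
  qed
qed

lemma padic_const_eq_of_rat: "padic_const q = of_rat q"
proof -
  have int: "padic_const (of_int z) = (of_int z :: 'a padic)" for z
  proof -
    have "padic_const (of_int z) + padic_const (of_nat (nat (- z))) = (padic_const (of_nat (nat z)) :: 'a padic)"
      by (subst padic_const_simps(3)[symmetric]) (cases "z \<ge> 0", auto)
    moreover have "of_int z + of_nat (nat (- z)) = (of_nat (nat z) :: 'a padic)"
      by (cases "z \<ge> 0") auto
    ultimately show ?thesis by (simp only: padic_const_of_nat) (metis add_right_cancel)
  qed
  obtain a b where ab: "quotient_of q = (a, b)" by force
  have q: "q = of_int a / of_int b" and b: "b > 0"
    using ab quotient_of_div quotient_of_denom_pos by auto
  have "padic_const q * of_int b = (of_int a :: 'a padic)"
    using b by (simp add: int[symmetric] padic_const_simps(4)[symmetric] q)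
  hence "padic_const q = (of_int a / of_int b :: 'a padic)"
    using b by (simp add: field_simps)
  thus ?thesis by (simp add: q of_rat_divide)
qed

lemma padic_norm_of_rat: "padic_norm (of_rat q :: 'p::prime_card padic) = padic_abs CARD('p) q"
  by (simp only: padic_const_eq_of_rat[symmetric] padic_norm_const)

lemma padic_norm_triangle: "padic_norm (x + y) \<le> padic_norm x + padic_norm y"
  using padic_norm_add_le_max[of x y] padic_norm_nonneg[of x] padic_norm_nonneg[of y] by linarith

lemma padic_norm_minus_commute: "padic_norm (x - y) = padic_norm (y - x)"
  using padic_norm_minus[of "x - y"] by simp

instantiation padic :: (prime_card) metric_space
begin
definition dist_padic :: "'a padic \<Rightarrow> 'a padic \<Rightarrow> real"
  where "dist_padic x y = padic_norm (x - y)"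
definition uniformity_padic :: "('a padic \<times> 'a padic) filter"
  where "uniformity_padic = (INF e\<in>{0<..}. principal {(x, y). dist x y < e})"
definition open_padic :: "'a padic set \<Rightarrow> bool"
  where "open_padic U \<longleftrightarrow> (\<forall>x\<in>U. eventually (\<lambda>(x', y). x' = x \<longrightarrow> y \<in> U) uniformity)"
instance
proof
  fix x y z :: "'a padic" and U :: "'a padic set"
  show "uniformity = (INF e\<in>{0<..}. principal {(x :: 'a padic, y). dist x y < e})"
    by (rule uniformity_padic_def)
  show "open U \<longleftrightarrow> (\<forall>x\<in>U. eventually (\<lambda>(x', y). x' = x \<longrightarrow> y \<in> U) uniformity)"
    by (rule open_padic_def)
  show "dist x y = 0 \<longleftrightarrow> x = y" by (simp add: dist_padic_def)
  show "dist x y \<le> dist x z + dist y z"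
    using padic_norm_triangle[of "x - z" "z - y"]
    by (simp add: dist_padic_def padic_norm_minus_commute[of z y])
qed
end

lemma padic_seq_approx:
  assumes "e > 0"
  shows "\<exists>q. padic_seq_norm (X - padic_seq_const q) < (e :: real)"
proof -
  obtain N where N: "\<And>m n. m \<ge> N \<Longrightarrow> n \<ge> N \<Longrightarrow>
      padic_abs CARD('a) (Rep_padic_seq X m - Rep_padic_seq X n) < e / 2"
    using Rep_padic_seq[of X] half_gt_zero[OF assms] unfolding mem_Collect_eq padic_Cauchy_def by blast
  have "padic_seq_norm (X - padic_seq_const (Rep_padic_seq X N)) \<le> e / 2"
    by (rule LIMSEQ_le_const2[OF padic_seq_norm_LIMSEQ])
       (use N in \<open>auto simp: Rep_padic_seq_minus padic_seq_const.rep_eq intro!: exI[of _ N] less_imp_le\<close>)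
  thus ?thesis using assms by (intro exI[of _ "Rep_padic_seq X N"]) linarith
qed

lemma padic_norm_abs_padic: "padic_norm (abs_padic X) = padic_seq_norm X"
  by (rule padic_norm.abs_eq)

lemma abs_padic_diff_of_rat: "abs_padic X - of_rat q = abs_padic (X - padic_seq_const q)"
  unfolding padic_const_eq_of_rat[symmetric] padic_const.abs_eq minus_padic_def
  unfolding uminus_padic.abs_eq plus_padic.abs_eq minus_padic_seq_def ..

lemma padic_rat_dense:
  assumes "e > 0" shows "\<exists>q. dist x (of_rat q :: 'p::prime_card padic) < e"
proof -
  obtain X where "x = abs_padic X" by (induct x rule: padic.abs_induct) blast
  thus ?thesis using padic_seq_approx[OF assms, of X]
    by (simp add: dist_padic_def abs_padic_diff_of_rat padic_norm_abs_padic)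
qed

instance padic :: (prime_card) complete_space
proof
  fix S :: "nat \<Rightarrow> 'a padic"
  assume S: "Cauchy S"
  have "\<exists>q. dist (S n) (of_rat q) < inverse (real (Suc n))" for n
    by (rule padic_rat_dense) simp
  then obtain r where r: "\<And>n. dist (S n) (of_rat (r n)) < inverse (real (Suc n))" by metis
  have r0: "(\<lambda>n. dist (S n) (of_rat (r n))) \<longlonglongrightarrow> 0"
    by (rule Lim_null_comparison[OF _ LIMSEQ_inverse_real_of_nat]) (use r in \<open>auto intro!: always_eventually less_imp_le\<close>)
  have "padic_Cauchy CARD('a) r"
    unfolding padic_Cauchy_def
  proof (intro allI impI)
    fix e :: real assume e: "e > 0"
    hence e3: "e / 3 > 0" by simp
    obtain N where N: "\<And>m n. m \<ge> N \<Longrightarrow> n \<ge> N \<Longrightarrow> dist (S m) (S n) < e / 3"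
      using metric_CauchyD[OF S e3] by blast
    obtain K where K: "\<And>n. n \<ge> K \<Longrightarrow> dist (S n) (of_rat (r n)) < e / 3"
      using order_tendstoD(2)[OF r0 e3] by (auto simp: eventually_sequentially)
    show "\<exists>N. \<forall>m\<ge>N. \<forall>n\<ge>N. padic_abs CARD('a) (r m - r n) < e"
    proof (intro exI[of _ "max N K"] allI impI)
      fix m n assume mn: "max N K \<le> m" "max N K \<le> n"
      have "dist (of_rat (r m)) (of_rat (r n) :: 'a padic)
          \<le> dist (S m) (of_rat (r m)) + (dist (S m) (S n) + dist (S n) (of_rat (r n)))"
        using dist_triangle[of "of_rat (r m)" "of_rat (r n)" "S m"]
          dist_triangle[of "S m" "of_rat (r n)" "S n"] dist_commute[of "of_rat (r m)" "S m"]
        by linarith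
      also have "\<dots> < e" using N[of m n] K[of m] K[of n] mn by simp
      finally show "padic_abs CARD('a) (r m - r n) < e"
        by (simp add: dist_padic_def of_rat_diff[symmetric] padic_norm_of_rat)
    qed
  qed
  define R :: "'a padic_seq" where "R = Abs_padic_seq r"
  have R: "Rep_padic_seq R = r"
    unfolding R_def by (rule Abs_padic_seq_inverse) (simp add: \<open>padic_Cauchy CARD('a) r\<close>)
  have "(\<lambda>n. dist (of_rat (r n)) (abs_padic R)) \<longlonglongrightarrow> 0"
  proof (rule metric_LIMSEQ_I)
    fix e :: real assume e: "e > 0"
    obtain N where N: "\<And>m n. m \<ge> N \<Longrightarrow> n \<ge> N \<Longrightarrow> padic_abs CARD('a) (r m - r n) < e / 2"
      using \<open>padic_Cauchy CARD('a) r\<close> half_gt_zero[OF e] unfolding padic_Cauchy_def by blast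
    show "\<exists>N. \<forall>n\<ge>N. dist (dist (of_rat (r n)) (abs_padic R)) 0 < e"
    proof (intro exI[of _ N] allI impI)
      fix n assume n: "n \<ge> N"
      have "padic_seq_norm (R - padic_seq_const (r n)) \<le> e / 2"
        by (rule LIMSEQ_le_const2[OF padic_seq_norm_LIMSEQ])
           (use N n in \<open>auto simp: Rep_padic_seq_minus padic_seq_const.rep_eq R intro!: exI[of _ N] less_imp_le\<close>)
      thus "dist (dist (of_rat (r n)) (abs_padic R)) 0 < e"
        using e by (simp add: dist_commute[of _ "abs_padic R"])
           (simp add: dist_padic_def abs_padic_diff_of_rat padic_norm_abs_padic)
    qed
  qed
  hence "(\<lambda>n. dist (S n) (of_rat (r n)) + dist (of_rat (r n)) (abs_padic R)) \<longlonglongrightarrow> 0"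
    using tendsto_add[OF r0] by fastforce
  hence "(\<lambda>n. dist (S n) (abs_padic R)) \<longlonglongrightarrow> 0"
    by (rule Lim_null_comparison[rotated]) (simp add: dist_triangle)
  hence "S \<longlonglongrightarrow> abs_padic R" by (rule tendsto_dist_iff[THEN iffD2])
  thus "convergent S" by (rule convergentI)
qed

section \<open>Vectors, matrices and polynomials\<close>

text \<open>
  Vectors and matrices are indexed by a finite linearly ordered type \<open>'n\<close>, playing the role of
  \<open>{1..n}\<close>; its least element plays the role of 1. The type synonyms serve definitions needing
  the order, since the infix notation for vector types insists on the sort \<open>finite\<close>.
\<close>

type_synonym 'n qvec = "(rat, 'n) vec"
type_synonym 'n qmat = "((rat, 'n) vec, 'n) vec"

definition first_index :: "'n::{finite,linorder}" where
  "first_index = Min UNIV"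

definition rat_vec :: "int^'n \<Rightarrow> 'n qvec" where
  "rat_vec x = (\<chi> i. of_int (x $ i))"

text \<open>
  The polynomial ring over the rationals in variables indexed by \<open>'n\<close>: a polynomial maps
  exponent vectors to coefficients, with the convolution product.
\<close>

type_synonym 'n rat_mpoly = "('n \<Rightarrow>\<^sub>0 nat) \<Rightarrow>\<^sub>0 rat"

definition mpoly_const :: "rat \<Rightarrow> 'n rat_mpoly" where
  "mpoly_const c = Poly_Mapping.single 0 c"

definition mpoly_var :: "'n \<Rightarrow> 'n rat_mpoly" where
  "mpoly_var i = Poly_Mapping.single (Poly_Mapping.single i 1) 1"

text \<open>Evaluation in any commutative ring receiving the coefficients through \<open>c\<close>.\<close>

definition mpoly_eval ::
    "(rat \<Rightarrow> 'b) \<Rightarrow> 'n::finite rat_mpoly \<Rightarrow> ('n \<Rightarrow> 'b) \<Rightarrow> 'b::comm_ring_1" where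
  "mpoly_eval c P x =
     (\<Sum>r\<in>Poly_Mapping.keys P. c (Poly_Mapping.lookup P r) *
        (\<Prod>i\<in>UNIV. x i ^ Poly_Mapping.lookup r i))"

text \<open>\<open>(B P)(X) = P(X B)\<close>, with \<open>X\<close> the row vector of the variables.\<close>

definition act_poly :: "'n qmat \<Rightarrow> 'n::finite rat_mpoly \<Rightarrow> 'n rat_mpoly" where
  "act_poly B P =
     mpoly_eval mpoly_const P (\<lambda>j. \<Sum>i\<in>UNIV. mpoly_var i * mpoly_const (B $ i $ j))"

text \<open>\<open>P\<^sub>r(\<sigma>)\<close>, defined by \<open>P(X \<sigma>\<^sup>t) = (\<Sum>r. P\<^sub>r(\<sigma>) X\<^sup>r / r!)\<close>.\<close>

definition taylor_coeff :: "'n qmat \<Rightarrow> 'n::finite rat_mpoly \<Rightarrow> ('n \<Rightarrow>\<^sub>0 nat) \<Rightarrow> rat" where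
  "taylor_coeff \<sigma> P r =
     (\<Prod>j\<in>UNIV. fact (Poly_Mapping.lookup r j)) * Poly_Mapping.lookup (act_poly (transpose \<sigma>) P) r"

text \<open>
  An \<open>m\<close>-tuple of real linear forms is the matrix of its coefficients, \<open>Q $ i $ j = Q\<^sub>i\<^sub>j\<close>, with
  \<open>m = CARD('m)\<close>. The action \<open>(B Q)(x) = Q(x B)\<close> on row vectors \<open>x\<close> amounts to applying \<open>B\<close> to
  the coefficient vector of each form.
\<close>

definition linear_forms :: "(real^'n^'m) set" where
  "linear_forms =
     {Q. \<forall>i. \<forall>x::'n qvec. x \<noteq> 0 \<longrightarrow> (\<Sum>j\<in>UNIV. Q $ i $ j * of_rat (x $ j)) \<noteq> 0}"

definition act_forms :: "'n qmat \<Rightarrow> real^'n^'m \<Rightarrow> real^'n^'m" where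
  "act_forms B Q = (\<chi> i. map_matrix of_rat B *v (Q $ i))"


section \<open>The arithmetic groups\<close>

definition localization_at :: "nat \<Rightarrow> rat set" where
  "localization_at l = {of_int a / of_int b | a b. \<not> int l dvd b}"

definition adjoin_inverse :: "nat \<Rightarrow> rat set" where
  "adjoin_inverse p = {of_int a / of_nat p ^ k | a k. True}"

definition GL_over :: "rat set \<Rightarrow> 'n::finite qmat set" where
  "GL_over R = {A. (\<forall>i j. A $ i $ j \<in> R) \<and>
     (\<exists>B. (\<forall>i j. B $ i $ j \<in> R) \<and> A ** B = mat 1 \<and> B ** A = mat 1)}"

definition Gamma_l :: "nat \<Rightarrow> 'n::{finite,linorder} qmat set" where
  "Gamma_l l = {A \<in> GL_over (localization_at l).
     \<forall>i. i \<noteq> first_index \<longrightarrow> (\<exists>c\<in>localization_at l. A $ i $ first_index = of_nat l * c)}"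

definition Gamma_lp :: "nat \<Rightarrow> nat \<Rightarrow> 'n::{finite,linorder} qmat set" where
  "Gamma_lp l p = Gamma_l l \<inter> GL_over (adjoin_inverse p)"

definition pi_mat :: "nat \<Rightarrow> 'n::{finite,linorder} qmat" where
  "pi_mat l = (\<chi> i j. if i = j then (if i = first_index then of_nat l else 1) else 0)"


section \<open>Bernoulli functions and smoothed Dedekind sums\<close>

text \<open>The Bernoulli polynomials: \<open>t exp(t y) / (exp t - 1) = (\<Sum>k. b\<^sub>k(y) t\<^sup>k / k!)\<close>.\<close>

definition bernoulli_poly :: "nat \<Rightarrow> 'a \<Rightarrow> 'a::field_char_0" where
  "bernoulli_poly k y = fact k * fps_nth (fps_X * fps_exp y / (fps_exp 1 - 1)) k"

definition bernoulli_fun :: "nat \<Rightarrow> 'a \<Rightarrow> 'a::floor_ceiling" where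
  "bernoulli_fun k y =
     (if k = 1 then (if y \<in> \<int> then 0 else frac y - 1 / 2) else bernoulli_poly k (frac y))"

text \<open>
  The values are rational for rational \<open>w\<close>, the only case needed to define a measure with p-adic
  values; hence the polymorphic argument (\<open>real\<close> and \<open>rat\<close> are both instances) and the detour
  through the floor to regard the sign of a real number as an element of \<open>'a\<close>.
\<close>

definition bernoulli_product :: "('n \<Rightarrow> nat) \<Rightarrow> 'a^'n \<Rightarrow> real^'n^'m \<Rightarrow> 'a::floor_ceiling" where
  "bernoulli_product e w Q =
     (let J = {j. e j = 1 \<and> w $ j \<in> \<int>} in
      1 / of_nat CARD('m) *
      (\<Sum>i\<in>UNIV. (\<Prod>j\<in>J. of_int \<lfloor>sgn (Q $ i $ j)\<rfloor> / 2) *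
                (\<Prod>j\<in>- J. bernoulli_fun (e j) (w $ j))))"

text \<open>
  Sum over \<open>\<int>\<^sup>n / T \<int>\<^sup>n\<close> of a function invariant under \<open>T \<int>\<^sup>n\<close>, through arbitrary representatives.
\<close>

definition lattice_rel :: "'n qmat \<Rightarrow> ((int^'n) \<times> (int^'n)) set" where
  "lattice_rel T = {(x, y). \<exists>z. rat_vec x - rat_vec y = T *v rat_vec z}"

definition sum_mod_lattice :: "'n qmat \<Rightarrow> (int^'n \<Rightarrow> 'a::comm_monoid_add) \<Rightarrow> 'a" where
  "sum_mod_lattice T f = (\<Sum>c\<in>UNIV // lattice_rel T. f (SOME x. x \<in> c))"

definition dedekind_sum ::
    "nat \<Rightarrow> 'n::{finite,linorder} qmat \<Rightarrow> ('n \<Rightarrow> nat) \<Rightarrow> ((real, 'n) vec, 'm::finite) vec \<Rightarrow>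
       'n qvec \<Rightarrow> rat" where
  "dedekind_sum l \<sigma> e Q v =
     (if det \<sigma> = 0 then 0 else
      let \<sigma>l = (\<chi> i j. (pi_mat l ** \<sigma>) $ i $ j / of_nat l); Q' = act_forms (matrix_inv \<sigma>) Q in
      sum_mod_lattice \<sigma>l
        (\<lambda>x. bernoulli_product e (matrix_inv \<sigma>l *v (rat_vec x + pi_mat l *v v)) Q')
      - of_nat l powi (1 - int CARD('n) + int (\<Sum>j\<in>UNIV. e j)) *
        sum_mod_lattice \<sigma> (\<lambda>x. bernoulli_product e (matrix_inv \<sigma> *v (rat_vec x + v)) Q'))"

text \<open>
  The Dedekind sums require the columns of \<open>\<sigma>\<close> to be integral. Replacing a first column by a
  positive multiple does not change the value of the cocycle \<open>Psi\<close>, so each first column is first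
  multiplied by the least positive integer clearing its denominators; an integral column is left
  unchanged. For tuples in \<open>Gamma_l l\<close> the matrix \<open>l\<^sup>-\<^sup>1 \<pi>\<^sub>l \<sigma>\<close> is then integral as well.
\<close>

definition clear_denominators :: "'n::finite qvec \<Rightarrow> 'n qvec" where
  "clear_denominators x = of_nat (LEAST d. d > 0 \<and> (\<forall>i. of_nat d * x $ i \<in> \<int>)) *s x"

definition sigma_mat :: "('n \<Rightarrow> 'n qmat) \<Rightarrow> 'n::{finite,linorder} qmat" where
  "sigma_mat B = (\<chi> i j. clear_denominators (column first_index (B j)) $ i)"

text \<open>
  The formula for homogeneous \<open>P\<close> does not involve its degree and is linear in \<open>P\<close>, so that it also
  gives the linear extension to all polynomials. Only the finitely many \<open>r\<close> in the support of
  \<open>P(X \<sigma>\<^sup>t)\<close> contribute.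
\<close>

definition Psi ::
    "nat \<Rightarrow> ('n::{finite,linorder} \<Rightarrow> 'n qmat) \<Rightarrow> 'n rat_mpoly \<Rightarrow>
       ((real, 'n) vec, 'm::finite) vec \<Rightarrow> 'n qvec \<Rightarrow> rat" where
  "Psi l B P Q v =
     (let \<sigma> = sigma_mat B in
      (- 1) ^ CARD('n) * sgn (det \<sigma>) *
      (\<Sum>r\<in>Poly_Mapping.keys (act_poly (transpose \<sigma>) P).
         taylor_coeff \<sigma> P r /
           ((\<Prod>j\<in>UNIV. fact (Poly_Mapping.lookup r j + 1)) *
            of_nat l ^ (\<Sum>j\<in>UNIV. Poly_Mapping.lookup r j)) *
         dedekind_sum l \<sigma> (\<lambda>j. 1 + Poly_Mapping.lookup r j) Q v))"


section \<open>p-adic measures and integration\<close>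

definition Zp_vec :: "('p::prime_card padic^'n) set" where
  "Zp_vec = {x. \<forall>i. padic_norm (x $ i) \<le> 1}"

text \<open>The set \<open>w + M \<int>\<^sub>p\<^sup>n\<close>.\<close>

definition padic_coset :: "'n qvec \<Rightarrow> 'n qmat \<Rightarrow> ('p::prime_card padic^'n) set" where
  "padic_coset w M = (\<lambda>x. (\<chi> i. of_rat (w $ i)) + map_matrix of_rat M *v x) ` Zp_vec"

text \<open>
  A measure on \<open>X\<close>: a bounded finitely additive function on the compact open subsets of \<open>X\<close>,
  given the value 0 on all other sets to make it unique as a function.
\<close>

definition compact_opens :: "'a::topological_space set \<Rightarrow> 'a set set" where
  "compact_opens X = {U. U \<subseteq> X \<and> compact U \<and> open U}"

definition padic_measure ::
    "'a::topological_space set \<Rightarrow> ('a set \<Rightarrow> 'p::prime_card padic) \<Rightarrow> bool" where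
  "padic_measure X \<mu> \<longleftrightarrow>
     (\<forall>U\<in>compact_opens X. \<forall>V\<in>compact_opens X. U \<inter> V = {} \<longrightarrow> \<mu> (U \<union> V) = \<mu> U + \<mu> V) \<and>
     (\<exists>C. \<forall>U\<in>compact_opens X. padic_norm (\<mu> U) \<le> C) \<and>
     (\<forall>U. U \<notin> compact_opens X \<longrightarrow> \<mu> U = 0)"

text \<open>
  \<open>has_padic_integral f I \<mu> U\<close>: the integral of \<open>f\<close> over the compact open set \<open>U\<close> exists and equals
  \<open>I\<close>, that is, the Riemann sums of \<open>f\<close> over finite partitions of \<open>U\<close> into compact open sets tend
  to \<open>I\<close> as the mesh tends to 0.
\<close>

definition compact_open_partition :: "real \<Rightarrow> 'a::metric_space set \<Rightarrow> 'a set set \<Rightarrow> bool" where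
  "compact_open_partition \<delta> U \<C> \<longleftrightarrow>
     finite \<C> \<and> \<Union>\<C> = U \<and> disjoint \<C> \<and> {} \<notin> \<C> \<and>
     (\<forall>C\<in>\<C>. compact C \<and> open C \<and> (\<forall>x\<in>C. \<forall>y\<in>C. dist x y < \<delta>))"

definition has_padic_integral ::
    "('a::metric_space \<Rightarrow> 'p::prime_card padic) \<Rightarrow> 'p padic \<Rightarrow> ('a set \<Rightarrow> 'p padic) \<Rightarrow> 'a set \<Rightarrow> bool" where
  "has_padic_integral f I \<mu> U \<longleftrightarrow>
     (\<forall>\<epsilon>>0. \<exists>\<delta>>0. \<forall>\<C> \<xi>. compact_open_partition \<delta> U \<C> \<and> (\<forall>C\<in>\<C>. \<xi> C \<in> C) \<longrightarrow>
        dist (\<Sum>C\<in>\<C>. f (\<xi> C) * \<mu> C) I < \<epsilon>)"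

text \<open>
  The measure on \<open>v + \<int>\<^sub>p\<^sup>n\<close> attached to a tuple of matrices; \<open>mat c\<close> is the scalar matrix \<open>c\<close>.
\<close>

definition mu_l ::
    "nat \<Rightarrow> ('n::{finite,linorder} \<Rightarrow> 'n qmat) \<Rightarrow> ((real, 'n) vec, 'm::finite) vec \<Rightarrow> 'n qvec \<Rightarrow>
       ('p::prime_card padic, 'n) vec set \<Rightarrow> 'p padic" where
  "mu_l l A Q v = (THE \<mu>. padic_measure (padic_coset v (mat 1)) \<mu> \<and>
     (if det (sigma_mat A) = 0 then \<forall>U. \<mu> U = 0
      else \<forall>a (k::nat).
        \<mu> (padic_coset (v + rat_vec a) (mat (of_nat CARD('p) ^ k))) =
        of_rat (Psi l A 1 Q ((1 / of_nat CARD('p) ^ k) *s (v + rat_vec a)))))"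

end

theory Submission
  imports Defs
begin

text \<open>
  Write \<open>L = \<int>\<^sup>n\<close> and \<open>L' = \<pi>\<^sub>l\<^sup>-\<^sup>1 L\<close>. The distribution relation of the Bernoulli polynomials turns the smoothed
  Dedekind sum into \<open>l\<^sup>r\<close> times the sum over \<open>L' / \<sigma>L\<close> of the periodic Bernoulli product, weighted by
  \<open>1 - l\<close> on \<open>L\<close> and by \<open>1\<close> elsewhere. In this form the cocycle is invariant under positive scaling of the
  columns of \<open>\<sigma>\<close>, equivariant under matrices, and additive under refinement of the lattices, so
  \<open>Psi\<close> at \<open>M\<^sup>-\<^sup>1 A\<close> is a sum, over the balls of radius \<open>p\<^sup>-\<^sup>k\<close> in the coset, of values at the
  scalar matrix \<open>p\<^sup>k\<close>.

  The weight sums to zero along each \<open>\<sigma>\<^sub>j / l\<close>, so every factor \<open>b(z)\<close> may be replaced by a difference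
  \<open>b(z + \<delta>) - b(z)\<close> with \<open>l \<delta>\<close> integral. After scaling by \<open>p\<^sup>k\<^sup>r\<close> only its leading term
  \<open>\<delta> \<omega>\<^sup>r\<close> survives modulo \<open>p\<^sup>k\<close>, where \<open>\<omega>\<close> is a coordinate of the centre \<open>w\<close> of the ball in the basis
  \<open>\<sigma>\<close>. Summed over \<open>r\<close> this says that the value for \<open>P\<close> is congruent to \<open>P(w)\<close> times the
  value for \<open>1\<close>. Hence the values for \<open>1\<close> are bounded and define the measure, and the values for
  \<open>P\<close> are limits of Riemann sums.
\<close>

section \<open>Bernoulli functions\<close>

text \<open>The obstacle is already present at P = 1: Bernoulli polynomials at arguments z with
  denominator p^k have denominators growing with k, so neither boundedness nor a congruence holds
  term by term. In b_{r+1}(z), scaled by p^(kr), the top power of z is the one unbounded term; a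
  difference lowers its degree by one and leaves (r + 1) \<delta> z^r, and the factor r + 1 is
  cancelled by the one separating (r + 1)! from r!. The two lattices have to be refined
  simultaneously, or else the weights would be lost. This is where l \<noteq> p and the shape of the
  first columns enter: M and p^k M^{-1} preserve both L and L', and p is prime to the index l of L
  in L', so one set of representatives serves for both. The values for P form an exactly additive
  system on balls, and the right-hand side is the sum of this system over the coset. Riemann sums
  are compared with it ball by ball; as the norm is ultrametric, the number of balls does not enter
  the error.\<close>

lemma bernoulli_fps_mult:
  fixes y :: "'a::field_char_0"
  shows "(fps_X * fps_exp y / (fps_exp 1 - 1)) * (fps_exp 1 - 1) = (fps_X * fps_exp y :: 'a fps)"
proof -
  have nz: "fps_exp 1 - 1 \<noteq> (0 :: 'a fps)"
    by (auto simp: fps_eq_iff intro!: exI[of _ 1])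
  have "subdegree (fps_exp 1 - 1 :: 'a fps) = 1"
    by (rule subdegreeI) auto
  \<comment> \<open>Quotients of power series are exact only under divisibility: the divisor has
    subdegree 1, and the factor \<open>fps_X\<close> supplies it.\<close>
  hence "fps_exp 1 - 1 dvd (fps_X * fps_exp y :: 'a fps)"
    using nz by (subst fps_dvd_iff) (auto simp: subdegree_mult)
  thus ?thesis by simp
qed

lemma bernoulli_poly_eq_sum:
  fixes y :: "'a::field_char_0"
  shows "bernoulli_poly k y = (\<Sum>i\<le>k. of_nat (k choose i) * bernoulli_poly (k - i) 0 * y ^ i)"
proof -
  let ?D = "fps_exp 1 - 1 :: 'a fps"
  have nz: "?D \<noteq> 0" by (auto simp: fps_eq_iff intro!: exI[of _ 1])
  have "(fps_exp y * (fps_X * fps_exp 0 / ?D)) * ?D = (fps_X * fps_exp y / ?D) * ?D"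
    using bernoulli_fps_mult[of y] bernoulli_fps_mult[of "0::'a"] by (simp add: mult_ac)
  hence *: "fps_X * fps_exp y / ?D = fps_exp y * (fps_X * fps_exp 0 / ?D)"
    using nz by simp
  have "bernoulli_poly k y
      = (\<Sum>i=0..k. fact k * (y ^ i / fact i * fps_nth (fps_X * fps_exp 0 / ?D) (k - i)))"
    unfolding bernoulli_poly_def * fps_mult_nth by (simp add: sum_distrib_left)
  also have "\<dots> = (\<Sum>i\<le>k. of_nat (k choose i) * bernoulli_poly (k - i) 0 * y ^ i)"
    by (intro sum.cong) (auto simp: bernoulli_poly_def binomial_fact field_simps)
  finally show ?thesis .
qed

lemma bernoulli_poly_0: "bernoulli_poly 0 y = (1::'a::field_char_0)"
proof -
  have "fps_nth ((fps_X * fps_exp y / (fps_exp 1 - 1)) * (fps_exp 1 - 1)) 1 = (1::'a)"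
    unfolding bernoulli_fps_mult by simp
  thus ?thesis by (simp add: bernoulli_poly_def fps_mult_nth)
qed

text \<open>The generating series for y = 1 and y = 0 differ by X. So b_1 alone distinguishes the
  two ends of the unit interval, which is why only this index needs a convention at the
  integers.\<close>

lemma bernoulli_poly_one_minus_zero:
  "bernoulli_poly k 1 - bernoulli_poly k 0 = (if k = 1 then 1 else (0::'a::field_char_0))"
proof -
  let ?D = "fps_exp 1 - 1 :: 'a fps"
  have nz: "?D \<noteq> 0" by (auto simp: fps_eq_iff intro!: exI[of _ 1])
  have "(fps_X * fps_exp 1 / ?D - fps_X * fps_exp 0 / ?D) * ?D = fps_X * ?D"
    unfolding left_diff_distrib bernoulli_fps_mult by (simp add: algebra_simps)
  hence *: "fps_X * fps_exp 1 / ?D - fps_X * fps_exp 0 / ?D = fps_X" using nz by simp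
  have "bernoulli_poly k 1 - bernoulli_poly k 0 = fact k * fps_nth (fps_X * fps_exp 1 / ?D - fps_X * fps_exp 0 / ?D) k"
    by (simp add: bernoulli_poly_def algebra_simps)
  thus ?thesis unfolding * by (simp add: fps_X_nth)
qed

lemma bernoulli_poly_1: "bernoulli_poly 1 y = y - (1/2::'a::field_char_0)"
proof -
  let ?F = "fps_X * fps_exp 0 / (fps_exp 1 - 1) :: 'a fps"
  have "fps_nth (?F * (fps_exp 1 - 1)) 2 = (0::'a)"
    unfolding bernoulli_fps_mult by (simp add: numeral_2_eq_2)
  hence "fps_nth ?F 1 + fps_nth ?F 0 / 2 = 0"
    by (simp add: fps_mult_nth numeral_2_eq_2 add.commute)
  moreover have "fps_nth ?F 0 = 1"
    using bernoulli_poly_0[of "0::'a"] by (simp add: bernoulli_poly_def)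
  ultimately have "fps_nth ?F 1 = - (1/2)" by (simp add: add_eq_0_iff2)
  hence "bernoulli_poly 1 0 = - (1/2::'a)" by (simp add: bernoulli_poly_def)
  thus ?thesis using bernoulli_poly_eq_sum[of 1 y] by (simp add: bernoulli_poly_0)
qed

text \<open>Raabe's multiplication formula. The geometric sum of the exp(tX/N), t < N, turns the
  divisor exp(X) - 1 into exp(X/N) - 1, so the sum of the series is N times the series for y with
  X/N in place of X.\<close>

lemma bernoulli_poly_distribution:
  fixes y :: "'a::field_char_0"
  assumes "N > 0"
  shows "of_nat N ^ k * (\<Sum>t<N. bernoulli_poly k ((y + of_nat t) / of_nat N)) = of_nat N * bernoulli_poly k y"
proof -
  let ?D = "fps_exp 1 - 1 :: 'a fps" and ?c = "1 / of_nat N :: 'a"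
  let ?G = "\<lambda>x::'a. fps_X * fps_exp x / ?D"
  let ?E = "fps_exp ?c - 1 :: 'a fps"
  have N: "of_nat N \<noteq> (0::'a)" using assms by simp
  have nz: "?D \<noteq> 0" by (auto simp: fps_eq_iff intro!: exI[of _ 1])
  have nzE: "?E \<noteq> 0" using N by (auto simp: fps_eq_iff intro!: exI[of _ 1])
  have pw: "fps_exp ((y + of_nat t) / of_nat N) = fps_exp (y / of_nat N) * fps_exp ?c ^ t" for t
    by (simp add: fps_exp_power_mult fps_exp_add_mult[symmetric] add_divide_distrib)
  have top: "fps_exp ?c ^ N = fps_exp 1" using N by (simp add: fps_exp_power_mult)
  have geo: "?E * (\<Sum>t<N. fps_exp ?c ^ t) = ?D"
    using power_diff_1_eq[of "fps_exp ?c" N] top by simp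
  let ?S = "\<Sum>t<N. ?G ((y + of_nat t) / of_nat N)"
  have "?S * ?D = (\<Sum>t<N. fps_X * fps_exp ((y + of_nat t) / of_nat N))"
    unfolding sum_distrib_right bernoulli_fps_mult ..
  also have "\<dots> = fps_X * fps_exp (y / of_nat N) * (\<Sum>t<N. fps_exp ?c ^ t)"
    unfolding pw by (simp add: sum_distrib_left mult_ac)
  finally have "?S * ?D = fps_X * fps_exp (y / of_nat N) * (\<Sum>t<N. fps_exp ?c ^ t)" .
  hence "?S * ?D * ?E = fps_X * fps_exp (y / of_nat N) * (\<Sum>t<N. fps_exp ?c ^ t) * ?E"
    by (rule arg_cong[where f = "\<lambda>x. x * ?E"])
  hence "?S * ?E * ?D = fps_X * fps_exp (y / of_nat N) * (?E * (\<Sum>t<N. fps_exp ?c ^ t))"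
    by (simp only: mult_ac)
  hence "?S * ?E * ?D = fps_X * fps_exp (y / of_nat N) * ?D" unfolding geo .
  hence 1: "?S * ?E = fps_X * fps_exp (y / of_nat N)" using nz by simp
  let ?H = "fps_compose (?G y) (fps_const ?c * fps_X)"
  have cX: "fps_compose (fps_X * fps_exp y) (fps_const ?c * fps_X) = fps_const ?c * fps_X * fps_exp (y / of_nat N)"
    by (subst fps_compose_mult_distrib) (simp_all add: fps_exp_compose_linear)
  have "?H * fps_compose ?D (fps_const ?c * fps_X) = fps_compose (fps_X * fps_exp y) (fps_const ?c * fps_X)"
    by (subst (2) bernoulli_fps_mult[of y, symmetric]) (rule fps_compose_mult_distrib[symmetric], simp)
  hence "?H * ?E = fps_const ?c * fps_X * fps_exp (y / of_nat N)"
    by (simp add: cX fps_compose_sub_distrib fps_exp_compose_linear)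
  hence "fps_const (of_nat N) * ?H * ?E = (fps_const (of_nat N) * fps_const ?c) * (fps_X * fps_exp (y / of_nat N))"
    by (simp only: mult_ac)
  also have "fps_const (of_nat N) * fps_const ?c = 1" using N by simp
  finally have "fps_const (of_nat N) * ?H * ?E = ?S * ?E" unfolding 1 by simp
  hence 2: "?S = fps_const (of_nat N) * ?H" using nzE by simp
  have "(\<Sum>t<N. bernoulli_poly k ((y + of_nat t) / of_nat N)) = fact k * fps_nth ?S k"
    by (simp add: bernoulli_poly_def fps_sum_nth sum_distrib_left)
  also have "\<dots> = of_nat N * (?c ^ k * bernoulli_poly k y)"
    unfolding 2 by (simp add: fps_compose_linear bernoulli_poly_def)
  finally show ?thesis using N by (simp add: power_one_over)
qed

text \<open>
  The fractional part with values in the half-open interval closed on the left (\<open>u = False\<close>) or on the right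
  (\<open>u = True\<close>). Evaluating Bernoulli polynomials at it incorporates the factors \<open>sgn Q\<^sub>i\<^sub>j / 2\<close>
  which replace \<open>B\<^sub>1\<close> at the integers: the sign \<open>+\<close> corresponds to the left limit \<open>b\<^sub>1(1)\<close> and
  the sign \<open>-\<close> to the right limit \<open>b\<^sub>1(0)\<close>.
\<close>

definition side_frac :: "bool \<Rightarrow> rat \<Rightarrow> rat" where
  "side_frac u y = (if u then y - of_int (\<lceil>y\<rceil> - 1) else frac y)"

lemma side_frac_range:
  "0 \<le> side_frac u y" "side_frac u y \<le> 1" "u \<Longrightarrow> 0 < side_frac u y" "\<not> u \<Longrightarrow> side_frac u y < 1"
  unfolding side_frac_def using frac_ge_0[of y] frac_lt_1[of y] ceiling_correct[of y]
  by (auto simp: split: if_splits)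

lemma side_frac_diff_Ints: "y - side_frac u y \<in> \<int>"
  by (auto simp: side_frac_def frac_def)

lemma side_frac_add_int [simp]: "side_frac u (y + of_int k) = side_frac u y"
  by (simp add: side_frac_def frac_def)

lemma side_frac_id:
  assumes "0 \<le> y" "y \<le> 1" "u \<Longrightarrow> 0 < y" "\<not> u \<Longrightarrow> y < 1"
  shows "side_frac u y = y"
proof (cases u)
  case True
  hence "\<lceil>y\<rceil> = 1" using assms by (intro ceiling_unique) auto
  thus ?thesis using True by (simp add: side_frac_def)
next
  case False
  thus ?thesis using assms by (simp add: side_frac_def frac_eq)
qed

definition periodic_bernoulli :: "bool \<Rightarrow> nat \<Rightarrow> rat \<Rightarrow> rat" where
  "periodic_bernoulli u k y = bernoulli_poly k (side_frac u y)"

lemma periodic_bernoulli_add_int [simp]: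
  "periodic_bernoulli u k (y + of_int i) = periodic_bernoulli u k y"
  by (simp add: periodic_bernoulli_def)

lemma periodic_bernoulli_Ints:
  assumes "y \<in> \<int>"
  shows "periodic_bernoulli u 1 y = (if u then 1 else - 1) / 2"
proof -
  obtain i where i: "y = 0 + of_int i" using assms by (auto elim: Ints_cases)
  show ?thesis unfolding i periodic_bernoulli_add_int
    by (simp only: periodic_bernoulli_def bernoulli_poly_1) (simp add: side_frac_def)
qed

text \<open>At integers the side \<open>u = True\<close> uses the argument 1 in place of 0; for k
  \<noteq> 1 this is invisible because the endpoint values agree.\<close>

lemma periodic_bernoulli_eq_bernoulli_fun:
  assumes "k \<noteq> 1 \<or> y \<notin> \<int>"
  shows "periodic_bernoulli u k y = bernoulli_fun k y"
proof (cases "y \<in> \<int>")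
  case True
  then obtain i where i: "y = 0 + of_int i" by (auto elim: Ints_cases)
  have k: "k \<noteq> 1" using assms True by simp
  show ?thesis
    using k bernoulli_poly_one_minus_zero[of k, where 'a = rat] unfolding i periodic_bernoulli_add_int
    by (auto simp: periodic_bernoulli_def side_frac_def bernoulli_fun_def)
next
  case False
  hence "\<lceil>y\<rceil> = \<lfloor>y\<rfloor> + 1" by (metis ceiling_altdef Ints_of_int)
  hence "side_frac u y = frac y" by (simp add: side_frac_def frac_def)
  thus ?thesis using False bernoulli_poly_1[of "frac y"]
    by (simp add: periodic_bernoulli_def bernoulli_fun_def)
qed

text \<open>With z the one-sided fractional part of y, all points (z + t)/N with 0 \<le> t < N stay
  in the half-open interval that contains z, so no reduction is left and the polynomial relation
  applies.\<close>

lemma periodic_bernoulli_distribution: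
  assumes N: "N > 0"
  shows "of_nat N ^ k * (\<Sum>t<N. periodic_bernoulli u k ((y + of_nat t) / of_nat N))
      = of_nat N * periodic_bernoulli u k y"
proof -
  define z where "z = side_frac u y"
  have Nq: "of_nat N > (0::rat)" using N by simp
  have "y - z \<in> \<int>" unfolding z_def by (rule side_frac_diff_Ints)
  then obtain i where i: "y = z + of_int i" by (metis Ints_cases add.commute diff_add_cancel)
  let ?f = "\<lambda>s::int. periodic_bernoulli u k ((z + of_int s) / of_nat N)"
  have per: "?f (s mod int N) = ?f s" for s
  proof -
    have "(z + of_int s) / of_nat N = (z + of_int (s mod int N)) / of_nat N + of_int (s div int N)"
    proof -
      have "s = s mod int N + int N * (s div int N)" by simp
      hence "(of_int s :: rat) = of_int (s mod int N) + of_nat N * of_int (s div int N)"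
        by (metis of_int_add of_int_mult of_int_of_nat_eq)
      thus ?thesis using N by (simp add: field_simps)
    qed
    thus ?thesis by simp
  qed
  have "(\<Sum>t<N. periodic_bernoulli u k ((y + of_nat t) / of_nat N)) = (\<Sum>t<N. ?f (int t + i))"
    unfolding i by (simp add: algebra_simps)
  also have "\<dots> = (\<Sum>t<N. ?f ((int t + i) mod int N))" by (simp only: per)
  \<comment> \<open>Rotation of the residues modulo N absorbs the integer y - z.\<close>
  also have "\<dots> = (\<Sum>t<N. ?f (int t))"
  proof (rule sum.reindex_bij_witness[of _ "\<lambda>t. nat ((int t - i) mod int N)" "\<lambda>t. nat ((int t + i) mod int N)"])
    fix t assume "t \<in> {..<N}"
    thus "nat ((int (nat ((int t + i) mod int N)) - i) mod int N) = t"
      "nat ((int (nat ((int t - i) mod int N)) + i) mod int N) = t"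
      using N by (simp_all add: mod_diff_left_eq mod_add_left_eq)
  qed (use N in \<open>auto simp: nat_less_iff\<close>)
  also have "\<dots> = (\<Sum>t<N. bernoulli_poly k ((z + of_nat t) / of_nat N))"
  proof (intro sum.cong refl)
    fix t assume t: "t \<in> {..<N}"
    have r: "0 \<le> z" "z \<le> 1" "u \<Longrightarrow> 0 < z" "\<not> u \<Longrightarrow> z < 1" unfolding z_def by (rule side_frac_range; assumption)+
    have tN: "of_nat t + 1 \<le> (of_nat N :: rat)" using t by (metis Suc_leI lessThan_iff of_nat_Suc of_nat_le_iff add.commute)
    have "side_frac u ((z + of_nat t) / of_nat N) = (z + of_nat t) / of_nat N"
    proof (rule side_frac_id)
      show "0 \<le> (z + of_nat t) / of_nat N" using r Nq by simp
      show "(z + of_nat t) / of_nat N \<le> 1" using r Nq tN by (simp add: divide_le_eq)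
      show "0 < (z + of_nat t) / of_nat N" if u using r(3)[OF that] Nq by (simp add: add_pos_nonneg)
      show "(z + of_nat t) / of_nat N < 1" if "\<not> u" using r(4)[OF that] Nq tN by (simp add: divide_less_eq)
    qed
    thus "?f (int t) = bernoulli_poly k ((z + of_nat t) / of_nat N)" by (simp add: periodic_bernoulli_def)
  qed
  finally show ?thesis
    using bernoulli_poly_distribution[OF N, of k z] by (simp add: periodic_bernoulli_def z_def)
qed

section \<open>Transversals of lattices\<close>

definition add_subgroup :: "'a::ab_group_add set \<Rightarrow> bool" where
  "add_subgroup A \<longleftrightarrow> 0 \<in> A \<and> (\<forall>x\<in>A. \<forall>y\<in>A. x - y \<in> A)"

lemma add_subgroupD:
  assumes "add_subgroup A"
  shows "0 \<in> A" "x \<in> A \<Longrightarrow> y \<in> A \<Longrightarrow> x - y \<in> A" "x \<in> A \<Longrightarrow> - x \<in> A"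
    "x \<in> A \<Longrightarrow> y \<in> A \<Longrightarrow> x + y \<in> A"
proof -
  show 0: "0 \<in> A" and d: "x \<in> A \<Longrightarrow> y \<in> A \<Longrightarrow> x - y \<in> A" for x y
    using assms by (auto simp: add_subgroup_def)
  show m: "x \<in> A \<Longrightarrow> - x \<in> A" for x using d[OF 0, of x] by simp
  show "x \<in> A \<Longrightarrow> y \<in> A \<Longrightarrow> x + y \<in> A" using d[of x "- y"] m[of y] by simp
qed

lemma add_subgroup_image:
  assumes "add_subgroup A" "\<And>x y. h (x - y) = h x - h y"
  shows "add_subgroup (h ` A)"
  using assms(1) unfolding add_subgroup_def
  by (auto simp: assms(2)[symmetric]) (metis assms(2) diff_self image_eqI)

text \<open>Quotients A/B are handled through sets of representatives rather than types of cosets: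
  this lets one set serve for several pairs of groups, on which the refinement of the smoothed sums
  relies.\<close>

definition transversal :: "'a::ab_group_add set \<Rightarrow> 'a set \<Rightarrow> 'a set \<Rightarrow> bool" where
  "transversal S A B \<longleftrightarrow> finite S \<and> S \<subseteq> A \<and> (\<forall>x\<in>A. \<exists>!s. s \<in> S \<and> x - s \<in> B)"

lemma transversalI:
  assumes "finite S" "S \<subseteq> A" "add_subgroup B" "\<And>x. x \<in> A \<Longrightarrow> \<exists>s\<in>S. x - s \<in> B"
    and "\<And>s t. s \<in> S \<Longrightarrow> t \<in> S \<Longrightarrow> s - t \<in> B \<Longrightarrow> s = t"
  shows "transversal S A B"
  unfolding transversal_def
proof (intro conjI ballI ex_ex1I)
  fix x s t assume *: "x \<in> A" "s \<in> S \<and> x - s \<in> B" "t \<in> S \<and> x - t \<in> B"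
  have "(x - t) - (x - s) \<in> B" using * assms(3) by (blast intro: add_subgroupD)
  thus "s = t" using assms(5)[of s t] * by simp
qed (use assms(1,2,4) in auto)

lemma transversalD:
  assumes "transversal S A B"
  shows "finite S" "S \<subseteq> A" "x \<in> A \<Longrightarrow> \<exists>s\<in>S. x - s \<in> B"
    and "s \<in> S \<Longrightarrow> t \<in> S \<Longrightarrow> s - t \<in> B \<Longrightarrow> 0 \<in> B \<Longrightarrow> s = t"
proof -
  show "finite S" "S \<subseteq> A" "x \<in> A \<Longrightarrow> \<exists>s\<in>S. x - s \<in> B"
    using assms by (auto simp: transversal_def)
  assume s: "s \<in> S" "t \<in> S" "s - t \<in> B" "0 \<in> B"
  hence "\<exists>!r. r \<in> S \<and> s - r \<in> B" using assms unfolding transversal_def by blast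
  thus "s = t" using s by (metis diff_self)
qed

lemma transversal_sum_eq:
  assumes B: "add_subgroup B" and S: "transversal S A B" and T: "transversal T A B"
    and f: "\<And>x y. x \<in> A \<Longrightarrow> y \<in> A \<Longrightarrow> x - y \<in> B \<Longrightarrow> f x = f y"
  shows "sum f S = sum f T"
proof -
  note B' = add_subgroupD[OF B]
  define g where "g S x = (THE s. s \<in> S \<and> x - s \<in> B)" for S x
  have g: "g S x \<in> S" "x - g S x \<in> B" if "transversal S A B" "x \<in> A" for S x
    using theI'[of "\<lambda>s. s \<in> S \<and> x - s \<in> B"] that unfolding transversal_def g_def by blast+
  have inv: "g S (g T s) = s" if ST: "transversal S A B" "transversal T A B" "s \<in> S" for S T s
  proof -
    have s: "s \<in> A" using transversalD(2)[OF ST(1)] ST(3) by blast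
    have t: "g T s \<in> A" using transversalD(2)[OF ST(2)] g[OF ST(2) s] by blast
    have "(s - g T s) + (g T s - g S (g T s)) \<in> B"
      by (rule B'(4)[OF g(2)[OF ST(2) s] g(2)[OF ST(1) t]])
    thus ?thesis using transversalD(4)[OF ST(1) ST(3) g(1)[OF ST(1) t]] B' by simp
  qed
  have A: "s \<in> A" if "s \<in> S" for s using transversalD(2)[OF S] that by blast
  have A': "s \<in> A" if "s \<in> T" for s using transversalD(2)[OF T] that by blast
  show ?thesis
  proof (rule sum.reindex_bij_witness[of _ "g S" "g T"])
    fix s assume s: "s \<in> S"
    show "g S (g T s) = s" by (rule inv[OF S T s])
    show "g T s \<in> T" by (rule g(1)[OF T A[OF s]])
    have "s - g T s \<in> B" by (rule g(2)[OF T A[OF s]])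
    thus "f (g T s) = f s" using f[of s "g T s"] A[OF s] A'[OF \<open>g T s \<in> T\<close>] by simp
  next
    fix t assume t: "t \<in> T"
    show "g T (g S t) = t" by (rule inv[OF T S t])
    show "g S t \<in> S" by (rule g(1)[OF S A'[OF t]])
  qed
qed

definition coset_sum :: "'a::ab_group_add set \<Rightarrow> 'a set \<Rightarrow> ('a \<Rightarrow> 'b::comm_monoid_add) \<Rightarrow> 'b" where
  "coset_sum A B f = sum f (SOME S. transversal S A B)"

lemma coset_sum_eq:
  assumes "transversal S A B" "add_subgroup B"
    and "\<And>x y. x \<in> A \<Longrightarrow> y \<in> A \<Longrightarrow> x - y \<in> B \<Longrightarrow> f x = f y"
  shows "coset_sum A B f = sum f S"
  unfolding coset_sum_def
  by (rule transversal_sum_eq[OF assms(2) _ assms(1)]) (use assms in \<open>auto intro: someI\<close>)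


lemma transversal_tower:
  assumes "add_subgroup A" "add_subgroup B" "add_subgroup C" "C \<subseteq> B" "B \<subseteq> A"
    and S: "transversal S A B" and T: "transversal T B C"
  shows "transversal ((\<lambda>(s, t). s + t) ` (S \<times> T)) A C" "inj_on (\<lambda>(s, t). s + t) (S \<times> T)"
proof -
  note A = add_subgroupD[OF assms(1)] and B = add_subgroupD[OF assms(2)] and C = add_subgroupD[OF assms(3)]
  have eq: "s = s' \<and> t = t'" if *: "s \<in> S" "s' \<in> S" "t \<in> T" "t' \<in> T" "(s + t) - (s' + t') \<in> C" for s s' t t'
  proof -
    have tB: "t \<in> B" "t' \<in> B" using transversalD(2)[OF T] * by auto
    have "((s + t) - (s' + t')) - (t - t') \<in> B" using tB *(5) assms(4) by (intro B(2)[of "_ - _" "t - t'"] B(2)[of t t']) auto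
    hence "s - s' \<in> B" by (simp add: algebra_simps)
    hence "s = s'" using transversalD(4)[OF S] * B by blast
    moreover from this have "t - t' \<in> C" using *(5) by (simp add: algebra_simps)
    hence "t = t'" using transversalD(4)[OF T] * C by blast
    ultimately show ?thesis by simp
  qed
  show "inj_on (\<lambda>(s, t). s + t) (S \<times> T)"
    using eq C(1) by (auto simp: inj_on_def)
  show "transversal ((\<lambda>(s, t). s + t) ` (S \<times> T)) A C"
  proof (rule transversalI)
    show "finite ((\<lambda>(s, t). s + t) ` (S \<times> T))" using transversalD(1) S T by blast
    show "(\<lambda>(s, t). s + t) ` (S \<times> T) \<subseteq> A"
    proof clarsimp
      fix s t assume "s \<in> S" "t \<in> T"
      thus "s + t \<in> A" using transversalD(2)[OF S] transversalD(2)[OF T] assms(5) by (intro A(4)) auto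
    qed
    show "add_subgroup C" by fact
    fix x assume "x \<in> A"
    then obtain s where s: "s \<in> S" "x - s \<in> B" using transversalD(3)[OF S] by blast
    then obtain t where t: "t \<in> T" "x - s - t \<in> C" using transversalD(3)[OF T] by blast
    hence "x - (s + t) \<in> C" by (simp add: algebra_simps)
    thus "\<exists>r\<in>(\<lambda>(s, t). s + t) ` (S \<times> T). x - r \<in> C" using s(1) t(1) by auto
  next
    fix r r' assume "r \<in> (\<lambda>(s, t). s + t) ` (S \<times> T)" "r' \<in> (\<lambda>(s, t). s + t) ` (S \<times> T)" "r - r' \<in> C"
    thus "r = r'" using eq by auto
  qed
qed

lemma transversal_tower_sum:
  assumes "add_subgroup A" "add_subgroup B" "add_subgroup C" "C \<subseteq> B" "B \<subseteq> A"
    and S: "transversal S A B" and T: "transversal T B C" and R: "transversal R A C"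
    and f: "\<And>x y. x \<in> A \<Longrightarrow> y \<in> A \<Longrightarrow> x - y \<in> C \<Longrightarrow> f x = f y"
  shows "(\<Sum>r\<in>R. f r) = (\<Sum>s\<in>S. \<Sum>t\<in>T. f (s + t))"
proof -
  note * = transversal_tower[OF assms(1-7)]
  have "(\<Sum>r\<in>R. f r) = sum f ((\<lambda>(s, t). s + t) ` (S \<times> T))"
    by (rule transversal_sum_eq[OF assms(3) R *(1) f])
  also have "\<dots> = (\<Sum>s\<in>S. \<Sum>t\<in>T. f (s + t))"
    by (subst sum.reindex[OF *(2)]) (simp add: sum.cartesian_product case_prod_beta o_def)
  finally show ?thesis .
qed

lemma transversal_image:
  assumes "transversal S A B" "add_subgroup B" "inj h" "\<And>x y. h (x - y) = h x - h y"
  shows "transversal (h ` S) (h ` A) (h ` B)"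
proof (rule transversalI)
  show "add_subgroup (h ` B)" by (rule add_subgroup_image[OF assms(2,4)])
  show "finite (h ` S)" "h ` S \<subseteq> h ` A" using transversalD[OF assms(1)] by auto
  show "\<exists>s\<in>h ` S. x - s \<in> h ` B" if "x \<in> h ` A" for x
    using that transversalD(3)[OF assms(1)] by (force simp: assms(4)[symmetric])
  show "s = t" if "s \<in> h ` S" "t \<in> h ` S" "s - t \<in> h ` B" for s t
  proof -
    obtain x y where "x \<in> S" "y \<in> S" "s = h x" "t = h y" using \<open>s \<in> h ` S\<close> \<open>t \<in> h ` S\<close> by blast
    moreover from this have "x - y \<in> B"
      using that(3) assms(3) by (simp add: assms(4)[symmetric] inj_image_mem_iff)
    ultimately show ?thesis using transversalD(4)[OF assms(1)] add_subgroupD(1)[OF assms(2)] by blast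
  qed
qed

text \<open>Each class of A modulo B is labelled by an element \<open>g x\<close> of the finite set
  F congruent to it; \<open>h\<close> turns labels into elements of A, as F itself may stick out of
  A.\<close>

lemma ex_transversal:
  assumes A: "add_subgroup A" and B: "add_subgroup B" and F: "finite F" "\<And>x. x \<in> A \<Longrightarrow> \<exists>s\<in>F. x - s \<in> B"
  shows "\<exists>S. transversal S A B"
proof -
  note B' = add_subgroupD[OF B]
  define h where "h s = (SOME x. x \<in> A \<and> x - s \<in> B)" for s
  define g where "g x = (SOME s. s \<in> F \<and> x - s \<in> B)" for x
  have g: "g x \<in> F" "x - g x \<in> B" if "x \<in> A" for x
    using someI_ex[of "\<lambda>s. s \<in> F \<and> x - s \<in> B"] F(2)[OF that] unfolding g_def by blast+
  have h: "h s \<in> A" "h s - s \<in> B" if "x \<in> A" "x - s \<in> B" for s x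
    using someI_ex[of "\<lambda>x. x \<in> A \<and> x - s \<in> B"] that unfolding h_def by blast+
  have gg: "g x = g y" if "x - y \<in> B" for x y
  proof -
    have "(x - s \<in> B) = (y - s \<in> B)" for s
    proof
      assume "x - s \<in> B" hence "(x - s) - (x - y) \<in> B" using that by (rule B'(2))
      thus "y - s \<in> B" by simp
    next
      assume "y - s \<in> B" hence "(y - s) + (x - y) \<in> B" using that by (rule B'(4))
      thus "x - s \<in> B" by simp
    qed
    thus ?thesis by (simp add: g_def)
  qed
  have hg: "h (g x) - g x \<in> B" "h (g x) \<in> A" if "x \<in> A" for x using g[OF that] h that by blast+
  have hgx: "x - h (g x) \<in> B" if "x \<in> A" for x
  proof -
    have "(x - g x) - (h (g x) - g x) \<in> B" by (rule B'(2)[OF g(2)[OF that] hg(1)[OF that]])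
    thus ?thesis by simp
  qed
  have "transversal ((h \<circ> g) ` A) A B"
  proof (rule transversalI[OF _ _ B])
    have "(h \<circ> g) ` A \<subseteq> h ` F" using g by auto
    thus "finite ((h \<circ> g) ` A)" using F(1) by (meson finite_imageI finite_subset)
    show "(h \<circ> g) ` A \<subseteq> A" using hg by auto
    show "\<exists>s\<in>(h \<circ> g) ` A. x - s \<in> B" if "x \<in> A" for x using hgx[OF that] that by auto
    fix s t assume st: "s \<in> (h \<circ> g) ` A" "t \<in> (h \<circ> g) ` A" "s - t \<in> B"
    then obtain x y where xy: "x \<in> A" "y \<in> A" "s = h (g x)" "t = h (g y)" by auto
    have "(x - s) + (s - t) - (y - t) \<in> B" using hgx xy st by (intro B'(2)[of "_ + _" "y - t"] B'(4)[of "x - s"]) auto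
    hence "g x = g y" by (intro gg) simp
    thus "s = t" using xy by simp
  qed
  thus ?thesis by blast
qed

section \<open>Lattices in rational space and their finite quotients\<close>

definition int_lattice :: "(rat^'n) set" where
  "int_lattice = {x. \<forall>i. x $ i \<in> \<int>}"

lemma int_lattice_eq_range: "int_lattice = range rat_vec"
proof -
  have "x \<in> range rat_vec" if "\<forall>i. x $ i \<in> \<int>" for x :: "rat^'n"
  proof -
    have "x = rat_vec (\<chi> i. \<lfloor>x $ i\<rfloor>)" using that by (simp add: rat_vec_def vec_eq_iff)
    thus ?thesis by blast
  qed
  thus ?thesis by (auto simp: int_lattice_def rat_vec_def)
qed

lemma rat_vec_in_int_lattice [simp]: "rat_vec x \<in> int_lattice"
  by (simp add: int_lattice_eq_range)

lemma rat_vec_inject [simp]: "rat_vec x = rat_vec y \<longleftrightarrow> x = y"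
  by (simp add: rat_vec_def vec_eq_iff)

lemma rat_vec_diff: "rat_vec (x - y) = rat_vec x - rat_vec y"
  by (simp add: rat_vec_def vec_eq_iff)


lemma add_subgroup_int_lattice [simp]: "add_subgroup int_lattice"
  by (auto simp: add_subgroup_def int_lattice_def)

definition matrix_lattice :: "rat^'n^'n \<Rightarrow> (rat^'n) set" where
  "matrix_lattice g = (*v) g ` int_lattice"

lemma add_subgroup_matrix_lattice [simp]: "add_subgroup (matrix_lattice g)"
  unfolding matrix_lattice_def by (rule add_subgroup_image) (auto simp: matrix_vector_mult_diff_distrib)

lemma matrix_lattice_mult: "matrix_lattice (g ** h) = (*v) g ` matrix_lattice h"
  by (auto simp: matrix_lattice_def matrix_vector_mul_assoc image_image)

lemma matrix_lattice_1 [simp]: "matrix_lattice (mat 1) = int_lattice"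
  by (simp add: matrix_lattice_def)

lemma mat_vector_mult: "mat c *v x = (c :: 'a::comm_semiring_1) *s x"
  by (simp add: vec_eq_iff matrix_vector_mult_def mat_def if_distrib[where f = "\<lambda>x. x * _"] cong: if_cong)

definition diag_mat :: "('n \<Rightarrow> 'a::zero) \<Rightarrow> 'a^'n^'n" where
  "diag_mat d = (\<chi> i j. if i = j then d i else 0)"

lemma diag_mat_vec [simp]: "(diag_mat d *v x) $ i = (d i :: 'a::semiring_1) * x $ i"
proof -
  have "(\<Sum>j\<in>UNIV. (if i = j then d i else 0) * x $ j) = (\<Sum>j\<in>UNIV. if i = j then d i * x $ i else 0)"
    by (intro sum.cong) auto
  thus ?thesis by (simp add: diag_mat_def matrix_vector_mult_def)
qed

lemma diag_mat_const: "diag_mat (\<lambda>_. c) = mat c"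
  by (simp add: diag_mat_def mat_def)

definition int_box :: "('n \<Rightarrow> nat) \<Rightarrow> (int^'n) set" where
  "int_box d = {x. \<forall>i. 0 \<le> x $ i \<and> x $ i < int (d i)}"

lemma bij_betw_int_box:
  "bij_betw (\<lambda>f. \<chi> i. int (f i)) (PiE UNIV (\<lambda>i. {..<d i})) (int_box d)"
proof (rule bij_betw_byWitness[of _ "\<lambda>x i. nat (x $ i)"])
  show "(\<lambda>x i. nat (x $ i)) ` int_box d \<subseteq> PiE UNIV (\<lambda>i. {..<d i})"
    by (auto simp: int_box_def nat_less_iff)
qed (auto simp: int_box_def vec_eq_iff PiE_def)

lemma finite_int_box [simp]: "finite (int_box d)"
  using bij_betw_finite[OF bij_betw_int_box[of d]] by (simp add: finite_PiE)

lemma sum_int_box_prod: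
  fixes g :: "'n::finite \<Rightarrow> int \<Rightarrow> 'b::comm_semiring_1"
  shows "(\<Sum>x\<in>int_box d. \<Prod>j\<in>UNIV. g j (x $ j)) = (\<Prod>j\<in>UNIV. \<Sum>t<d j. g j (int t))"
  by (subst prod_sum_PiE) (simp_all add: sum.reindex_bij_betw[OF bij_betw_int_box, symmetric])

text \<open>Division with remainder in each coordinate.\<close>

lemma transversal_int_box:
  fixes d :: "'n::finite \<Rightarrow> nat"
  assumes d: "\<And>i. d i > 0"
  shows "transversal (rat_vec ` int_box d) int_lattice (matrix_lattice (diag_mat (\<lambda>i. of_nat (d i))))"
proof (rule transversalI)
  show "finite (rat_vec ` int_box d)" by simp
  show "rat_vec ` int_box d \<subseteq> int_lattice" by auto
  show "add_subgroup (matrix_lattice (diag_mat (\<lambda>i. of_nat (d i))))" by simp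
next
  fix x :: "rat^'n" assume "x \<in> int_lattice"
  then obtain z where x: "x = rat_vec z" by (auto simp: int_lattice_eq_range)
  define s :: "int^'n" where "s = (\<chi> i. z $ i mod int (d i))"
  define q :: "int^'n" where "q = (\<chi> i. z $ i div int (d i))"
  have "s \<in> int_box d" using d by (auto simp: s_def int_box_def)
  moreover have "x - rat_vec s = diag_mat (\<lambda>i. of_nat (d i)) *v rat_vec q"
  proof -
    have "(of_int (z $ i) :: rat) - of_int (z $ i mod int (d i)) = of_nat (d i) * of_int (z $ i div int (d i))" for i
    proof -
      have "z $ i = z $ i mod int (d i) + int (d i) * (z $ i div int (d i))" by simp
      hence "(of_int (z $ i) :: rat) = of_int (z $ i mod int (d i) + int (d i) * (z $ i div int (d i)))" by simp
      thus ?thesis unfolding of_int_add of_int_mult by simp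
    qed
    thus ?thesis by (simp add: x vec_eq_iff rat_vec_def s_def q_def)
  qed
  ultimately show "\<exists>s\<in>rat_vec ` int_box d. x - s \<in> matrix_lattice (diag_mat (\<lambda>i. of_nat (d i)))"
    unfolding matrix_lattice_def by (metis imageI rat_vec_in_int_lattice)
next
  fix s t :: "rat^'n"
  assume *: "s \<in> rat_vec ` int_box d" "t \<in> rat_vec ` int_box d" "s - t \<in> matrix_lattice (diag_mat (\<lambda>i. of_nat (d i)))"
  then obtain a b q where ab: "a \<in> int_box d" "b \<in> int_box d" "s = rat_vec a" "t = rat_vec b"
    "rat_vec a - rat_vec b = diag_mat (\<lambda>i. of_nat (d i)) *v rat_vec q"
    by (auto simp: int_lattice_eq_range matrix_lattice_def)
  have "a $ i = b $ i" for i
  proof -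
    have "(of_int (a $ i - b $ i) :: rat) = of_int (int (d i) * q $ i)"
      using arg_cong[OF ab(5), of "\<lambda>x. x $ i"] by (simp add: rat_vec_def)
    hence "a $ i - b $ i = int (d i) * q $ i" by (simp only: of_int_eq_iff)
    hence "a $ i = b $ i + int (d i) * q $ i" by simp
    hence "a $ i mod int (d i) = b $ i mod int (d i)" by simp
    thus ?thesis using ab(1,2) by (simp add: int_box_def)
  qed
  hence "a = b" by (simp add: vec_eq_iff)
  thus "s = t" using ab by simp
qed

lemma common_denominator:
  fixes F :: "rat set"
  assumes "finite F"
  shows "\<exists>N::nat. N > 0 \<and> (\<forall>x\<in>F. of_nat N * x \<in> \<int>)"
  using assms
proof (induction F)
  case (insert x F)
  then obtain N :: nat where N: "N > 0" "\<forall>x\<in>F. of_nat N * x \<in> \<int>" by blast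
  obtain a b where ab: "quotient_of x = (a, b)" by force
  have b: "b > 0" "x = of_int a / of_int b" using ab quotient_of_denom_pos quotient_of_div by auto
  have 1: "of_nat (nat b * N) * y \<in> \<int>" if "y \<in> F" for y
  proof -
    have "of_nat (nat b) * (of_nat N * y) \<in> \<int>" using N that by (intro Ints_mult[of _ "_ * y"]) auto
    thus ?thesis by (simp only: of_nat_mult mult.assoc)
  qed
  have 2: "of_nat (nat b * N) * x = of_nat N * of_int a"
    using b by (simp add: of_nat_nat)
  show ?case using 1 2 N b by (intro exI[of _ "nat b * N"]) auto
qed (auto intro: exI[of _ 1])

lemma matrix_clear_denominators:
  "\<exists>N::nat. N > 0 \<and> (\<forall>x\<in>int_lattice. of_nat N *s ((T :: rat^'n^'m) *v x) \<in> int_lattice)"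
proof -
  obtain N :: nat where N: "N > 0" "\<forall>x\<in>(\<lambda>(i, j). T $ i $ j) ` UNIV. of_nat N * x \<in> \<int>"
    using common_denominator[of "(\<lambda>(i, j). T $ i $ j) ` UNIV"] by auto
  have "of_nat N *s (T *v x) \<in> int_lattice" if "x \<in> int_lattice" for x
  proof -
    have "of_nat N * (\<Sum>j\<in>UNIV. T $ i $ j * x $ j) \<in> \<int>" for i
      unfolding sum_distrib_left mult.assoc[symmetric]
      using N(2) that by (intro Ints_sum Ints_mult[of "_ * _"]) (auto simp: int_lattice_def)
    thus ?thesis by (simp add: int_lattice_def matrix_vector_mult_def)
  qed
  thus ?thesis using N(1) by blast
qed

lemma matrix_inv_mult:
  fixes A :: "rat^'n^'n"
  assumes "det A \<noteq> 0"
  shows "A ** matrix_inv A = mat 1" "matrix_inv A ** A = mat 1"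
proof -
  have "invertible A" using assms invertible_det_nz by blast
  thus "A ** matrix_inv A = mat 1" "matrix_inv A ** A = mat 1"
    using someI_ex[of "\<lambda>A'. A ** A' = mat 1 \<and> A' ** A = mat 1"]
    unfolding invertible_def matrix_inv_def by blast+
qed

lemma matrix_inv_vec:
  fixes A :: "rat^'n^'n"
  assumes "det A \<noteq> 0"
  shows "A *v (matrix_inv A *v x) = x" "matrix_inv A *v (A *v x) = x"
  using matrix_inv_mult[OF assms] by (simp_all add: matrix_vector_mul_assoc)

lemma inj_matrix_vec:
  fixes A :: "rat^'n^'n"
  assumes "det A \<noteq> 0" shows "inj ((*v) A)"
  by (rule inj_on_inverseI[of _ "(*v) (matrix_inv A)"]) (simp add: matrix_inv_vec assms)

text \<open>If N clears the denominators of g^{-1}h, then N h Z^n lies in g Z^n, so the images under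
  h of a box of side N meet every class.\<close>

lemma ex_transversal_matrix_lattice:
  fixes g h :: "rat^'n^'n"
  assumes "det g \<noteq> 0" shows "\<exists>S. transversal S (matrix_lattice h) (matrix_lattice g)"
proof -
  obtain N :: nat where N: "N > 0" "\<forall>x\<in>int_lattice. of_nat N *s ((matrix_inv g ** h) *v x) \<in> int_lattice"
    using matrix_clear_denominators[of "matrix_inv g ** h"] by blast
  show ?thesis
  proof (rule ex_transversal)
    show "finite ((*v) h ` rat_vec ` int_box (\<lambda>_. N))" by simp
    fix x assume "x \<in> matrix_lattice h"
    then obtain z where z: "z \<in> int_lattice" "x = h *v z" by (auto simp: matrix_lattice_def)
    then obtain s q where s: "s \<in> rat_vec ` int_box (\<lambda>_. N)" "q \<in> int_lattice" "z - s = of_nat N *s q"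
      using transversalD(3)[OF transversal_int_box[of "\<lambda>_. N"] z(1)] N(1)
      by (auto simp: matrix_lattice_def diag_mat_const mat_vector_mult)
    have "x - h *v s = h *v (of_nat N *s q)"
      using s(3) z(2) by (simp flip: matrix_vector_mult_diff_distrib)
    also have "\<dots> = g *v (of_nat N *s ((matrix_inv g ** h) *v q))"
      by (simp add: matrix_vector_mul_assoc[symmetric] vector_scalar_commute matrix_inv_vec[OF assms])
    finally have "x - h *v s \<in> matrix_lattice g" using N(2) s(2) by (auto simp: matrix_lattice_def)
    thus "\<exists>s\<in>(*v) h ` rat_vec ` int_box (\<lambda>_. N). x - s \<in> matrix_lattice g" using s(1) by blast
  qed auto
qed

text \<open>Bridge from the sum over equivalence classes of integer vectors to transversals in
  rational space: the representatives chosen in the classes form a transversal themselves.\<close>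

lemma sum_mod_lattice_eq:
  fixes T :: "'n::finite qmat"
  assumes S: "transversal S int_lattice (matrix_lattice T)"
    and f: "\<And>x y. x \<in> int_lattice \<Longrightarrow> y \<in> int_lattice \<Longrightarrow> x - y \<in> matrix_lattice T \<Longrightarrow> f x = f y"
  shows "sum_mod_lattice T (\<lambda>x. f (rat_vec x)) = sum f S"
proof -
  let ?R = "lattice_rel T"
  note B = add_subgroupD[OF add_subgroup_matrix_lattice[of T]]
  have R: "(x, y) \<in> ?R \<longleftrightarrow> rat_vec x - rat_vec y \<in> matrix_lattice T" for x y
    by (auto simp: lattice_rel_def matrix_lattice_def int_lattice_eq_range)
  have eq: "equiv UNIV ?R"
  proof (rule equivI)
    show "refl ?R" using B(1) by (auto simp: refl_on_def R)
    show "sym ?R"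
    proof (rule symI)
      fix x y assume "(x, y) \<in> ?R" thus "(y, x) \<in> ?R" using B(3)[of "rat_vec x - rat_vec y"] by (simp add: R)
    qed
    show "trans ?R"
    proof (rule transI)
      fix x y z assume "(x, y) \<in> ?R" "(y, z) \<in> ?R"
      thus "(x, z) \<in> ?R" using B(4)[of "rat_vec x - rat_vec y" "rat_vec y - rat_vec z"] by (simp add: R)
    qed
  qed auto
  define g where "g c = (SOME x. x \<in> c)" for c :: "(int^'n) set"
  have g: "g c \<in> c" if "c \<in> UNIV // ?R" for c
    using in_quotient_imp_non_empty[OF eq that] unfolding g_def by (simp add: some_in_eq)
  have gc: "c = ?R `` {g c}" if "c \<in> UNIV // ?R" for c
  proof -
    obtain x where x: "c = ?R `` {x}" using \<open>c \<in> UNIV // ?R\<close> by (rule quotientE)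
    hence "(x, g c) \<in> ?R" using g[OF that] by blast
    from x equiv_class_eq[OF eq this] show ?thesis by (rule trans)
  qed
  let ?T = "rat_vec ` g ` (UNIV // ?R)"
  have inj: "inj_on (\<lambda>c. rat_vec (g c)) (UNIV // ?R)"
  proof (rule inj_onI)
    fix c d assume cd: "c \<in> UNIV // ?R" "d \<in> UNIV // ?R" "rat_vec (g c) = rat_vec (g d)"
    hence "g c = g d" by simp
    thus "c = d" using gc[OF cd(1)] gc[OF cd(2)] by simp
  qed
  define k where "k x = (THE s. s \<in> S \<and> x - s \<in> matrix_lattice T)" for x
  have k: "k x \<in> S" "x - k x \<in> matrix_lattice T" if "x \<in> int_lattice" for x
    using theI'[of "\<lambda>s. s \<in> S \<and> x - s \<in> matrix_lattice T"] S that unfolding transversal_def k_def by blast+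
  have fin: "finite (UNIV // ?R)"
  proof (rule inj_on_finite)
    show "(\<lambda>c. k (rat_vec (g c))) ` (UNIV // ?R) \<subseteq> S" using k by auto
    show "finite S" using S by (rule transversalD)
    show "inj_on (\<lambda>c. k (rat_vec (g c))) (UNIV // ?R)"
    proof (rule inj_onI)
      fix c d assume cd: "c \<in> UNIV // ?R" "d \<in> UNIV // ?R" "k (rat_vec (g c)) = k (rat_vec (g d))"
      have "(rat_vec (g c) - k (rat_vec (g c))) - (rat_vec (g d) - k (rat_vec (g d))) \<in> matrix_lattice T"
        by (intro B(2)[of "_ - k _" "_ - k _"] k) auto
      hence "(g c, g d) \<in> ?R" using cd(3) by (simp add: R)
      hence "?R `` {g c} = ?R `` {g d}" using eq by (simp add: equiv_class_eq)
      thus "c = d" using gc cd by metis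
    qed
  qed
  have T: "transversal ?T int_lattice (matrix_lattice T)"
  proof (rule transversalI)
    show "finite ?T" using fin by simp
    show "?T \<subseteq> int_lattice" by auto
    fix x :: "rat^'n" assume "x \<in> int_lattice"
    then obtain z where z: "x = rat_vec z" by (auto simp: int_lattice_eq_range)
    let ?c = "?R `` {z}"
    have c: "?c \<in> UNIV // ?R" by (rule quotientI) simp
    have "(z, g ?c) \<in> ?R" using g[OF c] by blast
    thus "\<exists>s\<in>?T. x - s \<in> matrix_lattice T" using c z by (auto simp: R)
  next
    fix s t assume *: "s \<in> ?T" "t \<in> ?T" "s - t \<in> matrix_lattice T"
    then obtain c d where cd: "c \<in> UNIV // ?R" "d \<in> UNIV // ?R" "s = rat_vec (g c)" "t = rat_vec (g d)" by auto
    hence "(g c, g d) \<in> ?R" using * by (simp add: R)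
    hence "?R `` {g c} = ?R `` {g d}" using eq by (simp add: equiv_class_eq)
    hence "c = d" using gc cd by metis
    thus "s = t" using cd by simp
  qed auto
  have "sum f S = sum f ?T" by (rule transversal_sum_eq[OF _ S T f]) auto
  also have "\<dots> = (\<Sum>c\<in>UNIV // ?R. f (rat_vec (g c)))"
    unfolding image_image by (rule sum.reindex[OF inj, unfolded o_def])
  finally show ?thesis by (simp add: sum_mod_lattice_def g_def)
qed

section \<open>Linear substitutions in polynomials\<close>

text \<open>The coefficient map is kept variable so that substitution (\<open>mpoly_const\<close>)
  and evaluation at rational points (the identity) are instances of the same lemmas.\<close>

definition rat_ring_hom :: "(rat \<Rightarrow> 'b::comm_ring_1) \<Rightarrow> bool" where
  "rat_ring_hom c \<longleftrightarrow> c 0 = 0 \<and> c 1 = 1 \<and> (\<forall>x y. c (x + y) = c x + c y) \<and> (\<forall>x y. c (x * y) = c x * c y)"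

lemma rat_ring_homD:
  assumes "rat_ring_hom c"
  shows "c 0 = 0" "c 1 = 1" "c (x + y) = c x + c y" "c (x * y) = c x * c y"
  using assms by (auto simp: rat_ring_hom_def)


lemma rat_ring_hom_mpoly_const: "rat_ring_hom (mpoly_const :: rat \<Rightarrow> 'n rat_mpoly)"
  by (simp add: rat_ring_hom_def mpoly_const_def single_add mult_single)

lemma poly_mapping_eq_sum_single:
  "P = (\<Sum>r\<in>Poly_Mapping.keys P. Poly_Mapping.single r (Poly_Mapping.lookup P r))"
proof (rule poly_mapping_eqI)
  fix k
  have "(\<Sum>r\<in>Poly_Mapping.keys P. Poly_Mapping.lookup (Poly_Mapping.single r (Poly_Mapping.lookup P r)) k)
      = (\<Sum>r\<in>Poly_Mapping.keys P. if r = k then Poly_Mapping.lookup P k else 0)"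
    by (intro sum.cong) (auto simp: lookup_single when_def)
  thus "Poly_Mapping.lookup P k = Poly_Mapping.lookup (\<Sum>r\<in>Poly_Mapping.keys P. Poly_Mapping.single r (Poly_Mapping.lookup P r)) k"
    by (simp add: lookup_sum not_in_keys_iff_lookup_eq_zero)
qed

context
  fixes c :: "rat \<Rightarrow> 'b::comm_ring_1"
  assumes c: "rat_ring_hom c"
begin

lemmas coeff_hom = rat_ring_homD[OF c]

lemma mpoly_eval_superset:
  assumes "finite K" "Poly_Mapping.keys P \<subseteq> K"
  shows "mpoly_eval c P x = (\<Sum>r\<in>K. c (Poly_Mapping.lookup P r) * (\<Prod>i\<in>UNIV. x i ^ Poly_Mapping.lookup r i))"
  unfolding mpoly_eval_def
  by (rule sum.mono_neutral_left) (use assms in \<open>auto simp: in_keys_iff coeff_hom\<close>)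

lemma mpoly_eval_0 [simp]: "mpoly_eval c 0 x = 0"
  by (simp add: mpoly_eval_def)

lemma mpoly_eval_add: "mpoly_eval c (P + R) x = mpoly_eval c P x + mpoly_eval c R x"
proof -
  let ?K = "Poly_Mapping.keys P \<union> Poly_Mapping.keys R"
  have "Poly_Mapping.keys (P + R) \<subseteq> ?K" by (rule keys_add)
  thus ?thesis
    by (subst (1 2 3) mpoly_eval_superset[of ?K]) (auto simp: lookup_add coeff_hom distrib_right sum.distrib)
qed

lemma mpoly_eval_sum: "mpoly_eval c (sum f A) x = (\<Sum>a\<in>A. mpoly_eval c (f a) x)"
  by (induction A rule: infinite_finite_induct) (simp_all add: mpoly_eval_add)

lemma mpoly_eval_single:
  "mpoly_eval c (Poly_Mapping.single r a) x = c a * (\<Prod>i\<in>UNIV. x i ^ Poly_Mapping.lookup r i)"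
  by (subst mpoly_eval_superset[of "{r}"]) auto

lemma mpoly_eval_mult: "mpoly_eval c (P * R) x = mpoly_eval c P x * mpoly_eval c R x"
proof -
  let ?s = "\<lambda>P r. Poly_Mapping.single r (Poly_Mapping.lookup P r)"
  have "P * R = (\<Sum>r\<in>Poly_Mapping.keys P. ?s P r) * (\<Sum>q\<in>Poly_Mapping.keys R. ?s R q)"
    by (simp flip: poly_mapping_eq_sum_single)
  also have "\<dots> = (\<Sum>r\<in>Poly_Mapping.keys P. \<Sum>q\<in>Poly_Mapping.keys R.
      Poly_Mapping.single (r + q) (Poly_Mapping.lookup P r * Poly_Mapping.lookup R q))"
    by (simp add: sum_product mult_single)
  finally have "mpoly_eval c (P * R) x = mpoly_eval c \<dots> x" by simp
  also have "\<dots> = mpoly_eval c P x * mpoly_eval c R x"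
    unfolding mpoly_eval_sum mpoly_eval_single mpoly_eval_def[of c P] mpoly_eval_def[of c R] sum_product
    by (intro sum.cong) (simp_all add: coeff_hom lookup_add power_add prod.distrib mult_ac)
  finally show ?thesis .
qed

lemma mpoly_eval_const [simp]: "mpoly_eval c (mpoly_const a) x = c a"
  by (simp add: mpoly_const_def mpoly_eval_single)

lemma mpoly_eval_1 [simp]: "mpoly_eval c 1 x = 1"
  using mpoly_eval_single[of 0 1 x] by (simp add: coeff_hom)

lemma mpoly_eval_var [simp]: "mpoly_eval c (mpoly_var i) x = x i"
proof -
  have "(\<Prod>j\<in>UNIV. x j ^ Poly_Mapping.lookup (Poly_Mapping.single i 1) j) = (\<Prod>j\<in>UNIV. if j = i then x j else 1)"
    by (intro prod.cong) (auto simp: lookup_single when_def)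
  thus ?thesis by (simp add: mpoly_var_def mpoly_eval_single coeff_hom)
qed

lemma mpoly_eval_power: "mpoly_eval c (P ^ n) x = mpoly_eval c P x ^ n"
  by (induction n) (simp_all add: mpoly_eval_mult)

lemma mpoly_eval_prod: "mpoly_eval c (prod f A) x = (\<Prod>a\<in>A. mpoly_eval c (f a) x)"
  by (induction A rule: infinite_finite_induct) (simp_all add: mpoly_eval_mult)

lemma mpoly_eval_subst:
  "mpoly_eval c (mpoly_eval mpoly_const P y) x = mpoly_eval c P (\<lambda>i. mpoly_eval c (y i) x)"
  unfolding mpoly_eval_def[of mpoly_const] mpoly_eval_def[of c P]
  by (simp add: mpoly_eval_sum mpoly_eval_mult mpoly_eval_prod mpoly_eval_power)

lemma mpoly_eval_act_poly:
  "mpoly_eval c (act_poly B P) x = mpoly_eval c P (\<lambda>j. \<Sum>i\<in>UNIV. x i * c (B $ i $ j))"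
  unfolding act_poly_def mpoly_eval_subst by (simp add: mpoly_eval_sum mpoly_eval_mult)

end

lemma act_poly_1 [simp]: "act_poly B 1 = 1"
  by (simp add: act_poly_def mpoly_eval_1[OF rat_ring_hom_mpoly_const])

text \<open>P(X(BC)) = P((XB)C): on row vectors the substitution is a left action.\<close>

lemma act_poly_mult: "act_poly (B ** C) P = act_poly B (act_poly C P)"
proof -
  note h = rat_ring_hom_mpoly_const
  have sum: "mpoly_const (sum f A) = (\<Sum>a\<in>A. mpoly_const (f a) :: 'a rat_mpoly)" for f :: "'a \<Rightarrow> rat" and A
    by (induction A rule: infinite_finite_induct) (simp_all add: rat_ring_homD[OF h])
  have "(\<Sum>i\<in>UNIV. mpoly_var i * mpoly_const ((B ** C) $ i $ j))
      = (\<Sum>i\<in>UNIV. (\<Sum>k\<in>UNIV. mpoly_var k * mpoly_const (B $ k $ i)) * mpoly_const (C $ i $ j))" for j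
    unfolding sum_distrib_right
    by (subst sum.swap) (simp add: matrix_matrix_mult_def sum sum_distrib_left rat_ring_homD[OF h] mult_ac)
  thus ?thesis
    unfolding act_poly_def[of B "act_poly C P"] mpoly_eval_act_poly[OF h] by (simp add: act_poly_def)
qed

text \<open>Monomials are eigenvectors of diagonal substitutions. The distribution relation produces
  the same factor d^r with the opposite exponent when columns are rescaled.\<close>

lemma lookup_act_poly_diag:
  "Poly_Mapping.lookup (act_poly (diag_mat d) P) r
    = (\<Prod>j\<in>UNIV. d j ^ Poly_Mapping.lookup r j) * Poly_Mapping.lookup P r"
proof -
  note h = rat_ring_hom_mpoly_const
  have pw: "mpoly_const (a ^ n) = mpoly_const a ^ n" for a n
    by (induction n) (simp_all add: rat_ring_homD[OF h])
  have pr: "mpoly_const (\<Prod>i\<in>A. f i) = (\<Prod>i\<in>A. mpoly_const (f i))" for f :: "'a \<Rightarrow> rat" and A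
    by (induction A rule: infinite_finite_induct) (simp_all add: rat_ring_homD[OF h])
  have vars: "(\<Prod>i\<in>UNIV. mpoly_var i ^ Poly_Mapping.lookup q i) = Poly_Mapping.single q 1" for q :: "'a \<Rightarrow>\<^sub>0 nat"
  proof -
    have 1: "mpoly_var i ^ n = Poly_Mapping.single (Poly_Mapping.single i n) 1" for i :: 'a and n
      by (induction n) (simp_all add: mpoly_var_def mult_single flip: single_add)
    have 2: "(\<Prod>i\<in>A. Poly_Mapping.single (f i) (1::rat)) = Poly_Mapping.single (sum f A) 1"
      if "finite A" for A and f :: "'a \<Rightarrow> 'a \<Rightarrow>\<^sub>0 nat"
      using that by (induction A) (simp_all add: mult_single)
    have "(\<Sum>i\<in>UNIV. Poly_Mapping.single i (Poly_Mapping.lookup q i)) = q"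
    proof -
      have "q = (\<Sum>r\<in>Poly_Mapping.keys q. Poly_Mapping.single r (Poly_Mapping.lookup q r))"
        by (rule poly_mapping_eq_sum_single)
      also have "\<dots> = (\<Sum>i\<in>UNIV. Poly_Mapping.single i (Poly_Mapping.lookup q i))"
        by (rule sum.mono_neutral_left) (auto simp: in_keys_iff)
      finally show ?thesis by simp
    qed
    thus ?thesis by (simp add: 1 2)
  qed
  have d: "(\<Sum>i\<in>UNIV. mpoly_var i * mpoly_const (diag_mat d $ i $ j)) = mpoly_var j * mpoly_const (d j)" for j
  proof -
    have "(\<Sum>i\<in>UNIV. mpoly_var i * mpoly_const (diag_mat d $ i $ j))
        = (\<Sum>i\<in>UNIV. if i = j then mpoly_var j * mpoly_const (d j) else 0)"
      by (intro sum.cong) (auto simp: diag_mat_def rat_ring_homD[OF h])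
    thus ?thesis by simp
  qed
  let ?m = "\<lambda>q. \<Prod>j\<in>UNIV. d j ^ Poly_Mapping.lookup q j"
  have "act_poly (diag_mat d) P = (\<Sum>q\<in>Poly_Mapping.keys P. mpoly_const (Poly_Mapping.lookup P q) *
      (mpoly_const (?m q) * Poly_Mapping.single q 1))"
    unfolding act_poly_def d mpoly_eval_def power_mult_distrib prod.distrib vars pr pw by (simp add: mult_ac)
  also have "\<dots> = (\<Sum>q\<in>Poly_Mapping.keys P. Poly_Mapping.single q (?m q * Poly_Mapping.lookup P q))"
    by (simp add: mpoly_const_def mult_single mult_ac)
  finally have "Poly_Mapping.lookup (act_poly (diag_mat d) P) r
      = (\<Sum>q\<in>Poly_Mapping.keys P. if q = r then ?m r * Poly_Mapping.lookup P r else 0)"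
    by (auto simp: lookup_sum lookup_single when_def intro!: sum.cong)
  thus ?thesis by (simp add: not_in_keys_iff_lookup_eq_zero)
qed

lemma keys_act_poly_diag:
  assumes "\<And>j. d j \<noteq> 0"
  shows "Poly_Mapping.keys (act_poly (diag_mat d) P) = Poly_Mapping.keys P"
  using assms by (auto simp: in_keys_iff lookup_act_poly_diag)

section \<open>Sums over lattice quotients\<close>

text \<open>The index is shifted: \<open>r\<close> is the exponent vector of a monomial and e = 1 +
  r the tuple of Bernoulli indices. \<open>u\<close> records the side on which each coordinate is
  taken.\<close>

definition bernoulli_prod :: "('n \<Rightarrow> bool) \<Rightarrow> ('n \<Rightarrow> nat) \<Rightarrow> rat^'n::finite \<Rightarrow> rat" where
  "bernoulli_prod u r w = (\<Prod>j\<in>UNIV. periodic_bernoulli (u j) (Suc (r j)) (w $ j))"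

lemma bernoulli_prod_add_int:
  assumes "z \<in> int_lattice" shows "bernoulli_prod u r (w + z) = bernoulli_prod u r w"
proof -
  obtain i where "z = rat_vec i" using assms by (auto simp: int_lattice_eq_range)
  thus ?thesis by (simp add: bernoulli_prod_def rat_vec_def)
qed

text \<open>Product of the one-variable relations; of the powers d_j^(r_j + 1) there, one factor
  cancels against the d_j on the other side.\<close>

lemma bernoulli_prod_distribution:
  assumes d: "\<And>j. d j > 0"
  shows "(\<Prod>j\<in>UNIV. of_nat (d j) ^ r j) *
      (\<Sum>t\<in>int_box d. bernoulli_prod u r (\<chi> j. (w $ j + of_int (t $ j)) / of_nat (d j)))
    = bernoulli_prod u r w"
proof -
  have "(\<Sum>t\<in>int_box d. bernoulli_prod u r (\<chi> j. (w $ j + of_int (t $ j)) / of_nat (d j)))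
      = (\<Prod>j\<in>UNIV. \<Sum>t<d j. periodic_bernoulli (u j) (Suc (r j)) ((w $ j + of_nat t) / of_nat (d j)))"
    using sum_int_box_prod[of "\<lambda>j t. periodic_bernoulli (u j) (Suc (r j)) ((w $ j + of_int t) / of_nat (d j))" d]
    by (simp add: bernoulli_prod_def)
  moreover have "of_nat (d j) ^ r j * (\<Sum>t<d j. periodic_bernoulli (u j) (Suc (r j)) ((w $ j + of_nat t) / of_nat (d j)))
      = periodic_bernoulli (u j) (Suc (r j)) (w $ j)" for j
    using periodic_bernoulli_distribution[OF d[of j], of "Suc (r j)" "u j" "w $ j"] d[of j]
    by (simp add: mult.assoc)
  ultimately show ?thesis by (simp add: bernoulli_prod_def prod.distrib[symmetric])
qed

section \<open>Bernoulli sums over a lattice modulo the columns of a matrix\<close>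

definition lattice_sum :: "(rat^'n) set \<Rightarrow> rat^'n^'n \<Rightarrow> ('n \<Rightarrow> bool) \<Rightarrow> ('n \<Rightarrow> nat) \<Rightarrow> rat^'n \<Rightarrow> rat" where
  "lattice_sum \<Lambda> \<tau> u r v =
     coset_sum \<Lambda> (matrix_lattice \<tau>) (\<lambda>y. bernoulli_prod u r (matrix_inv \<tau> *v (y + v)))"

lemma bernoulli_prod_matrix_cong:
  assumes "det \<tau> \<noteq> 0" "x - y \<in> matrix_lattice \<tau>"
  shows "bernoulli_prod u r (matrix_inv \<tau> *v (x + v)) = bernoulli_prod u r (matrix_inv \<tau> *v (y + v))"
proof -
  obtain z where z: "z \<in> int_lattice" "x - y = \<tau> *v z" using assms(2) by (auto simp: matrix_lattice_def)
  have "x + v = (y + v) + \<tau> *v z"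
    unfolding z(2)[symmetric] by simp
  hence "matrix_inv \<tau> *v (x + v) = matrix_inv \<tau> *v (y + v) + z"
    by (simp only: matrix_vector_right_distrib matrix_inv_vec[OF assms(1)])
  thus ?thesis by (simp add: bernoulli_prod_add_int z(1))
qed

lemma lattice_sum_eq:
  assumes "det \<tau> \<noteq> 0" "transversal S \<Lambda> (matrix_lattice \<tau>)"
  shows "lattice_sum \<Lambda> \<tau> u r v = (\<Sum>y\<in>S. bernoulli_prod u r (matrix_inv \<tau> *v (y + v)))"
  unfolding lattice_sum_def
  by (rule coset_sum_eq[OF assms(2)]) (use assms in \<open>auto intro: bernoulli_prod_matrix_cong\<close>)

lemma det_diag_mat: "det (diag_mat d :: 'a::comm_ring_1^'n^'n) = prod d UNIV"
  using det_diagonal[of "diag_mat d"] by (simp add: diag_mat_def)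

lemma matrix_inv_unique:
  fixes A B :: "rat^'n^'n"
  assumes "A ** B = mat 1"
  shows "matrix_inv A = B"
proof -
  have "det A * det B = 1" using assms by (metis det_I det_mul)
  hence "det A \<noteq> 0" by auto
  hence "matrix_inv A ** (A ** B) = B" by (simp add: matrix_mul_assoc matrix_inv_mult)
  thus ?thesis by (simp add: assms)
qed

lemma matrix_inv_mult_distrib:
  fixes A B :: "rat^'n^'n"
  assumes "det A \<noteq> 0" "det B \<noteq> 0"
  shows "matrix_inv (A ** B) = matrix_inv B ** matrix_inv A"
proof (rule matrix_inv_unique)
  have "A ** B ** (matrix_inv B ** matrix_inv A) = A ** (B ** matrix_inv B) ** matrix_inv A"
    by (simp only: matrix_mul_assoc)
  thus "A ** B ** (matrix_inv B ** matrix_inv A) = mat 1" by (simp add: matrix_inv_mult assms)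
qed

lemma matrix_inv_diag:
  fixes d :: "'n::finite \<Rightarrow> rat"
  assumes "\<And>j. d j \<noteq> 0"
  shows "matrix_inv (diag_mat d) = diag_mat (\<lambda>j. 1 / d j)"
  by (rule matrix_inv_unique) (simp add: assms matrix_eq vec_eq_iff flip: matrix_vector_mul_assoc)

text \<open>The classes of \<tau>L modulo \<tau>DL, with D the diagonal matrix of d, are the \<tau>t
  with t in the box of sides d_j. In the basis \<tau>D the point s + \<tau>t + v has coordinates
  (w_j + t_j)/d_j, where w are those of s + v in the basis \<tau>: summing over t is the
  distribution relation.\<close>

lemma lattice_sum_scale_nat:
  fixes \<tau> :: "rat^'n^'n"
  assumes \<tau>: "det \<tau> \<noteq> 0" "matrix_lattice \<tau> \<subseteq> \<Lambda>" "\<Lambda> = matrix_lattice h" and d: "\<And>j. d j > 0"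
  shows "(\<Prod>j\<in>UNIV. of_nat (d j) ^ r j) * lattice_sum \<Lambda> (\<tau> ** diag_mat (\<lambda>j. of_nat (d j))) u r v
    = lattice_sum \<Lambda> \<tau> u r v"
proof -
  let ?D = "diag_mat (\<lambda>j. of_nat (d j)) :: rat^'n^'n"
  have detD: "det ?D \<noteq> 0" using d by (auto simp: det_diag_mat)
  obtain S where S: "transversal S \<Lambda> (matrix_lattice \<tau>)"
    using ex_transversal_matrix_lattice[OF \<tau>(1), of h] \<tau>(3) by blast
  obtain R where R: "transversal R \<Lambda> (matrix_lattice (\<tau> ** ?D))"
    using ex_transversal_matrix_lattice[of "\<tau> ** ?D" h] \<tau>(1,3) detD by (auto simp: det_mul)
  have T: "transversal ((*v) \<tau> ` rat_vec ` int_box d) (matrix_lattice \<tau>) (matrix_lattice (\<tau> ** ?D))"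
    unfolding matrix_lattice_mult matrix_lattice_def[of \<tau>]
    by (rule transversal_image[OF transversal_int_box]) 
       (auto simp: d matrix_vector_mult_diff_distrib inj_matrix_vec \<tau>(1))
  have DL: "matrix_lattice ?D \<subseteq> int_lattice"
    by (auto simp: matrix_lattice_def int_lattice_def)
  have sub: "matrix_lattice (\<tau> ** ?D) \<subseteq> matrix_lattice \<tau>"
    unfolding matrix_lattice_mult matrix_lattice_def[of \<tau>] using DL by (rule image_mono)
  have inv: "matrix_inv (\<tau> ** ?D) *v (s + \<tau> *v rat_vec t + v)
      = (\<chi> j. ((matrix_inv \<tau> *v (s + v)) $ j + of_int (t $ j)) / of_nat (d j))" for s t
  proof -
    have "matrix_inv \<tau> *v (s + \<tau> *v rat_vec t + v) = matrix_inv \<tau> *v (s + v) + rat_vec t"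
    proof -
      have "matrix_inv \<tau> *v (s + \<tau> *v rat_vec t + v) = matrix_inv \<tau> *v ((s + v) + \<tau> *v rat_vec t)"
        by (simp add: add_ac)
      thus ?thesis by (simp only: matrix_vector_right_distrib matrix_inv_vec[OF \<tau>(1)])
    qed
    thus ?thesis using d
      by (simp add: matrix_inv_mult_distrib \<tau>(1) detD matrix_inv_diag vec_eq_iff rat_vec_def flip: matrix_vector_mul_assoc)
  qed
  have "lattice_sum \<Lambda> (\<tau> ** ?D) u r v = (\<Sum>y\<in>R. bernoulli_prod u r (matrix_inv (\<tau> ** ?D) *v (y + v)))"
    by (rule lattice_sum_eq[OF _ R]) (simp add: det_mul \<tau>(1) detD)
  also have "\<dots> = (\<Sum>s\<in>S. \<Sum>y\<in>(*v) \<tau> ` rat_vec ` int_box d. bernoulli_prod u r (matrix_inv (\<tau> ** ?D) *v (s + y + v)))"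
    by (rule transversal_tower_sum[OF _ _ _ _ _ S T R])
       (use \<tau> sub in \<open>auto simp: det_mul detD intro!: bernoulli_prod_matrix_cong\<close>)
  also have "\<dots> = (\<Sum>s\<in>S. \<Sum>t\<in>int_box d. bernoulli_prod u r
      (\<chi> j. ((matrix_inv \<tau> *v (s + v)) $ j + of_int (t $ j)) / of_nat (d j)))"
    by (intro sum.cong refl, subst image_image, subst sum.reindex)
       (auto simp: inj_on_def inv dest: injD[OF inj_matrix_vec[OF \<tau>(1)]])
  finally show ?thesis
    using d by (simp only: lattice_sum_eq[OF \<tau>(1) S] sum_distrib_left[of _ _ S] bernoulli_prod_distribution)
qed

lemma diag_mat_mult: "diag_mat a ** diag_mat b = (diag_mat (\<lambda>j. a j * b j) :: 'a::comm_semiring_1^'n^'n)"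
  by (simp add: matrix_eq vec_eq_iff mult_ac flip: matrix_vector_mul_assoc)

text \<open>For rational factors d_j = a_j/b_j both matrices are compared with a common multiple:
  scaling \<tau> by a and the rescaled matrix by b gives the same result, and these two scalings are
  by positive integers.\<close>

lemma lattice_sum_scale:
  fixes \<tau> :: "rat^'n^'n" and d :: "'n \<Rightarrow> rat"
  assumes \<tau>: "det \<tau> \<noteq> 0" "matrix_lattice \<tau> \<subseteq> \<Lambda>" "\<Lambda> = matrix_lattice h"
    and d: "\<And>j. d j > 0" "matrix_lattice (\<tau> ** diag_mat d) \<subseteq> \<Lambda>"
  shows "(\<Prod>j\<in>UNIV. d j ^ r j) * lattice_sum \<Lambda> (\<tau> ** diag_mat d) u r v = lattice_sum \<Lambda> \<tau> u r v"
proof -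
  have "\<exists>a b::nat. a > 0 \<and> b > 0 \<and> d j = of_nat a / of_nat b" for j
  proof -
    obtain a b where "quotient_of (d j) = (a, b)" by force
    hence *: "b > 0" "d j = of_int a / of_int b" using quotient_of_denom_pos quotient_of_div by auto
    have "a > 0" using d(1)[of j] * by (simp add: zero_less_divide_iff)
    thus ?thesis using * by (intro exI[of _ "nat a"] exI[of _ "nat b"]) simp
  qed
  then obtain a b :: "'n \<Rightarrow> nat" where ab: "\<And>j. a j > 0" "\<And>j. b j > 0" "\<And>j. d j = of_nat (a j) / of_nat (b j)"
    by metis
  have eq: "\<tau> ** diag_mat d ** diag_mat (\<lambda>j. of_nat (b j)) = \<tau> ** diag_mat (\<lambda>j. of_nat (a j))"
    using ab(2) by (simp add: ab(3) diag_mat_mult flip: matrix_mul_assoc)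
  have "det (\<tau> ** diag_mat d) \<noteq> 0"
    using \<tau>(1) less_imp_neq[OF d(1)] by (auto simp: det_mul det_diag_mat)
  hence "(\<Prod>j\<in>UNIV. of_nat (b j) ^ r j) * lattice_sum \<Lambda> (\<tau> ** diag_mat (\<lambda>j. of_nat (a j))) u r v
      = lattice_sum \<Lambda> (\<tau> ** diag_mat d) u r v"
    using lattice_sum_scale_nat[of "\<tau> ** diag_mat d" \<Lambda> h b r u v] d \<tau>(3) ab unfolding eq by simp
  moreover have "(\<Prod>j\<in>UNIV. of_nat (a j) ^ r j) * lattice_sum \<Lambda> (\<tau> ** diag_mat (\<lambda>j. of_nat (a j))) u r v
      = lattice_sum \<Lambda> \<tau> u r v"
    by (rule lattice_sum_scale_nat[OF \<tau> ab(1)])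
  moreover have "(\<Prod>j\<in>UNIV. of_nat (b j) ^ r j) \<noteq> (0 :: rat)" using ab(2) by simp
  moreover have "x / y * l' = m" if "y * l = l'" "x * l = m" "y \<noteq> 0" for x y l l' m :: rat
    using that by auto
  ultimately show ?thesis
    unfolding ab(3) power_divide prod_dividef by blast
qed

text \<open>
  The cocycle is, up to sign and averaging over the forms, the difference of two of these
  functionals (\<open>Psi_eq\<close>). Being defined for every lattice containing the columns of \<open>\<tau>\<close>, they can
  be transported by matrices and refined to sublattices.
\<close>

definition lattice_functional ::
    "(rat^'n) set \<Rightarrow> rat^'n^'n \<Rightarrow> ('n \<Rightarrow> bool) \<Rightarrow> 'n::finite rat_mpoly \<Rightarrow> rat^'n \<Rightarrow> rat" where
  "lattice_functional \<Lambda> \<tau> u P v =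
     (let R = act_poly (transpose \<tau>) P in
      \<Sum>r\<in>Poly_Mapping.keys R. Poly_Mapping.lookup R r / (\<Prod>j\<in>UNIV. of_nat (Suc (Poly_Mapping.lookup r j))) *
        lattice_sum \<Lambda> \<tau> u (Poly_Mapping.lookup r) v)"

lemma transpose_diag_mat [simp]: "transpose (diag_mat d) = diag_mat d"
  by (auto simp: transpose_def diag_mat_def vec_eq_iff)

text \<open>The substitution multiplies the coefficient at r by d^r, and the lattice sum is divided
  by d^r.\<close>

lemma lattice_functional_scale:
  fixes \<tau> :: "rat^'n^'n" and d :: "'n \<Rightarrow> rat"
  assumes \<tau>: "det \<tau> \<noteq> 0" "matrix_lattice \<tau> \<subseteq> \<Lambda>" "\<Lambda> = matrix_lattice h"
    and d: "\<And>j. d j > 0" "matrix_lattice (\<tau> ** diag_mat d) \<subseteq> \<Lambda>"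
  shows "lattice_functional \<Lambda> (\<tau> ** diag_mat d) u P v = lattice_functional \<Lambda> \<tau> u P v"
proof -
  have d0: "d j \<noteq> 0" for j using d(1)[of j] by simp
  show ?thesis
    unfolding lattice_functional_def Let_def matrix_transpose_mul transpose_diag_mat act_poly_mult
      keys_act_poly_diag[of d, OF d0] lookup_act_poly_diag
    by (intro sum.cong refl) (simp add: lattice_sum_scale[OF assms, symmetric])
qed

lemma lattice_sum_image:
  fixes \<tau> M :: "rat^'n^'n"
  assumes "det \<tau> \<noteq> 0" "\<Lambda> = matrix_lattice h" "det M \<noteq> 0"
  shows "lattice_sum ((*v) M ` \<Lambda>) (M ** \<tau>) u r (M *v v) = lattice_sum \<Lambda> \<tau> u r v"
proof -
  obtain S where S: "transversal S \<Lambda> (matrix_lattice \<tau>)"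
    using ex_transversal_matrix_lattice[OF assms(1), of h] assms(2) by blast
  have T: "transversal ((*v) M ` S) ((*v) M ` \<Lambda>) (matrix_lattice (M ** \<tau>))"
    unfolding matrix_lattice_mult
    by (rule transversal_image[OF S]) (auto simp: matrix_vector_mult_diff_distrib inj_matrix_vec assms)
  have "lattice_sum ((*v) M ` \<Lambda>) (M ** \<tau>) u r (M *v v)
      = (\<Sum>y\<in>(*v) M ` S. bernoulli_prod u r (matrix_inv (M ** \<tau>) *v (y + M *v v)))"
    by (rule lattice_sum_eq[OF _ T]) (simp add: det_mul assms)
  also have "\<dots> = (\<Sum>y\<in>S. bernoulli_prod u r (matrix_inv (M ** \<tau>) *v (M *v (y + v))))"
    by (subst sum.reindex) (auto simp: matrix_vector_right_distrib intro: inj_on_subset[OF inj_matrix_vec[OF assms(3)]])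
  also have "\<dots> = (\<Sum>y\<in>S. bernoulli_prod u r (matrix_inv \<tau> *v (y + v)))"
    by (simp add: matrix_inv_mult_distrib assms matrix_inv_vec flip: matrix_vector_mul_assoc)
  finally show ?thesis by (simp add: lattice_sum_eq[OF assms(1) S])
qed

lemma lattice_functional_image:
  fixes \<tau> M :: "rat^'n^'n"
  assumes "det \<tau> \<noteq> 0" "\<Lambda> = matrix_lattice h" "det M \<noteq> 0"
  shows "lattice_functional ((*v) M ` \<Lambda>) (M ** \<tau>) u P (M *v v)
    = lattice_functional \<Lambda> \<tau> u (act_poly (transpose M) P) v"
  by (simp add: lattice_functional_def matrix_transpose_mul act_poly_mult lattice_sum_image[OF assms])

lemma lattice_sum_refine:
  fixes \<tau> :: "rat^'n^'n"
  assumes "det \<tau> \<noteq> 0" "\<Lambda> = matrix_lattice h" "\<Lambda>' = matrix_lattice h'"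
    and "matrix_lattice \<tau> \<subseteq> \<Lambda>'" "\<Lambda>' \<subseteq> \<Lambda>" and B: "transversal B \<Lambda> \<Lambda>'"
  shows "lattice_sum \<Lambda> \<tau> u r v = (\<Sum>b\<in>B. lattice_sum \<Lambda>' \<tau> u r (v + b))"
proof -
  obtain S where S: "transversal S \<Lambda> (matrix_lattice \<tau>)"
    using ex_transversal_matrix_lattice[OF assms(1), of h] assms(2) by blast
  obtain T where T: "transversal T \<Lambda>' (matrix_lattice \<tau>)"
    using ex_transversal_matrix_lattice[OF assms(1), of h'] assms(3) by blast
  have "lattice_sum \<Lambda> \<tau> u r v = (\<Sum>y\<in>S. bernoulli_prod u r (matrix_inv \<tau> *v (y + v)))"
    by (rule lattice_sum_eq[OF assms(1) S])
  also have "\<dots> = (\<Sum>b\<in>B. \<Sum>y\<in>T. bernoulli_prod u r (matrix_inv \<tau> *v (b + y + v)))"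
    by (rule transversal_tower_sum[OF _ _ _ assms(4,5) B T S])
       (auto simp: assms(2,3) intro: bernoulli_prod_matrix_cong[OF assms(1)])
  also have "\<dots> = (\<Sum>b\<in>B. lattice_sum \<Lambda>' \<tau> u r (v + b))"
    unfolding lattice_sum_eq[OF assms(1) T] by (simp add: add_ac)
  finally show ?thesis .
qed

lemma lattice_functional_refine:
  fixes \<tau> :: "rat^'n^'n"
  assumes "det \<tau> \<noteq> 0" "\<Lambda> = matrix_lattice h" "\<Lambda>' = matrix_lattice h'"
    and "matrix_lattice \<tau> \<subseteq> \<Lambda>'" "\<Lambda>' \<subseteq> \<Lambda>" and B: "transversal B \<Lambda> \<Lambda>'"
  shows "lattice_functional \<Lambda> \<tau> u P v = (\<Sum>b\<in>B. lattice_functional \<Lambda>' \<tau> u P (v + b))"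
  unfolding lattice_functional_def Let_def lattice_sum_refine[OF assms] sum_distrib_left
  by (rule sum.swap)

lemma lattice_sum_add:
  fixes \<tau> :: "rat^'n^'n"
  assumes "det \<tau> \<noteq> 0" "\<Lambda> = matrix_lattice h" "b \<in> \<Lambda>"
  shows "lattice_sum \<Lambda> \<tau> u r (v + b) = lattice_sum \<Lambda> \<tau> u r v"
proof -
  have sg: "add_subgroup \<Lambda>" by (simp add: assms(2))
  obtain S where S: "transversal S \<Lambda> (matrix_lattice \<tau>)"
    using ex_transversal_matrix_lattice[OF assms(1), of h] assms(2) by blast
  have T: "transversal ((\<lambda>x. x + b) ` S) \<Lambda> (matrix_lattice \<tau>)"
  proof (rule transversalI)
    show "finite ((\<lambda>x. x + b) ` S)" "(\<lambda>x. x + b) ` S \<subseteq> \<Lambda>"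
      using transversalD(1,2)[OF S] assms(3) add_subgroupD(4)[OF sg] by auto
    fix x assume "x \<in> \<Lambda>"
    hence "x - b \<in> \<Lambda>" using add_subgroupD(2)[OF sg] assms(3) by blast
    then obtain s where "s \<in> S" "x - b - s \<in> matrix_lattice \<tau>" using transversalD(3)[OF S] by blast
    thus "\<exists>s\<in>(\<lambda>x. x + b) ` S. x - s \<in> matrix_lattice \<tau>" by (auto simp: algebra_simps)
  qed (use transversalD(4)[OF S] add_subgroupD(1)[of "matrix_lattice \<tau>"] in auto)
  have "lattice_sum \<Lambda> \<tau> u r v = (\<Sum>y\<in>(\<lambda>x. x + b) ` S. bernoulli_prod u r (matrix_inv \<tau> *v (y + v)))"
    by (rule lattice_sum_eq[OF assms(1) T])
  also have "\<dots> = (\<Sum>y\<in>S. bernoulli_prod u r (matrix_inv \<tau> *v (y + (v + b))))"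
    by (subst sum.reindex) (simp_all add: add_ac)
  finally show ?thesis by (simp add: lattice_sum_eq[OF assms(1) S])
qed

lemma lattice_functional_add:
  fixes \<tau> :: "rat^'n^'n"
  assumes "det \<tau> \<noteq> 0" "\<Lambda> = matrix_lattice h" "b \<in> \<Lambda>"
  shows "lattice_functional \<Lambda> \<tau> u P (v + b) = lattice_functional \<Lambda> \<tau> u P v"
  unfolding lattice_functional_def lattice_sum_add[OF assms] ..

section \<open>The cocycle as a difference of lattice functionals\<close>

lemma pi_mat_eq_diag: "pi_mat l = diag_mat (\<lambda>i. if i = first_index then of_nat l else 1)"
  by (simp add: pi_mat_def diag_mat_def vec_eq_iff)

definition ext_scaling :: "nat \<Rightarrow> 'n::{finite,linorder} qmat" where
  "ext_scaling l = diag_mat (\<lambda>i. if i = first_index then 1 / of_nat l else 1)"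

text \<open>The lattice \<open>\<pi>\<^sub>l\<^sup>-\<^sup>1 \<int>\<^sup>n\<close>, an extension of \<open>\<int>\<^sup>n\<close> of index \<open>l\<close>.\<close>

definition ext_lattice :: "nat \<Rightarrow> 'n::{finite,linorder} qvec set" where
  "ext_lattice l = {x. of_nat l * x $ first_index \<in> \<int> \<and> (\<forall>i. i \<noteq> first_index \<longrightarrow> x $ i \<in> \<int>)}"

lemma pi_mat_vec [simp]: "(pi_mat l *v x) $ i = (if i = first_index then of_nat l * x $ i else x $ i)"
  by (simp add: pi_mat_eq_diag)

lemma ext_scaling_vec [simp]: "(ext_scaling l *v x) $ i = (if i = first_index then x $ i / of_nat l else x $ i)"
  by (simp add: ext_scaling_def)

lemma pi_mat_ext_scaling:
  assumes "l > 0" shows "pi_mat l ** ext_scaling l = mat 1"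
  using assms by (simp add: matrix_eq vec_eq_iff flip: matrix_vector_mul_assoc)

lemma det_pi_mat: "l > 0 \<Longrightarrow> det (pi_mat l) \<noteq> 0"
  by (auto simp: pi_mat_eq_diag det_diag_mat)

lemma ext_lattice_eq:
  assumes "l > 0" shows "ext_lattice l = matrix_lattice (ext_scaling l)"
proof (intro equalityI subsetI)
  fix x :: "'a qvec" assume "x \<in> ext_lattice l"
  hence "pi_mat l *v x \<in> int_lattice" by (auto simp: ext_lattice_def int_lattice_def)
  moreover have "x = ext_scaling l *v (pi_mat l *v x)" using assms by (simp add: vec_eq_iff)
  ultimately show "x \<in> matrix_lattice (ext_scaling l)" unfolding matrix_lattice_def by blast
qed (use assms in \<open>auto simp: matrix_lattice_def ext_lattice_def int_lattice_def\<close>)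

lemma pi_mat_image_ext_lattice:
  assumes "l > 0" shows "(*v) (pi_mat l) ` ext_lattice l = int_lattice"
  by (simp add: ext_lattice_eq assms pi_mat_ext_scaling flip: matrix_lattice_mult)

lemma int_lattice_subset_ext: "int_lattice \<subseteq> ext_lattice l"
  by (auto simp: int_lattice_def ext_lattice_def)

text \<open>Each form decides between left and right limits: the sign of its j-th coefficient is the
  side of coordinate j, and sgn/2 is the value of b_1 at 1 or at 0. The exceptional index set thus
  disappears; nonzero coefficients exclude the sign 0.\<close>

lemma bernoulli_product_eq:
  fixes Q' :: "real^'n^'m" and w :: "rat^'n"
  assumes "\<And>i j. Q' $ i $ j \<noteq> 0"
  shows "bernoulli_product (\<lambda>j. 1 + r j) w Q'
    = 1 / of_nat CARD('m) * (\<Sum>i\<in>UNIV. bernoulli_prod (\<lambda>j. Q' $ i $ j > 0) r w)"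
proof -
  have floor: "\<lfloor>- 1 :: real\<rfloor> = - 1" by (simp add: floor_eq_iff)
  define J where "J = {j. r j = 0 \<and> w $ j \<in> \<int>}"
  have "(\<Prod>j\<in>J. of_int \<lfloor>sgn (Q' $ i $ j)\<rfloor> / 2) * (\<Prod>j\<in>- J. bernoulli_fun (1 + r j) (w $ j))
      = bernoulli_prod (\<lambda>j. Q' $ i $ j > 0) r w" for i
  proof -
    have "(\<Prod>j\<in>J. of_int \<lfloor>sgn (Q' $ i $ j)\<rfloor> / 2) = (\<Prod>j\<in>J. periodic_bernoulli (Q' $ i $ j > 0) (Suc (r j)) (w $ j))"
      using assms[of i]
      by (intro prod.cong)
        (auto simp: J_def sgn_real_def periodic_bernoulli_Ints[unfolded One_nat_def] floor)
    moreover have "(\<Prod>j\<in>- J. bernoulli_fun (1 + r j) (w $ j)) = (\<Prod>j\<in>- J. periodic_bernoulli (Q' $ i $ j > 0) (Suc (r j)) (w $ j))"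
      by (intro prod.cong) (auto simp: J_def periodic_bernoulli_eq_bernoulli_fun)
    ultimately show ?thesis
      unfolding bernoulli_prod_def by (simp add: prod.union_disjoint[symmetric] Compl_partition)
  qed
  moreover have "J = {j. 1 + r j = 1 \<and> w $ j \<in> \<int>}" by (simp add: J_def)
  ultimately show ?thesis
    unfolding bernoulli_product_def Let_def by (metis (no_types, lifting))
qed

text \<open>The coefficients of \<open>act_forms B Q\<close> are the values of the forms at the rows
  of \<open>B\<close>, which are nonzero rational vectors.\<close>

lemma act_forms_nonzero:
  fixes Q :: "real^'n^'m"
  assumes Q: "Q \<in> linear_forms" and B: "det B \<noteq> 0"
  shows "act_forms B Q $ i $ j \<noteq> 0"
proof -
  have "B $ j \<noteq> 0"
  proof
    assume "B $ j = 0"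
    hence "row j B = 0" by (simp add: row_def vec_eq_iff)
    thus False using B det_zero_row(1) by blast
  qed
  hence "(\<Sum>k\<in>UNIV. Q $ i $ k * of_rat (B $ j $ k)) \<noteq> 0"
    using Q by (auto simp: linear_forms_def)
  thus ?thesis by (simp add: act_forms_def matrix_vector_mult_def mult.commute)
qed

lemma sum_mod_lattice_bernoulli_product:
  fixes T :: "'n::{finite,linorder} qmat" and Q' :: "((real, 'n) vec, 'm::finite) vec"
  assumes T: "det T \<noteq> 0" and Q': "\<And>i j. Q' $ i $ j \<noteq> 0"
  shows "sum_mod_lattice T (\<lambda>x. bernoulli_product (\<lambda>j. 1 + r j) (matrix_inv T *v (rat_vec x + v)) Q')
    = 1 / of_nat CARD('m) * (\<Sum>i\<in>UNIV. lattice_sum int_lattice T (\<lambda>j. Q' $ i $ j > 0) r v)"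
proof -
  obtain S where S: "transversal S int_lattice (matrix_lattice T)"
    using ex_transversal_matrix_lattice[OF T, of "mat 1"] by auto
  have "sum_mod_lattice T (\<lambda>x. bernoulli_product (\<lambda>j. 1 + r j) (matrix_inv T *v (rat_vec x + v)) Q')
      = (\<Sum>y\<in>S. bernoulli_product (\<lambda>j. 1 + r j) (matrix_inv T *v (y + v)) Q')"
    by (rule sum_mod_lattice_eq[OF S])
      (simp only: bernoulli_product_eq[OF Q'] bernoulli_prod_matrix_cong[OF T])
  also have "\<dots> = 1 / of_nat CARD('m) * (\<Sum>i\<in>UNIV. lattice_sum int_lattice T (\<lambda>j. Q' $ i $ j > 0) r v)"
    by (simp add: bernoulli_product_eq[OF Q', simplified] lattice_sum_eq[OF T S] sum_distrib_left[symmetric] sum_divide_distrib[symmetric]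
        sum.swap[of _ S])
  finally show ?thesis .
qed

text \<open>Undoing \<open>pi_mat l\<close> replaces Z^n by the extended lattice and leaves the
  matrix \<sigma>/l; rescaling \<sigma>/l to \<sigma> produces the power of l.\<close>

lemma lattice_sum_pi_mat:
  fixes \<sigma> :: "'n::{finite,linorder} qmat"
  assumes l: "l > 0" and \<sigma>: "det \<sigma> \<noteq> 0" "matrix_lattice \<sigma> \<subseteq> ext_lattice l"
    "matrix_lattice (\<sigma> ** mat (1 / of_nat l)) \<subseteq> ext_lattice l"
  shows "lattice_sum int_lattice (pi_mat l ** (\<sigma> ** mat (1 / of_nat l))) u r (pi_mat l *v v)
    = of_nat l ^ (\<Sum>j\<in>UNIV. r j) * lattice_sum (ext_lattice l) \<sigma> u r v"
proof -
  have "lattice_sum int_lattice (pi_mat l ** (\<sigma> ** mat (1 / of_nat l))) u r (pi_mat l *v v)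
      = lattice_sum (ext_lattice l) (\<sigma> ** mat (1 / of_nat l)) u r v"
    unfolding pi_mat_image_ext_lattice[OF l, symmetric]
    by (rule lattice_sum_image[OF _ ext_lattice_eq[OF l] det_pi_mat[OF l]])
       (use l \<sigma>(1) in \<open>simp add: det_mul flip: diag_mat_const, simp add: det_diag_mat\<close>)
  moreover have "(\<Prod>j\<in>UNIV. (1 / of_nat l) ^ r j) * lattice_sum (ext_lattice l) (\<sigma> ** diag_mat (\<lambda>_. 1 / of_nat l)) u r v
      = lattice_sum (ext_lattice l) \<sigma> u r v"
    by (rule lattice_sum_scale[OF \<sigma>(1,2) ext_lattice_eq[OF l]]) (use l \<sigma>(3) in \<open>simp_all add: diag_mat_const\<close>)
  moreover have "(\<Prod>j\<in>UNIV. (1 / of_nat l :: rat) ^ r j) = 1 / of_nat l ^ (\<Sum>j\<in>UNIV. r j)"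
    by (simp add: power_sum prod_dividef power_divide)
  ultimately show ?thesis using l by (simp only: diag_mat_const) (simp add: divide_eq_eq mult.commute)
qed

text \<open>For e = 1 + r the exponent 1 - n + \<Sum>e is 1 + \<Sum>r, so both halves share the
  power \<Sum>r of l and a single l is left in front of the second: the points of Z^n get the total
  weight 1 - l.\<close>

lemma dedekind_sum_eq:
  fixes \<sigma> :: "'n::{finite,linorder} qmat" and Q :: "((real, 'n) vec, 'm::finite) vec"
  assumes l: "l > 0" and \<sigma>: "det \<sigma> \<noteq> 0" "matrix_lattice \<sigma> \<subseteq> int_lattice"
    "matrix_lattice (\<sigma> ** mat (1 / of_nat l)) \<subseteq> ext_lattice l" and Q: "Q \<in> linear_forms"
  defines "u \<equiv> \<lambda>i j. act_forms (matrix_inv \<sigma>) Q $ i $ j > 0"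
  shows "dedekind_sum l \<sigma> (\<lambda>j. 1 + r j) Q v = of_nat l ^ (\<Sum>j\<in>UNIV. r j) * (1 / of_nat CARD('m) *
    (\<Sum>i\<in>UNIV. lattice_sum (ext_lattice l) \<sigma> (u i) r v - of_nat l * lattice_sum int_lattice \<sigma> (u i) r v))"
proof -
  let ?Q = "act_forms (matrix_inv \<sigma>) Q" and ?\<sigma>l = "pi_mat l ** (\<sigma> ** mat (1 / of_nat l))"
  have "det (matrix_inv \<sigma>) * det \<sigma> = 1"
    using matrix_inv_mult(2)[OF \<sigma>(1)] by (metis det_I det_mul)
  hence Q': "?Q $ i $ j \<noteq> 0" for i j by (intro act_forms_nonzero[OF Q]) auto
  have sl: "(\<chi> i j. (pi_mat l ** \<sigma>) $ i $ j / of_nat l) = ?\<sigma>l"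
    by (simp add: matrix_mul_assoc vec_eq_iff flip: diag_mat_const)
       (simp add: matrix_matrix_mult_def diag_mat_def if_distrib cong: if_cong)
  have det: "det ?\<sigma>l \<noteq> 0"
    using l \<sigma>(1) det_pi_mat[OF l] by (simp add: det_mul flip: diag_mat_const) (simp add: det_diag_mat)
  have pw: "of_nat l powi (1 - int CARD('n) + int (\<Sum>j\<in>UNIV. 1 + r j)) = (of_nat l ^ (\<Sum>j\<in>UNIV. r j) * of_nat l :: rat)"
  proof -
    have "1 - int CARD('n) + int (\<Sum>j\<in>UNIV. 1 + r j) = int (Suc (\<Sum>j\<in>UNIV. r j))"
      by (simp add: sum.distrib)
    thus ?thesis by (simp only: power_int_of_nat power_Suc mult.commute)
  qed
  have ext: "matrix_lattice \<sigma> \<subseteq> ext_lattice l" using \<sigma>(2) int_lattice_subset_ext by blast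
  show ?thesis
    unfolding dedekind_sum_def Let_def sl pw using \<sigma>(1)
    by (simp only: if_False sum_mod_lattice_bernoulli_product[OF det Q'] sum_mod_lattice_bernoulli_product[OF \<sigma>(1) Q']
        lattice_sum_pi_mat[OF l \<sigma>(1) ext \<sigma>(3)] u_def sum_subtractf sum_distrib_left[symmetric])
      (simp add: algebra_simps)
qed

text \<open>\<open>g\<close> moves the pair of lattices. Taking for it the identity,
  \<open>M\<close> and the scalar p^k gives the cocycle, the coset and the balls
  respectively.\<close>

definition smoothed_functional ::
    "nat \<Rightarrow> 'n qmat \<Rightarrow> 'n qmat \<Rightarrow> ('n \<Rightarrow> bool) \<Rightarrow> 'n::{finite,linorder} rat_mpoly \<Rightarrow> 'n qvec \<Rightarrow> rat" where
  "smoothed_functional l g \<tau> u P v =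
     lattice_functional ((*v) g ` ext_lattice l) \<tau> u P v
     - of_nat l * lattice_functional ((*v) g ` int_lattice) \<tau> u P v"

text \<open>The power of l from the Dedekind sums cancels the one in the denominator of
  \<open>Psi\<close>, and the factorials r! of the Taylor coefficients reduce (r + 1)! to the
  product of the r_j + 1. A singular \<sigma> is covered by sgn 0 = 0.\<close>

lemma Psi_eq:
  fixes B :: "'n::{finite,linorder} \<Rightarrow> 'n qmat" and Q :: "((real, 'n) vec, 'm::finite) vec"
  assumes l: "l > 0" and \<sigma>: "matrix_lattice \<sigma> \<subseteq> int_lattice"
    "matrix_lattice (\<sigma> ** mat (1 / of_nat l)) \<subseteq> ext_lattice l" and Q: "Q \<in> linear_forms"
    and sig: "sigma_mat B = \<sigma>"
  defines "u \<equiv> \<lambda>i j. act_forms (matrix_inv \<sigma>) Q $ i $ j > 0"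
  shows "Psi l B P Q v = (- 1) ^ CARD('n) * sgn (det \<sigma>) / of_nat CARD('m) *
    (\<Sum>i\<in>UNIV. smoothed_functional l (mat 1) \<sigma> (u i) P v)"
proof (cases "det \<sigma> = 0")
  case True
  thus ?thesis by (simp add: Psi_def sig)
next
  case False
  let ?R = "act_poly (transpose \<sigma>) P" and ?lk = "Poly_Mapping.lookup"
  let ?L = "\<lambda>i r. lattice_sum (ext_lattice l) \<sigma> (u i) (?lk r) v - of_nat l * lattice_sum int_lattice \<sigma> (u i) (?lk r) v"
  have coeff: "taylor_coeff \<sigma> P r / ((\<Prod>j\<in>UNIV. fact (?lk r j + 1)) * of_nat l ^ (\<Sum>j\<in>UNIV. ?lk r j)) *
        dedekind_sum l \<sigma> (\<lambda>j. 1 + ?lk r j) Q v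
      = 1 / of_nat CARD('m) * (\<Sum>i\<in>UNIV. ?lk ?R r / (\<Prod>j\<in>UNIV. of_nat (Suc (?lk r j))) * ?L i r)" for r
  proof -
    have "(\<Prod>j\<in>UNIV. fact (?lk r j + 1) :: rat) = (\<Prod>j\<in>UNIV. fact (?lk r j)) * (\<Prod>j\<in>UNIV. of_nat (Suc (?lk r j)))"
      by (simp add: prod.distrib[symmetric] mult.commute)
    moreover have "(\<Prod>j\<in>UNIV. fact (?lk r j) :: rat) \<noteq> 0" by simp
    moreover have "x * k / (x * y * z) * (z * (c * s)) = c * (k / y * s)" if "x \<noteq> 0" "z \<noteq> 0" for x y z k c s :: rat
      using that by (simp add: field_simps)
    ultimately show ?thesis
      unfolding dedekind_sum_eq[OF l False \<sigma> Q] taylor_coeff_def u_def sum_distrib_left[symmetric]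
      using l by (simp only:) simp
  qed
  have "Psi l B P Q v = (- 1) ^ CARD('n) * sgn (det \<sigma>) * (1 / of_nat CARD('m) *
      (\<Sum>i\<in>UNIV. \<Sum>r\<in>Poly_Mapping.keys ?R. ?lk ?R r / (\<Prod>j\<in>UNIV. of_nat (Suc (?lk r j))) * ?L i r))"
    unfolding Psi_def Let_def sig coeff sum_distrib_left[of "1 / of_nat CARD('m)", symmetric]
    by (subst sum.swap) (rule refl)
  also have "(\<lambda>i. \<Sum>r\<in>Poly_Mapping.keys ?R. ?lk ?R r / (\<Prod>j\<in>UNIV. of_nat (Suc (?lk r j))) * ?L i r)
      = (\<lambda>i. smoothed_functional l (mat 1) \<sigma> (u i) P v)"
    by (rule ext) (simp add: smoothed_functional_def lattice_functional_def Let_def right_diff_distrib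
        sum_subtractf sum_distrib_left mult_ac)
  finally show ?thesis by simp
qed

section \<open>Refinement to congruence lattices\<close>

lemma mat_mult_commute: "mat c ** (A :: rat^'n^'n) = A ** mat c"
  by (simp add: matrix_eq mat_vector_mult vector_scalar_commute flip: matrix_vector_mul_assoc)

lemma det_mat_nonzero: "c \<noteq> 0 \<Longrightarrow> det (mat c :: rat^'n^'n) \<noteq> 0"
  by (simp add: det_diag_mat flip: diag_mat_const)

lemma smoothed_functional_scale:
  fixes g \<tau> :: "'n::{finite,linorder} qmat"
  assumes l: "l > 0" and \<tau>: "det \<tau> \<noteq> 0" "matrix_lattice \<tau> \<subseteq> matrix_lattice g"
    and d: "\<And>j. d j > 0" "matrix_lattice (\<tau> ** diag_mat d) \<subseteq> matrix_lattice g"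
  shows "smoothed_functional l g (\<tau> ** diag_mat d) u P v = smoothed_functional l g \<tau> u P v"
proof -
  have int: "(*v) g ` int_lattice = matrix_lattice g" by (simp add: matrix_lattice_def)
  have ext: "(*v) g ` ext_lattice l = matrix_lattice (g ** ext_scaling l)"
    by (simp add: ext_lattice_eq l matrix_lattice_mult)
  have sub: "matrix_lattice g \<subseteq> (*v) g ` ext_lattice l"
    unfolding matrix_lattice_def by (intro image_mono int_lattice_subset_ext)
  show ?thesis
    unfolding smoothed_functional_def
    using lattice_functional_scale[OF \<tau>(1) _ ext d(1)] lattice_functional_scale[OF \<tau>(1) _ int d(1)] \<tau> d sub
    by (simp add: int)
qed

lemma smoothed_functional_image:
  fixes g \<tau> M :: "'n::{finite,linorder} qmat"
  assumes l: "l > 0" and "det \<tau> \<noteq> 0" "det M \<noteq> 0"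
  shows "smoothed_functional l (M ** g) (M ** \<tau>) u P (M *v v)
    = smoothed_functional l g \<tau> u (act_poly (transpose M) P) v"
proof -
  have 1: "(*v) (M ** g) ` X = (*v) M ` (*v) g ` X" for X by (simp add: image_image matrix_vector_mul_assoc)
  have int: "(*v) g ` int_lattice = matrix_lattice g" by (simp add: matrix_lattice_def)
  have ext: "(*v) g ` ext_lattice l = matrix_lattice (g ** ext_scaling l)"
    by (simp add: ext_lattice_eq l matrix_lattice_mult)
  show ?thesis unfolding smoothed_functional_def 1
    by (simp only: lattice_functional_image[OF assms(2) int assms(3)] lattice_functional_image[OF assms(2) ext assms(3)])
qed

lemma Ints_divide_coprime:
  fixes y :: rat
  assumes "y \<in> \<int>" "of_int e * y / of_nat l \<in> \<int>" "coprime e (int l)"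
  shows "y / of_nat l \<in> \<int>"
proof (cases "l = 0")
  case False
  obtain a b where ab: "a * e + b * int l = 1"
    using assms(3) by (metis bezout_int coprime_imp_gcd_eq_1)
  have "(of_int a * of_int e + of_int b * of_nat l :: rat) = 1"
    using arg_cong[OF ab, of "of_int :: int \<Rightarrow> rat"] by simp
  hence "y / of_nat l = (of_int a * of_int e + of_int b * of_nat l) * (y / of_nat l)" by simp
  also have "\<dots> = of_int a * (of_int e * y / of_nat l) + of_int b * y"
    using False by (simp add: field_simps)
  also have "\<dots> \<in> \<int>" using assms by (intro Ints_add Ints_mult) auto
  finally show ?thesis .
qed auto

text \<open>Integral matrices with this property act on the pair of lattices \<open>\<int>\<^sup>n\<close> and \<open>\<pi>\<^sub>l\<^sup>-\<^sup>1 \<int>\<^sup>n\<close>.\<close>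

definition int_Gamma0 :: "nat \<Rightarrow> 'n::{finite,linorder} qmat \<Rightarrow> bool" where
  "int_Gamma0 l M \<longleftrightarrow> (\<forall>i j. M $ i $ j \<in> \<int>) \<and> (\<forall>i. i \<noteq> first_index \<longrightarrow> M $ i $ first_index / of_nat l \<in> \<int>)"

lemma int_matrix_lattice:
  assumes "\<And>i j. M $ i $ j \<in> \<int>" "x \<in> int_lattice"
  shows "M *v x \<in> int_lattice"
  using assms by (auto simp: int_lattice_def matrix_vector_mult_def intro!: Ints_sum Ints_mult)

lemma int_Gamma0_lattice:
  assumes M: "int_Gamma0 l M" and l: "l > 0"
  shows "(*v) M ` int_lattice \<subseteq> int_lattice" "(*v) M ` ext_lattice l \<subseteq> ext_lattice l"
proof -
  have M': "M $ i $ j \<in> \<int>" "i \<noteq> first_index \<Longrightarrow> M $ i $ first_index / of_nat l \<in> \<int>" for i j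
    using M by (auto simp: int_Gamma0_def)
  show "(*v) M ` int_lattice \<subseteq> int_lattice" using int_matrix_lattice[OF M'(1)] by blast
  show "(*v) M ` ext_lattice l \<subseteq> ext_lattice l"
  proof (intro image_subsetI)
    fix x :: "'a qvec" assume x: "x \<in> ext_lattice l"
    hence x': "of_nat l * x $ first_index \<in> \<int>" "j \<noteq> first_index \<Longrightarrow> x $ j \<in> \<int>" for j by (auto simp: ext_lattice_def)
    have lx: "of_nat l * x $ j \<in> \<int>" for j using x' by (cases "j = first_index") (auto intro: Ints_mult)
    have "of_nat l * (M *v x) $ first_index \<in> \<int>"
    proof -
      have "of_nat l * (M *v x) $ first_index = (\<Sum>j\<in>UNIV. M $ first_index $ j * (of_nat l * x $ j))"
        by (simp add: matrix_vector_mult_def sum_distrib_left mult_ac)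
      also have "\<dots> \<in> \<int>" using M'(1) lx
        by (intro Ints_sum Ints_mult[of "M $ _ $ _" "of_nat l * x $ _"]) auto
      finally show ?thesis .
    qed
    moreover have "(M *v x) $ i \<in> \<int>" if i: "i \<noteq> first_index" for i
    proof -
      have "M $ i $ j * x $ j \<in> \<int>" for j
      proof (cases "j = first_index")
        case True
        have "(M $ i $ first_index / of_nat l) * (of_nat l * x $ first_index) \<in> \<int>"
          using M'(2)[OF i] x'(1) by (rule Ints_mult)
        thus ?thesis using l True by simp
      qed (use M' x' in \<open>auto intro: Ints_mult\<close>)
      thus ?thesis by (auto simp: matrix_vector_mult_def intro!: Ints_sum)
    qed
    ultimately show "M *v x \<in> ext_lattice l" by (simp add: ext_lattice_def)
  qed
qed

text \<open>Reduction modulo p^k does not see the index l. With a p^k + b l = 1, every x is p^k(ax)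
  + b(lx), where lx already comes from Z^n, so the given representatives suffice; and they stay
  distinct because an integral vector in p^k times the extended lattice lies in p^k Z^n.\<close>

lemma transversal_ext_lattice:
  fixes M :: "'n::{finite,linorder} qmat"
  assumes cop: "coprime (int p) (int l)" and l: "l > 0" and p: "p > 0"
    and M: "(*v) M ` int_lattice \<subseteq> int_lattice" "(*v) M ` ext_lattice l \<subseteq> ext_lattice l"
    and B: "transversal B ((*v) M ` int_lattice) (matrix_lattice (mat (of_nat p ^ k)))"
  shows "transversal B ((*v) M ` ext_lattice l) ((*v) (mat (of_nat p ^ k)) ` ext_lattice l)"
proof (rule transversalI)
  let ?p = "of_nat p ^ k :: rat"
  have int_ext: "(int_lattice :: 'n qvec set) \<subseteq> ext_lattice l" by (rule int_lattice_subset_ext)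
  have ext_int: "of_nat l *s x \<in> int_lattice" if "x \<in> ext_lattice l" for x :: "'n qvec"
    unfolding int_lattice_def
  proof safe
    fix i show "(of_nat l *s x) $ i \<in> \<int>"
      using that by (cases "i = first_index") (auto simp: ext_lattice_def intro: Ints_mult)
  qed
  have pk: "coprime (int p ^ k) (int l)" using cop by simp
  obtain a b where ab: "a * int p ^ k + b * int l = 1"
    using pk by (metis bezout_int coprime_imp_gcd_eq_1)
  have ab': "of_int a * ?p + of_int b * of_nat l = 1"
    using arg_cong[OF ab, of "of_int :: int \<Rightarrow> rat"] by simp
  have split: "x = ?p *s (of_int a *s x) + of_int b *s (of_nat l *s x)" for x :: "'n qvec"
  proof -
    have "x = (of_int a * ?p + of_int b * of_nat l) *s x" by (simp add: ab')
    also have "\<dots> = ?p *s (of_int a *s x) + of_int b *s (of_nat l *s x)"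
      by (simp add: vec_eq_iff algebra_simps)
    finally show ?thesis .
  qed
  have sub_ext: "add_subgroup (ext_lattice l :: 'n qvec set)" by (simp add: ext_lattice_eq l)
  have int_mult: "of_int c *s x \<in> ext_lattice l" if "x \<in> ext_lattice l" for c and x :: "'n qvec"
    using that by (auto simp: ext_lattice_def mult.left_commute intro!: Ints_mult)
  have int_mult': "of_int c *s x \<in> int_lattice" if "x \<in> int_lattice" for c and x :: "'n qvec"
    using that by (auto simp: int_lattice_def intro!: Ints_mult)
  show "finite B" using B by (rule transversalD)
  show "B \<subseteq> (*v) M ` ext_lattice l" using transversalD(2)[OF B] int_ext by blast
  show "add_subgroup ((*v) (mat ?p) ` (ext_lattice l :: 'n qvec set))"
    by (rule add_subgroup_image[OF sub_ext]) (simp add: matrix_vector_mult_diff_distrib)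
  fix x assume "x \<in> (*v) M ` ext_lattice l"
  then obtain y where y: "y \<in> ext_lattice l" "x = M *v y" by blast
  have x: "x \<in> ext_lattice l" using y M(2) by blast
  have "of_int b *s (of_nat l *s x) = M *v (of_int b *s (of_nat l *s y))"
    by (simp add: y(2) vector_scalar_commute)
  hence "of_int b *s (of_nat l *s x) \<in> (*v) M ` int_lattice"
    using int_mult'[OF ext_int[OF y(1)], of b] by simp
  then obtain s where s: "s \<in> B" "of_int b *s (of_nat l *s x) - s \<in> matrix_lattice (mat ?p)"
    using transversalD(3)[OF B] by blast
  then obtain z where z: "z \<in> int_lattice" "of_int b *s (of_nat l *s x) - s = mat ?p *v z"
    by (auto simp: matrix_lattice_def)
  have "x - s = mat ?p *v (of_int a *s x + z)"
  proof -
    have "x - s = ?p *s (of_int a *s x) + (of_int b *s (of_nat l *s x) - s)"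
      using split[of x] by (simp only: add_diff_eq)
    thus ?thesis unfolding z(2) by (simp add: mat_vector_mult vector_add_ldistrib)
  qed
  moreover have "of_int a *s x + z \<in> ext_lattice l"
    using int_mult[OF x, of a] z(1) int_ext by (intro add_subgroupD(4)[OF sub_ext]) auto
  ultimately show "\<exists>s\<in>B. x - s \<in> (*v) (mat ?p) ` ext_lattice l" using s(1) by blast
next
  let ?p = "of_nat p ^ k :: rat"
  fix s t assume st: "s \<in> B" "t \<in> B" "s - t \<in> (*v) (mat ?p) ` ext_lattice l"
  then obtain z where z: "z \<in> ext_lattice l" "s - t = ?p *s z" by (auto simp: mat_vector_mult)
  have "s \<in> int_lattice" "t \<in> int_lattice" using st transversalD(2)[OF B] M(1) by auto
  hence "s - t \<in> int_lattice" by (intro add_subgroupD(2)) auto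
  hence int: "?p * z $ i \<in> \<int>" for i unfolding z(2) by (simp add: int_lattice_def)
  have "of_nat l * z $ first_index / of_nat l \<in> \<int>"
  proof (rule Ints_divide_coprime)
    show "of_nat l * z $ first_index \<in> \<int>" using z(1) by (simp add: ext_lattice_def)
    show "of_int (int p ^ k) * (of_nat l * z $ first_index) / of_nat l \<in> \<int>"
      using int[of first_index] l by (simp add: mult.left_commute)
    show "coprime (int p ^ k) (int l)" using cop by simp
  qed
  hence "z \<in> int_lattice" unfolding int_lattice_def
  proof safe
    fix i assume "of_nat l * z $ first_index / of_nat l \<in> \<int>"
    thus "z $ i \<in> \<int>" using z(1) l by (cases "i = first_index") (auto simp: ext_lattice_def)
  qed
  hence "s - t \<in> matrix_lattice (mat ?p)" by (auto simp: z(2) matrix_lattice_def mat_vector_mult)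
  thus "s = t" using transversalD(4)[OF B] st add_subgroupD(1)[OF add_subgroup_matrix_lattice] by blast
qed

text \<open>One set \<open>B\<close> represents the quotient for both lattices, so the two terms are
  refined over the same translates and recombine into smoothed functionals.\<close>

lemma smoothed_functional_refine:
  fixes M \<tau> :: "'n::{finite,linorder} qmat"
  assumes cop: "coprime (int p) (int l)" and l: "l > 0" and p: "p > 0"
    and M: "(*v) M ` int_lattice \<subseteq> int_lattice" "(*v) M ` ext_lattice l \<subseteq> ext_lattice l"
    and pM: "(*v) (mat (of_nat p ^ k)) ` int_lattice \<subseteq> (*v) M ` int_lattice"
      "(*v) (mat (of_nat p ^ k)) ` ext_lattice l \<subseteq> (*v) M ` ext_lattice l"
    and \<tau>: "det \<tau> \<noteq> 0" "matrix_lattice \<tau> \<subseteq> matrix_lattice (mat (of_nat p ^ k))"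
    and B: "transversal B (matrix_lattice M) (matrix_lattice (mat (of_nat p ^ k)))"
  shows "smoothed_functional l M \<tau> u P v = (\<Sum>b\<in>B. smoothed_functional l (mat (of_nat p ^ k)) \<tau> u P (v + b))"
proof -
  let ?p = "mat (of_nat p ^ k) :: 'n qmat"
  have int: "(*v) g ` int_lattice = matrix_lattice g" for g :: "'n qmat" by (simp add: matrix_lattice_def)
  have ext: "(*v) g ` ext_lattice l = matrix_lattice (g ** ext_scaling l)" for g :: "'n qmat"
    by (simp add: ext_lattice_eq l matrix_lattice_mult)
  have B': "transversal B ((*v) M ` ext_lattice l) ((*v) ?p ` ext_lattice l)"
    by (rule transversal_ext_lattice[OF cop l p M B[folded int[of M]]])
  have Bi: "transversal B ((*v) M ` int_lattice) ((*v) ?p ` int_lattice)" using B by (simp only: int)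
  have \<tau>i: "matrix_lattice \<tau> \<subseteq> (*v) ?p ` int_lattice" using \<tau>(2) by (simp only: int)
  have \<tau>': "matrix_lattice \<tau> \<subseteq> (*v) ?p ` ext_lattice l"
    using \<tau>(2) int_lattice_subset_ext by (fastforce simp: int[symmetric])
  show ?thesis
    unfolding smoothed_functional_def sum_subtractf sum_distrib_left[symmetric]
    by (simp only: lattice_functional_refine[OF \<tau>(1) ext ext \<tau>' pM(2) B']
        lattice_functional_refine[OF \<tau>(1) int int \<tau>i pM(1) Bi])
qed

text \<open>The quantity attached to the ball w + p^k Z_p^n. Using the lattice p^k Z^n and the
  matrix p^k \<sigma>, instead of rescaling back to Z^n, keeps w and P themselves in the formula and
  makes additivity in k a statement about sublattices.\<close>

definition level_functional ::
    "nat \<Rightarrow> nat \<Rightarrow> 'n qmat \<Rightarrow> ('n \<Rightarrow> bool) \<Rightarrow> nat \<Rightarrow> 'n::{finite,linorder} rat_mpoly \<Rightarrow> 'n qvec \<Rightarrow> rat" where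
  "level_functional l p \<sigma> u k P w =
     smoothed_functional l (mat (of_nat p ^ k)) (mat (of_nat p ^ k) ** \<sigma>) u P w"

lemma level_functional_eq_smoothed:
  assumes "l > 0" "p > 0" "det \<sigma> \<noteq> 0"
  shows "level_functional l p \<sigma> u k P w
    = smoothed_functional l (mat 1) \<sigma> u (act_poly (mat (of_nat p ^ k)) P) ((1 / of_nat p ^ k) *s w)"
proof -
  have w: "w = mat (of_nat p ^ k) *v ((1 / of_nat p ^ k) *s w)"
    using assms(2) by (simp add: mat_vector_mult vec_eq_iff)
  have "det (mat (of_nat p ^ k) :: 'a qmat) \<noteq> 0" using assms(2) by (intro det_mat_nonzero) simp
  from smoothed_functional_image[OF assms(1,3) this, of "mat 1" u P "(1 / of_nat p ^ k) *s w"] show ?thesis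
    unfolding level_functional_def using w by (simp add: transpose_mat)
qed

lemma level_functional_add:
  assumes "l > 0" "p > 0" "det \<sigma> \<noteq> 0" "b \<in> matrix_lattice (mat (of_nat p ^ k))"
  shows "level_functional l p \<sigma> u k P (w + b) = level_functional l p \<sigma> u k P w"
proof -
  have int: "(*v) g ` int_lattice = matrix_lattice g" for g :: "'a qmat" by (simp add: matrix_lattice_def)
  have ext: "(*v) g ` ext_lattice l = matrix_lattice (g ** ext_scaling l)" for g :: "'a qmat"
    by (simp add: ext_lattice_eq assms matrix_lattice_mult)
  have det: "det (mat (of_nat p ^ k) ** \<sigma>) \<noteq> 0" using assms(2,3) by (simp add: det_mul det_mat_nonzero)
  have bi: "b \<in> (*v) (mat (of_nat p ^ k)) ` int_lattice" using assms(4) by (simp only: int)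
  hence be: "b \<in> (*v) (mat (of_nat p ^ k)) ` ext_lattice l" using int_lattice_subset_ext by blast
  show ?thesis
    unfolding level_functional_def smoothed_functional_def
    by (simp only: lattice_functional_add[OF det ext be] lattice_functional_add[OF det int bi])
qed

text \<open>The rescaled \<sigma> may be replaced by p^k \<sigma>, since the columns of both lie in
  M Z^n; afterwards the columns lie in p^k Z^n, and the lattices can be refined down to it. That p^k
  M^{-1} preserves Z^n and the extended lattice gives the two inclusions required.\<close>

lemma smoothed_functional_eq_level_sum:
  fixes M \<sigma> :: "'n::{finite,linorder} qmat"
  assumes cop: "coprime (int p) (int l)" and l: "l > 0" and p: "p > 0"
    and M: "int_Gamma0 l M" "det M \<noteq> 0" "int_Gamma0 l (mat (of_nat p ^ k) ** matrix_inv M)"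
    and \<sigma>: "det \<sigma> \<noteq> 0" "matrix_lattice \<sigma> \<subseteq> int_lattice"
    and d: "\<And>j. d j > 0" "matrix_lattice (\<sigma> ** diag_mat d) \<subseteq> matrix_lattice M"
    and B: "transversal B (matrix_lattice M) (matrix_lattice (mat (of_nat p ^ k)))"
  shows "smoothed_functional l M (\<sigma> ** diag_mat d) u P v = (\<Sum>b\<in>B. level_functional l p \<sigma> u k P (v + b))"
proof -
  let ?p = "mat (of_nat p ^ k) :: 'n qmat"
  have eq: "?p = M ** (?p ** matrix_inv M)"
    by (simp add: mat_mult_commute matrix_mul_assoc[symmetric] matrix_inv_mult M)
      (simp add: matrix_mul_assoc matrix_inv_mult M)
  have pM: "(*v) ?p ` X \<subseteq> (*v) M ` X" if "(*v) (?p ** matrix_inv M) ` X \<subseteq> X" for X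
  proof -
    have "(*v) ?p ` X = (*v) M ` (*v) (?p ** matrix_inv M) ` X"
      by (subst eq) (simp add: image_image matrix_vector_mul_assoc)
    thus ?thesis using that by blast
  qed
  note pM' = pM[OF int_Gamma0_lattice(1)[OF M(3) l]] pM[OF int_Gamma0_lattice(2)[OF M(3) l]]
  have p\<sigma>: "matrix_lattice (?p ** \<sigma>) \<subseteq> matrix_lattice ?p"
    unfolding matrix_lattice_mult matrix_lattice_def[of ?p] using \<sigma>(2) by (rule image_mono)
  have det: "det (?p ** \<sigma>) \<noteq> 0" using p \<sigma>(1) by (simp add: det_mul det_mat_nonzero)
  have "?p ** \<sigma> ** diag_mat (\<lambda>j. d j / of_nat p ^ k) = \<sigma> ** (?p ** diag_mat (\<lambda>j. d j / of_nat p ^ k))"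
    by (simp only: mat_mult_commute[of _ \<sigma>] matrix_mul_assoc)
  also have "\<dots> = \<sigma> ** diag_mat d"
    using p by (simp add: diag_mat_mult flip: diag_mat_const)
  finally have sd: "?p ** \<sigma> ** diag_mat (\<lambda>j. d j / of_nat p ^ k) = \<sigma> ** diag_mat d" .
  have "smoothed_functional l M (\<sigma> ** diag_mat d) u P v = smoothed_functional l M (?p ** \<sigma>) u P v"
    unfolding sd[symmetric]
    by (rule smoothed_functional_scale[OF l det]) (use p p\<sigma> pM'(1) d in \<open>auto simp: sd matrix_lattice_def\<close>)
  also have "\<dots> = (\<Sum>b\<in>B. smoothed_functional l ?p (?p ** \<sigma>) u P (v + b))"
    by (rule smoothed_functional_refine[OF cop l p int_Gamma0_lattice[OF M(1) l] pM' det p\<sigma> B])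
  finally show ?thesis by (simp add: level_functional_def)
qed

lemma int_Gamma0_mat: "int_Gamma0 l (mat (of_nat c))"
  by (auto simp: int_Gamma0_def mat_def)

text \<open>The scalar p^k takes the place of \<open>M\<close>, with all factors d_j equal to
  p^k.\<close>

lemma level_functional_refine:
  fixes \<sigma> :: "'n::{finite,linorder} qmat"
  assumes cop: "coprime (int p) (int l)" and l: "l > 0" and p: "p > 0"
    and \<sigma>: "det \<sigma> \<noteq> 0" "matrix_lattice \<sigma> \<subseteq> int_lattice" and k: "k \<le> k'"
    and B: "transversal B (matrix_lattice (mat (of_nat p ^ k))) (matrix_lattice (mat (of_nat p ^ k')))"
  shows "level_functional l p \<sigma> u k P w = (\<Sum>b\<in>B. level_functional l p \<sigma> u k' P (w + b))"
proof -
  let ?p = "mat (of_nat p ^ k) :: 'n qmat"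
  have inv: "matrix_inv ?p = mat (1 / of_nat p ^ k)"
    using p by (subst (1 2) diag_mat_const[symmetric], subst matrix_inv_diag) auto
  have kk: "of_nat p ^ k' * (1 / of_nat p ^ k) = (of_nat (p ^ (k' - k)) :: rat)"
    unfolding of_nat_power using p k by (simp add: power_diff)
  have "?p ** \<sigma> = \<sigma> ** diag_mat (\<lambda>_. of_nat p ^ k)" by (simp add: diag_mat_const mat_mult_commute)
  moreover have "smoothed_functional l ?p (\<sigma> ** diag_mat (\<lambda>_. of_nat p ^ k)) u P w
      = (\<Sum>b\<in>B. level_functional l p \<sigma> u k' P (w + b))"
  proof (rule smoothed_functional_eq_level_sum[OF cop l p _ _ _ \<sigma> _ _ B])
    show "int_Gamma0 l ?p" using int_Gamma0_mat[of l "p ^ k"] by simp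
    show "det ?p \<noteq> 0" using p by (simp add: det_mat_nonzero)
    have "mat (of_nat p ^ k') ** mat (1 / of_nat p ^ k) = (mat (of_nat (p ^ (k' - k))) :: 'n qmat)"
      by (simp only: diag_mat_const[symmetric] diag_mat_mult kk)
    thus "int_Gamma0 l (mat (of_nat p ^ k') ** matrix_inv ?p)"
      using int_Gamma0_mat[of l "p ^ (k' - k)"] inv by simp
    have "matrix_lattice (?p ** \<sigma>) \<subseteq> matrix_lattice ?p"
      unfolding matrix_lattice_mult matrix_lattice_def[of ?p] using \<sigma>(2) by (rule image_mono)
    thus "matrix_lattice (\<sigma> ** diag_mat (\<lambda>_. of_nat p ^ k)) \<subseteq> matrix_lattice ?p"
      by (simp add: diag_mat_const mat_mult_commute)
  qed (use p in auto)
  ultimately show ?thesis by (simp add: level_functional_def)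
qed

section \<open>Integrality of the first columns\<close>

lemma of_int_in_localization_at:
  assumes "prime l" shows "of_int c \<in> localization_at l"
proof -
  have "\<not> int l dvd 1" using prime_gt_1_nat[OF assms] by simp
  thus ?thesis unfolding localization_at_def by (intro CollectI exI[of _ c] exI[of _ 1]) simp
qed

lemma localization_at_sum:
  assumes l: "prime l" and f: "\<And>x. x \<in> A \<Longrightarrow> f x \<in> localization_at l"
  shows "sum f A \<in> localization_at l"
  using f
proof (induction A rule: infinite_finite_induct)
  case (insert x F)
  obtain a b where 1: "f x = of_int a / of_int b" "\<not> int l dvd b"
    using insert.prems[of x] by (auto simp: localization_at_def)
  obtain c d where 2: "sum f F = of_int c / of_int d" "\<not> int l dvd d"
    using insert.IH insert.prems by (auto simp: localization_at_def)
  have "b \<noteq> 0" "d \<noteq> 0" using 1 2 by auto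
  hence "sum f (insert x F) = of_int (a * d + c * b) / of_int (b * d)"
    using insert.hyps 1 2 by (simp add: field_simps)
  moreover have "\<not> int l dvd b * d"
    using 1 2 l by (metis prime_dvd_mult_iff prime_nat_int_transfer)
  ultimately show ?case unfolding localization_at_def by blast
qed (use of_int_in_localization_at[OF l, of 0] in auto)

lemma localization_at_mult:
  assumes l: "prime l" and "x \<in> localization_at l" "y \<in> localization_at l"
  shows "x * y \<in> localization_at l"
proof -
  obtain a b c d where *: "x = of_int a / of_int b" "\<not> int l dvd b" "y = of_int c / of_int d" "\<not> int l dvd d"
    using assms by (auto simp: localization_at_def)
  have "x * y = of_int (a * c) / of_int (b * d)" by (simp add: *)
  moreover have "\<not> int l dvd b * d"
    using * l by (metis prime_dvd_mult_iff prime_nat_int_transfer)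
  ultimately show ?thesis unfolding localization_at_def by blast
qed

lemma Ints_divide_localization:
  assumes l: "prime l" and z: "z \<in> \<int>" "z = of_nat l * c" "c \<in> localization_at l"
  shows "z / of_nat l \<in> \<int>"
proof -
  obtain a b where ab: "c = of_int a / of_int b" "\<not> int l dvd b"
    using z(3) by (auto simp: localization_at_def)
  have l0: "(of_nat l :: rat) \<noteq> 0" and b0: "b \<noteq> 0" using prime_gt_0_nat[OF l] ab by auto
  have "of_int b * z / of_nat l = of_int a" using l0 b0 by (simp add: z(2) ab)
  hence "of_int b * z / of_nat l \<in> \<int>" by simp
  moreover have "coprime b (int l)"
    using l ab(2) by (metis coprime_commute prime_imp_coprime prime_nat_int_transfer)
  ultimately show ?thesis using z(1) by (rule Ints_divide_coprime[rotated])
qed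

lemma adjoin_inverse_clear:
  assumes "x \<in> adjoin_inverse p" "p > 0" shows "\<exists>k. \<forall>k'\<ge>k. of_nat p ^ k' * x \<in> \<int>"
proof -
  obtain a k where "x = of_int a / of_nat p ^ k" using assms by (auto simp: adjoin_inverse_def)
  hence "of_nat p ^ k' * x = of_int (a * int p ^ (k' - k))" if "k' \<ge> k" for k'
  proof -
    have "(of_nat p ^ k' :: rat) = of_nat p ^ k * of_nat p ^ (k' - k)"
      using that by (simp flip: power_add)
    thus ?thesis using assms(2) \<open>x = _\<close> by simp
  qed
  thus ?thesis by (metis Ints_of_int)
qed

lemma adjoin_inverse_clear_all:
  assumes "\<And>i::'i::finite. f i \<in> adjoin_inverse p" "p > 0"
  shows "\<exists>k. \<forall>k'\<ge>k. \<forall>i. of_nat p ^ k' * f i \<in> \<int>"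
proof -
  obtain k where k: "\<And>i k'. k' \<ge> k i \<Longrightarrow> of_nat p ^ k' * f i \<in> \<int>"
    using adjoin_inverse_clear[OF assms(1) assms(2)] by metis
  have "k i \<le> Max (range k)" for i by simp
  thus ?thesis using k by (meson order_trans)
qed

text \<open>Division with remainder strengthens minimality to divisibility: a factor bounded by a
  power of p would say nothing about l, whereas a divisor of a power of p is prime to l.\<close>

lemma clear_denominators_eq:
  fixes x :: "'n::finite qvec"
  obtains d where "d > 0" "clear_denominators x = of_nat d *s x" "of_nat d *s x \<in> int_lattice"
    and "\<And>e::nat. of_nat e *s x \<in> int_lattice \<Longrightarrow> d dvd e"
proof -
  define Q where "Q d \<longleftrightarrow> d > 0 \<and> (\<forall>i. of_nat d * x $ i \<in> \<int>)" for d :: nat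
  have "\<exists>d. Q d" using common_denominator[of "range (($) x)"] by (auto simp: Q_def)
  hence Q: "Q (Least Q)" by (rule LeastI_ex)
  show ?thesis
  proof (rule that[of "Least Q"])
    show "Least Q > 0" "of_nat (Least Q) *s x \<in> int_lattice" using Q by (auto simp: Q_def int_lattice_def)
    show "clear_denominators x = of_nat (Least Q) *s x" unfolding clear_denominators_def Q_def ..
    fix e :: nat assume e: "of_nat e *s x \<in> int_lattice"
    show "Least Q dvd e"
    proof (rule ccontr)
      assume "\<not> Least Q dvd e"
      hence pos: "e mod Least Q > 0" by (simp add: dvd_eq_mod_eq_0)
      have "of_nat (e mod Least Q) * x $ i \<in> \<int>" for i
      proof -
        have "of_nat (e mod Least Q) * x $ i = of_nat e * x $ i - of_nat (e div Least Q) * (of_nat (Least Q) * x $ i)"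
        proof -
          have "(of_nat e :: rat) = of_nat (e mod Least Q + Least Q * (e div Least Q))" by simp
          thus ?thesis unfolding of_nat_add of_nat_mult by (simp add: algebra_simps)
        qed
        also have "\<dots> \<in> \<int>"
        proof (rule Ints_diff)
          show "of_nat e * x $ i \<in> \<int>" using e by (simp add: int_lattice_def)
          have "of_nat (Least Q) * x $ i \<in> \<int>" using Q by (simp add: Q_def)
          thus "of_nat (e div Least Q) * (of_nat (Least Q) * x $ i) \<in> \<int>" by (rule Ints_mult[OF Ints_of_nat])
        qed
        finally show ?thesis .
      qed
      hence "Q (e mod Least Q)" using pos by (simp add: Q_def)
      hence "Least Q \<le> e mod Least Q" by (rule Least_le)
      moreover have "e mod Least Q < Least Q" using Q by (simp add: Q_def)
      ultimately show False by simp
    qed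
  qed
qed

text \<open>Modulo l the cleared column is a multiple of the first unit vector. The multiple is a
  unit: if l divided the whole column, multiplying by the first row of the inverse matrix would show
  that l divides d.\<close>

lemma Gamma_lp_first_column:
  fixes A :: "'n::{finite,linorder} qmat"
  assumes l: "prime l" and A: "A \<in> Gamma_l l" and d: "coprime (int d) (int l)"
    and x: "of_nat d *s column first_index A \<in> int_lattice"
  shows "i \<noteq> first_index \<Longrightarrow> of_nat d * A $ i $ first_index / of_nat l \<in> \<int>"
    and "of_nat d * A $ first_index $ first_index / of_nat l \<notin> \<int>"
proof -
  have int: "of_nat d * A $ i $ first_index \<in> \<int>" for i using x by (simp add: int_lattice_def column_def)
  have l0: "(of_nat l :: rat) \<noteq> 0" using prime_gt_0_nat[OF l] by simp
  note of_int_loc = of_int_in_localization_at[OF l]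
  have of_nat_loc: "of_nat c \<in> localization_at l" for c using of_int_loc[of "int c"] by simp
  show *: "of_nat d * A $ i $ first_index / of_nat l \<in> \<int>" if "i \<noteq> first_index" for i
  proof -
    obtain c where "c \<in> localization_at l" "A $ i $ first_index = of_nat l * c"
      using A \<open>i \<noteq> first_index\<close> by (auto simp: Gamma_l_def)
    thus ?thesis
      using int[of i] by (intro Ints_divide_localization[OF l, of _ "of_nat d * c"] localization_at_mult[OF l])
        (auto simp: of_nat_loc)
  qed
  show "of_nat d * A $ first_index $ first_index / of_nat l \<notin> \<int>"
  proof
    assume "of_nat d * A $ first_index $ first_index / of_nat l \<in> \<int>"
    hence all: "of_nat d * A $ i $ first_index / of_nat l \<in> \<int>" for i
      using * by (cases "i = first_index") auto
    obtain B where B: "\<And>i j. B $ i $ j \<in> localization_at l" "B ** A = mat 1"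
      using A by (auto simp: Gamma_l_def GL_over_def)
    have "(\<Sum>k\<in>UNIV. B $ first_index $ k * A $ k $ first_index) = 1"
      using arg_cong[OF B(2), of "\<lambda>X. X $ first_index $ first_index"] by (simp add: matrix_matrix_mult_def mat_def)
    hence "of_nat d = of_nat d * (\<Sum>k\<in>UNIV. B $ first_index $ k * A $ k $ first_index)" by simp
    also have "\<dots> = of_nat l * (\<Sum>k\<in>UNIV. B $ first_index $ k * (of_nat d * A $ k $ first_index / of_nat l))"
      using l0 by (simp add: sum_distrib_left field_simps)
    finally have eq: "of_nat d = of_nat l * (\<Sum>k\<in>UNIV. B $ first_index $ k * (of_nat d * A $ k $ first_index / of_nat l))" .
    have "(\<Sum>k\<in>UNIV. B $ first_index $ k * (of_nat d * A $ k $ first_index / of_nat l)) \<in> localization_at l"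
    proof (rule localization_at_sum[OF l], rule localization_at_mult[OF l B(1)])
      fix k show "of_nat d * A $ k $ first_index / of_nat l \<in> localization_at l"
        using all[of k] of_int_loc by (metis Ints_cases)
    qed
    hence "of_nat d / of_nat l \<in> (\<int> :: rat set)" by (intro Ints_divide_localization[OF l _ eq]) auto
    then obtain z where "(of_nat d / of_nat l :: rat) = of_int z" by (auto elim: Ints_cases)
    hence "(of_int (int d) :: rat) = of_int (z * int l)" using l0 by (simp add: field_simps)
    hence "int l dvd int d" by (metis dvd_triv_right of_int_eq_iff)
    thus False using d l by (metis coprime_commute coprime_absorb_left not_prime_unit prime_nat_int_transfer)
  qed
qed

text \<open>Put N = p^k M^{-1}, integral for large k. For i other than the first index, the entry
  (i, first) of N M = p^k is zero; modulo l only N_{i1} M_{11} is left in it, and M_{11} is prime to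
  l.\<close>

lemma int_Gamma0_inverse:
  fixes M :: "'n::{finite,linorder} qmat"
  assumes l: "prime l" and p: "p > 0" and cop: "coprime (int p) (int l)"
    and M: "\<forall>i j. M $ i $ j \<in> \<int>" "M \<in> Gamma_lp l p"
  shows "det M \<noteq> 0" "int_Gamma0 l M" "\<exists>K. \<forall>k\<ge>K. int_Gamma0 l (mat (of_nat p ^ k) ** matrix_inv M)"
proof -
  have l0: "(of_nat l :: rat) \<noteq> 0" using prime_gt_0_nat[OF l] by simp
  obtain B where B: "\<And>i j. B $ i $ j \<in> adjoin_inverse p" "M ** B = mat 1" "B ** M = mat 1"
    using M(2) by (auto simp: Gamma_lp_def GL_over_def)
  have "det M * det B = 1" using B(2) by (metis det_I det_mul)
  thus det: "det M \<noteq> 0" by auto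
  have inv: "matrix_inv M = B" by (rule matrix_inv_unique[OF B(2)])
  have "of_nat 1 *s column first_index M \<in> int_lattice"
    using M(1) by (simp add: int_lattice_def column_def)
  note col = Gamma_lp_first_column[OF l _ _ this]
  have MG: "M \<in> Gamma_l l" using M(2) by (simp add: Gamma_lp_def)
  have c1: "M $ i $ first_index / of_nat l \<in> \<int>" if "i \<noteq> first_index" for i
    using col(1)[OF MG _ that] by simp
  have c2: "M $ first_index $ first_index / of_nat l \<notin> \<int>" using col(2)[OF MG] by simp
  show "int_Gamma0 l M" using M(1) c1 by (simp add: int_Gamma0_def)
  obtain m where m: "M $ first_index $ first_index = of_int m" using M(1) by (metis Ints_cases)
  have copm: "coprime m (int l)"
  proof (rule ccontr)
    assume "\<not> coprime m (int l)"
    hence "int l dvd m" using l by (metis coprime_commute prime_imp_coprime prime_nat_int_transfer)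
    then obtain z where "m = int l * z" by auto
    hence "M $ first_index $ first_index / of_nat l = of_int z" using l0 m by simp
    thus False using c2 by simp
  qed
  have "\<exists>K. \<forall>k\<ge>K. \<forall>ij. of_nat p ^ k * (\<lambda>(i, j). B $ i $ j) ij \<in> \<int>"
    by (rule adjoin_inverse_clear_all) (use B(1) p in auto)
  then obtain K where "\<forall>k\<ge>K. \<forall>ij. of_nat p ^ k * (\<lambda>(i, j). B $ i $ j) ij \<in> \<int>" by blast
  hence K: "of_nat p ^ k * B $ i $ j \<in> \<int>" if "k \<ge> K" for k i j
    using that by (auto dest!: spec[of _ k] spec[of _ "(i, j)"])
  have "int_Gamma0 l (mat (of_nat p ^ k) ** matrix_inv M)" if k: "k \<ge> K" for k
  proof -
    define N where "N = mat (of_nat p ^ k) ** B"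
    have N: "N $ i $ j = of_nat p ^ k * B $ i $ j" for i j
      unfolding N_def diag_mat_const[symmetric] 
      by (simp add: matrix_matrix_mult_def diag_mat_def if_distrib if_distribR cong: if_cong)
    have Ni: "N $ i $ j \<in> \<int>" for i j unfolding N by (rule K[OF k])
    have NM: "N ** M = mat (of_nat p ^ k)"
      by (simp add: N_def B(3) flip: matrix_mul_assoc)
    have "N $ i $ first_index / of_nat l \<in> \<int>" if i: "i \<noteq> first_index" for i
    proof (rule Ints_divide_coprime[OF Ni _ copm])
      have "(\<Sum>j\<in>UNIV. N $ i $ j * M $ j $ first_index) = 0"
        using arg_cong[OF NM, of "\<lambda>X. X $ i $ first_index"] i by (simp add: matrix_matrix_mult_def mat_def)
      hence "N $ i $ first_index * M $ first_index $ first_index + (\<Sum>j\<in>UNIV - {first_index}. N $ i $ j * M $ j $ first_index) = 0"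
        by (simp add: sum.remove[of UNIV first_index])
      hence "of_int m * N $ i $ first_index / of_nat l = - (\<Sum>j\<in>UNIV - {first_index}. N $ i $ j * (M $ j $ first_index / of_nat l))"
        by (simp add: m sum_divide_distrib[symmetric] add_eq_0_iff2 mult.commute divide_minus_left[symmetric] del: divide_minus_left)
      also have "\<dots> \<in> \<int>" using Ni c1 by (intro Ints_minus Ints_sum Ints_mult[of "N $ _ $ _" "_ / _"]) auto
      finally show "of_int m * N $ i $ first_index / of_nat l \<in> \<int>" .
    qed
    thus ?thesis using Ni by (simp add: int_Gamma0_def inv N_def)
  qed
  thus "\<exists>K. \<forall>k\<ge>K. int_Gamma0 l (mat (of_nat p ^ k) ** matrix_inv M)" by blast
qed

section \<open>The columns of the cocycle matrix modulo l\<close>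

lemma matrix_lattice_subset_iff_columns:
  fixes g :: "'n::finite qmat"
  assumes "add_subgroup X"
  shows "matrix_lattice g \<subseteq> X \<longleftrightarrow> (\<forall>j. column j g \<in> X)"
proof
  assume *: "matrix_lattice g \<subseteq> X"
  show "\<forall>j. column j g \<in> X"
  proof
    fix j
    have "column j g = g *v rat_vec (\<chi> i. if i = j then 1 else 0)"
    proof -
      have "(\<Sum>k\<in>UNIV. g $ i $ k * of_int (if k = j then 1 else 0)) = (\<Sum>k\<in>UNIV. if k = j then g $ i $ j else 0)" for i
        by (intro sum.cong) auto
      thus ?thesis by (simp add: vec_eq_iff column_def matrix_vector_mult_def rat_vec_def)
    qed
    thus "column j g \<in> X" using * by (auto simp: matrix_lattice_def)
  qed
next
  assume *: "\<forall>j. column j g \<in> X"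
  have int_mult: "of_int z *s x \<in> X" if x: "x \<in> X" for z :: int and x
  proof (induction z rule: int_induct[of _ 0])
    case base thus ?case using add_subgroupD(1)[OF assms] by simp
  next
    case (step1 i)
    thus ?case using add_subgroupD(4)[OF assms step1(2) x] by (simp add: vector_sadd_rdistrib)
  next
    case (step2 i)
    thus ?case using add_subgroupD(2)[OF assms step2(2) x] by (simp add: vector_sub_rdistrib)
  qed
  have sums: "(\<Sum>j\<in>J. f j) \<in> X" if "\<And>j. f j \<in> X" for f :: "'n \<Rightarrow> 'n qvec" and J
    using that by (induction J rule: infinite_finite_induct) (auto intro: add_subgroupD[OF assms])
  show "matrix_lattice g \<subseteq> X"
  proof
    fix y assume "y \<in> matrix_lattice g"
    then obtain z where "y = g *v rat_vec z" by (auto simp: matrix_lattice_def int_lattice_eq_range)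
    hence "y = (\<Sum>j\<in>UNIV. of_int (z $ j) *s column j g)"
      by (simp add: matrix_mult_sum rat_vec_def)
    thus "y \<in> X" using sums[of "\<lambda>j. of_int (z $ j) *s column j g"] int_mult * by simp
  qed
qed

lemma mult_mat_nth: "(g ** mat c) $ i $ j = (g $ i $ j * c :: rat)"
  unfolding diag_mat_const[symmetric] by (simp add: matrix_matrix_mult_def diag_mat_def if_distrib cong: if_cong)

text \<open>
  The conditions on \<open>\<sigma>\<close> used below: the columns are integral and congruent modulo \<open>l\<close> to unit
  multiples of the first unit vector.
\<close>

definition unit_column_matrix :: "nat \<Rightarrow> 'n::{finite,linorder} qmat \<Rightarrow> bool" where
  "unit_column_matrix l \<sigma> \<longleftrightarrow> matrix_lattice \<sigma> \<subseteq> int_lattice \<and>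
     matrix_lattice (\<sigma> ** mat (1 / of_nat l)) \<subseteq> ext_lattice l \<and>
     (\<forall>j. \<sigma> $ first_index $ j / of_nat l \<notin> \<int>)"

lemma ext_lattice_columns:
  fixes \<sigma> :: "'n::{finite,linorder} qmat"
  assumes l: "l > 0" and \<sigma>: "\<And>j. column j \<sigma> \<in> int_lattice"
    "\<And>i j. i \<noteq> first_index \<Longrightarrow> \<sigma> $ i $ j / of_nat l \<in> \<int>"
  shows "matrix_lattice \<sigma> \<subseteq> int_lattice" "matrix_lattice (\<sigma> ** mat (1 / of_nat l)) \<subseteq> ext_lattice l"
proof -
  show "matrix_lattice \<sigma> \<subseteq> int_lattice" using \<sigma>(1) by (simp add: matrix_lattice_subset_iff_columns)
  have "add_subgroup (ext_lattice l :: 'n qvec set)" by (simp add: ext_lattice_eq l)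
  moreover have "column j (\<sigma> ** mat (1 / of_nat l)) \<in> ext_lattice l" for j
    using \<sigma>(1)[of j] \<sigma>(2)[of _ j] l by (auto simp: ext_lattice_def int_lattice_def column_def mult_mat_nth)
  ultimately show "matrix_lattice (\<sigma> ** mat (1 / of_nat l)) \<subseteq> ext_lattice l"
    by (simp add: matrix_lattice_subset_iff_columns)
qed

lemma sigma_mat_column: "column j (sigma_mat B) = clear_denominators (column first_index (B j))"
  by (simp add: sigma_mat_def column_def vec_eq_iff)

lemma Gamma_lp_clear:
  fixes A :: "'n::{finite,linorder} qmat"
  assumes p: "p > 0" and A: "A \<in> Gamma_lp l p"
  shows "\<exists>s. of_nat (p ^ s) *s column first_index A \<in> int_lattice"
proof -
  have "A $ i $ first_index \<in> adjoin_inverse p" for i using A by (simp add: Gamma_lp_def GL_over_def)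
  from adjoin_inverse_clear_all[of "\<lambda>i. A $ i $ first_index", OF this p] obtain k where "\<forall>i. of_nat p ^ k * A $ i $ first_index \<in> \<int>" by blast
  thus ?thesis by (intro exI[of _ k]) (simp add: int_lattice_def column_def)
qed

text \<open>First columns over Z[1/p] are cleared by a power of p; the least clearing factor divides
  it, hence is prime to l and preserves the shape of the column modulo l.\<close>

lemma unit_column_matrix_sigma_mat:
  fixes A :: "'n::{finite,linorder} \<Rightarrow> 'n qmat"
  assumes l: "prime l" and p: "p > 0" and cop: "coprime (int p) (int l)" and A: "\<forall>i. A i \<in> Gamma_lp l p"
  shows "unit_column_matrix l (sigma_mat A)"
proof -
  have l0: "l > 0" using prime_gt_0_nat[OF l] .
  have *: "column j (sigma_mat A) \<in> int_lattice \<and>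
      (\<forall>i. i \<noteq> first_index \<longrightarrow> sigma_mat A $ i $ j / of_nat l \<in> \<int>) \<and>
      sigma_mat A $ first_index $ j / of_nat l \<notin> \<int>" for j
  proof -
    let ?x = "column first_index (A j)"
    obtain d where d: "d > 0" "clear_denominators ?x = of_nat d *s ?x" "of_nat d *s ?x \<in> int_lattice"
      "\<And>e::nat. of_nat e *s ?x \<in> int_lattice \<Longrightarrow> d dvd e"
      using clear_denominators_eq[of ?x] by blast
    obtain s where "of_nat (p ^ s) *s ?x \<in> int_lattice" using Gamma_lp_clear[OF p, of "A j" l] A by blast
    hence "d dvd p ^ s" by (rule d(4))
    hence "int d dvd int p ^ s" by (metis of_nat_dvd_iff of_nat_power)
    hence cop': "coprime (int d) (int l)" using cop
      by (meson coprime_divisors coprime_power_left_iff dvd_refl)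
    have AG: "A j \<in> Gamma_l l" using A by (simp add: Gamma_lp_def)
    have entry: "sigma_mat A $ i $ j = of_nat d * A j $ i $ first_index" for i
      by (simp add: sigma_mat_def d(2)) (simp add: column_def)
    show ?thesis
      using d(2,3) Gamma_lp_first_column[OF l AG cop' d(3)] by (simp add: sigma_mat_column entry)
  qed
  show ?thesis
    unfolding unit_column_matrix_def using * ext_lattice_columns[OF l0, of "sigma_mat A"] by blast
qed

text \<open>Normalisation does not commute with M^{-1}, but for the first column x of A_j both ways
  lead to positive multiples of M^{-1}x; the quotient of the two clearing factors is the scaling of
  column j.\<close>

lemma sigma_mat_inverse:
  fixes A :: "'n::{finite,linorder} \<Rightarrow> 'n qmat"
  assumes l: "prime l" and p: "p > 0" and cop: "coprime (int p) (int l)" and A: "\<forall>i. A i \<in> Gamma_lp l p"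
    and M: "\<forall>i j. M $ i $ j \<in> \<int>" "M \<in> Gamma_lp l p"
  obtains d where "\<And>j. d j > 0" "sigma_mat (\<lambda>i. matrix_inv M ** A i) = matrix_inv M ** (sigma_mat A ** diag_mat d)"
    "matrix_lattice (sigma_mat (\<lambda>i. matrix_inv M ** A i)) \<subseteq> int_lattice"
    "matrix_lattice (sigma_mat (\<lambda>i. matrix_inv M ** A i) ** mat (1 / of_nat l)) \<subseteq> ext_lattice l"
proof -
  have l0: "l > 0" using prime_gt_0_nat[OF l] .
  note G = int_Gamma0_inverse[OF l p cop M]
  obtain K where K: "int_Gamma0 l (mat (of_nat p ^ K) ** matrix_inv M)" using G(3) by blast
  let ?N = "mat (of_nat p ^ K) ** matrix_inv M"
  let ?s = "sigma_mat (\<lambda>i. matrix_inv M ** A i)"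
  have ext: "add_subgroup (ext_lattice l :: 'n qvec set)" by (simp add: ext_lattice_eq l0)
  have "\<exists>c>0. column j ?s = c *s (matrix_inv M *v column j (sigma_mat A)) \<and> column j ?s \<in> int_lattice \<and>
      (1 / of_nat l) *s column j ?s \<in> ext_lattice l" for j
  proof -
    let ?x = "column first_index (A j)"
    have col: "column first_index (matrix_inv M ** A j) = matrix_inv M *v ?x"
      by (simp add: vec_eq_iff column_def matrix_matrix_mult_def matrix_vector_mult_def)
    obtain d where d: "d > 0" "clear_denominators ?x = of_nat d *s ?x" "of_nat d *s ?x \<in> int_lattice"
      "\<And>e::nat. of_nat e *s ?x \<in> int_lattice \<Longrightarrow> d dvd e"
      using clear_denominators_eq[of ?x] by blast
    obtain e where e: "e > 0" "clear_denominators (matrix_inv M *v ?x) = of_nat e *s (matrix_inv M *v ?x)"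
      "of_nat e *s (matrix_inv M *v ?x) \<in> int_lattice"
      "\<And>f::nat. of_nat f *s (matrix_inv M *v ?x) \<in> int_lattice \<Longrightarrow> e dvd f"
      using clear_denominators_eq[of "matrix_inv M *v ?x"] by blast
    obtain s where s: "of_nat (p ^ s) *s ?x \<in> int_lattice" using Gamma_lp_clear[OF p, of "A j" l] A by blast
    let ?y = "column j ?s"
    have y: "?y = of_nat e *s (matrix_inv M *v ?x)" unfolding sigma_mat_column col by (rule e(2))
    have "?y = (of_nat e / of_nat d) *s (matrix_inv M *v column j (sigma_mat A))"
      unfolding y sigma_mat_column[of j A] d(2) using d(1) by (simp add: vector_scalar_commute)
    moreover have yint: "?y \<in> int_lattice" using e(3) y by simp
    moreover have "(1 / of_nat l) *s ?y \<in> ext_lattice l"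
    proof -
      have nm: "of_nat c *s z \<in> ext_lattice l" if "z \<in> ext_lattice l" for c and z :: "'n qvec"
        using that by (auto simp: ext_lattice_def mult.left_commute intro!: Ints_mult)
      have un: "unit_column_matrix l (sigma_mat A)" by (rule unit_column_matrix_sigma_mat[OF l p cop A])
      have "column j (sigma_mat A ** mat (1 / of_nat l)) \<in> ext_lattice l"
        using un unfolding unit_column_matrix_def matrix_lattice_subset_iff_columns[OF ext] by blast
      moreover have "column j (sigma_mat A ** mat (1 / of_nat l)) = (1 / of_nat l) *s column j (sigma_mat A)"
        by (simp add: vec_eq_iff column_def mult_mat_nth)
      ultimately have "(1 / of_nat l) *s (of_nat d *s ?x) \<in> ext_lattice l"
        by (simp add: sigma_mat_column d(2))
      hence "of_nat e *s (?N *v ((1 / of_nat l) *s (of_nat d *s ?x))) \<in> ext_lattice l"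
        using int_Gamma0_lattice(2)[OF K l0] by (intro nm) blast
      also have "of_nat e *s (?N *v ((1 / of_nat l) *s (of_nat d *s ?x))) = (of_nat (d * p ^ K) / of_nat l) *s ?y"
        by (simp add: y vector_scalar_commute mat_vector_mult mult_ac flip: matrix_vector_mul_assoc)
      \<comment> \<open>The factor d p^K comes from clearing x and from making M^{-1} integral. It
        is prime to l, so divisibility by l descends from this multiple to the column.\<close>
      finally have big: "(of_nat (d * p ^ K) / of_nat l) *s ?y \<in> ext_lattice l" .
      have "coprime (int (d * p ^ K)) (int l)"
      proof -
        have "d dvd p ^ s" by (rule d(4)[OF s])
        hence "int d dvd int p ^ s" by (metis of_nat_dvd_iff of_nat_power)
        hence "coprime (int d) (int l)" using cop
          by (meson coprime_divisors coprime_power_left_iff dvd_refl)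
        thus ?thesis using cop by simp
      qed
      note cp = Ints_divide_coprime[OF _ _ this]
      have "?y $ i / of_nat l \<in> \<int>" if i: "i \<noteq> first_index" for i
        by (rule cp) (use big yint i in \<open>auto simp: ext_lattice_def int_lattice_def\<close>)
      thus ?thesis using yint l0 by (auto simp: ext_lattice_def int_lattice_def)
    qed
    ultimately show ?thesis using d(1) e(1) by (intro exI[of _ "of_nat e / of_nat d"]) simp
  qed
  then obtain c where c: "\<And>j. c j > 0" "\<And>j. column j ?s = c j *s (matrix_inv M *v column j (sigma_mat A))"
    "\<And>j. column j ?s \<in> int_lattice" "\<And>j. (1 / of_nat l) *s column j ?s \<in> ext_lattice l"
    by metis
  show ?thesis
  proof (rule that[of c])
    show "c j > 0" for j by (rule c(1))
    have dm: "column j (X ** diag_mat c) = c j *s column j X" for X :: "'n qmat" and j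
      by (simp add: vec_eq_iff column_def matrix_matrix_mult_def diag_mat_def if_distrib mult.commute cong: if_cong)
    have mm: "column j (X ** Y) = X *v column j Y" for X Y :: "'n qmat" and j
      by (simp add: vec_eq_iff column_def matrix_matrix_mult_def matrix_vector_mult_def)
    have "column j ?s = column j (matrix_inv M ** (sigma_mat A ** diag_mat c))" for j
      by (simp only: c(2)[of j] matrix_mul_assoc dm) (simp only: mm)
    thus "?s = matrix_inv M ** (sigma_mat A ** diag_mat c)"
      by (simp add: vec_eq_iff column_def)
    have e: "?s $ i $ j / of_nat l \<in> \<int>" if "i \<noteq> first_index" for i j
      using c(4)[of j] that by (auto simp: ext_lattice_def column_def)
    show "matrix_lattice ?s \<subseteq> int_lattice" "matrix_lattice (?s ** mat (1 / of_nat l)) \<subseteq> ext_lattice l"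
      by (rule ext_lattice_columns[OF l0 c(3) e]; assumption)+
  qed
qed

lemma act_forms_mult: "act_forms B (act_forms C Q) = act_forms (B ** C) (Q :: real^'n^'m)"
proof -
  have "map_matrix of_rat (B ** C) = (map_matrix of_rat B ** map_matrix of_rat C :: real^'n^'n)"
    by (simp add: vec_eq_iff matrix_matrix_mult_def of_rat_sum of_rat_mult)
  thus ?thesis unfolding act_forms_def by (simp add: matrix_vector_mul_assoc)
qed

lemma act_forms_diag_nth: "act_forms (diag_mat d ** B) Q $ i $ j = of_rat (d j) * act_forms B (Q :: real^'n^'m) $ i $ j"
proof -
  have "(map_matrix of_rat (diag_mat d) :: real^'n^'n) = diag_mat (\<lambda>j. of_rat (d j))"
    by (simp add: vec_eq_iff diag_mat_def)
  moreover have "act_forms (diag_mat d ** B) Q = act_forms (diag_mat d) (act_forms B Q)"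
    by (simp add: act_forms_mult)
  ultimately show ?thesis by (simp add: act_forms_def)
qed

lemma act_forms_linear_forms:
  fixes Q :: "real^'n^'m"
  assumes Q: "Q \<in> linear_forms" and B: "det B \<noteq> 0"
  shows "act_forms B Q \<in> linear_forms"
  unfolding linear_forms_def
proof (intro CollectI allI impI)
  fix i and x :: "'n qvec" assume x: "x \<noteq> 0"
  have "x v* B \<noteq> 0"
  proof
    assume "x v* B = 0"
    hence "transpose B *v x = 0" by simp
    hence "x = matrix_inv (transpose B) *v 0"
      using matrix_inv_vec(2)[of "transpose B" x] B by (simp add: det_transpose)
    thus False using x by simp
  qed
  hence "(\<Sum>k\<in>UNIV. Q $ i $ k * of_rat ((x v* B) $ k)) \<noteq> 0" using Q by (auto simp: linear_forms_def)
  also have "(\<Sum>k\<in>UNIV. Q $ i $ k * of_rat ((x v* B) $ k)) = (\<Sum>j\<in>UNIV. act_forms B Q $ i $ j * of_rat (x $ j))"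
    unfolding act_forms_def
    by (simp add: vector_matrix_mult_def matrix_vector_mult_def of_rat_sum of_rat_mult sum_distrib_left sum_distrib_right)
      (subst sum.swap, simp add: mult_ac)
  finally show "(\<Sum>j\<in>UNIV. act_forms B Q $ i $ j * of_rat (x $ j)) \<noteq> 0" .
qed

lemma det_matrix_inv: "det (A :: 'n::finite qmat) \<noteq> 0 \<Longrightarrow> det (matrix_inv A) = 1 / det A"
  using matrix_inv_mult(1)[of A] by (metis det_I det_mul nonzero_eq_divide_eq mult.commute)

section \<open>The cocycle as an additive function of balls\<close>

context
  fixes l p :: nat and A :: "'n::{finite,linorder} \<Rightarrow> 'n qmat" and Q :: "((real, 'n) vec, 'm::finite) vec"
    and \<sigma> :: "'n qmat" and u :: "'m \<Rightarrow> 'n \<Rightarrow> bool"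
  assumes l: "prime l" and p: "p > 0" and cop: "coprime (int p) (int l)"
    and A: "\<forall>i. A i \<in> Gamma_lp l p" and Q: "Q \<in> linear_forms"
    and sig: "sigma_mat A = \<sigma>" and \<sigma>: "det \<sigma> \<noteq> 0"
  defines "u \<equiv> \<lambda>i j. act_forms (matrix_inv \<sigma>) Q $ i $ j > 0"
begin

text \<open>At P = 1 this is the measure of the ball of level k around w; at general P it is the
  prospective integral of P over that ball.\<close>

definition level_value :: "nat \<Rightarrow> 'n rat_mpoly \<Rightarrow> 'n qvec \<Rightarrow> rat" where
  "level_value k P w = (- 1) ^ CARD('n) * sgn (det \<sigma>) / of_nat CARD('m) *
     (\<Sum>i\<in>UNIV. level_functional l p \<sigma> (u i) k P w)"

text \<open>The substitution of p^k X for X fixes the polynomial 1.\<close>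

lemma Psi_one_eq_level_value:
  "Psi l A 1 Q ((1 / of_nat p ^ k) *s w) = level_value k 1 w"
proof -
  have l0: "l > 0" using prime_gt_0_nat[OF l] .
  have un: "unit_column_matrix l \<sigma>" using unit_column_matrix_sigma_mat[OF l p cop A] sig by simp
  hence un': "matrix_lattice \<sigma> \<subseteq> int_lattice" "matrix_lattice (\<sigma> ** mat (1 / of_nat l)) \<subseteq> ext_lattice l"
    by (auto simp: unit_column_matrix_def)
  show ?thesis
    unfolding level_value_def level_functional_eq_smoothed[OF l0 p \<sigma>] act_poly_1 u_def
    by (rule Psi_eq[OF l0 un' Q sig])
qed

lemma level_value_refine:
  assumes "k \<le> k'" "transversal B (matrix_lattice (mat (of_nat p ^ k))) (matrix_lattice (mat (of_nat p ^ k')))"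
  shows "level_value k P w = (\<Sum>b\<in>B. level_value k' P (w + b))"
proof -
  have l0: "l > 0" using prime_gt_0_nat[OF l] .
  have un: "unit_column_matrix l \<sigma>" using unit_column_matrix_sigma_mat[OF l p cop A] sig by simp
  hence un': "matrix_lattice \<sigma> \<subseteq> int_lattice" by (auto simp: unit_column_matrix_def)
  show ?thesis
    unfolding level_value_def level_functional_refine[OF cop l0 p \<sigma> un' assms] sum_distrib_left[symmetric]
    by (subst sum.swap) (rule refl)
qed

lemma level_value_add:
  assumes "b \<in> matrix_lattice (mat (of_nat p ^ k))"
  shows "level_value k P (w + b) = level_value k P w"
  unfolding level_value_def level_functional_add[OF prime_gt_0_nat[OF l] p \<sigma> assms] ..

text \<open>The matrix for M^{-1}A is M^{-1}\<sigma> with positively rescaled columns; its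
  determinant is det \<sigma> times a positive number over det M, which is the origin of sgn(det M).
  In its basis the forms M^{-1}Q have coefficients that are positive multiples of those of
  \<sigma>^{-1}Q, so the sides \<open>u\<close> do not change.\<close>

lemma Psi_inverse_eq_level_sum:
  assumes M: "\<forall>i j. M $ i $ j \<in> \<int>" "M \<in> Gamma_lp l p"
    and k: "int_Gamma0 l (mat (of_nat p ^ k) ** matrix_inv M)"
    and B: "transversal B (matrix_lattice M) (matrix_lattice (mat (of_nat p ^ k)))"
  shows "sgn (det M) * Psi l (\<lambda>i. matrix_inv M ** A i) (act_poly (transpose M) P)
      (act_forms (matrix_inv M) Q) (matrix_inv M *v w) = (\<Sum>b\<in>B. level_value k P (w + b))"
proof -
  have l0: "l > 0" using prime_gt_0_nat[OF l] .
  have un: "unit_column_matrix l \<sigma>" using unit_column_matrix_sigma_mat[OF l p cop A] sig by simp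
  hence un': "matrix_lattice \<sigma> \<subseteq> int_lattice" by (auto simp: unit_column_matrix_def)
  note G = int_Gamma0_inverse[OF l p cop M]
  let ?s = "sigma_mat (\<lambda>i. matrix_inv M ** A i)"
  obtain d where d: "\<And>j. d j > 0" "?s = matrix_inv M ** (\<sigma> ** diag_mat d)"
    "matrix_lattice ?s \<subseteq> int_lattice" "matrix_lattice (?s ** mat (1 / of_nat l)) \<subseteq> ext_lattice l"
    using sigma_mat_inverse[OF l p cop A M] sig by metis
  have Ms: "M ** ?s = \<sigma> ** diag_mat d" by (simp add: d(2) matrix_mul_assoc matrix_inv_mult G(1))
  have d0: "d j \<noteq> 0" for j using d(1)[of j] by simp
  have pd: "prod d UNIV > 0" using d(1) by (simp add: prod_pos)
  have detD: "det (diag_mat d) \<noteq> 0" using d0 by (simp add: det_diag_mat)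
  have dets: "det ?s = det \<sigma> * prod d UNIV / det M"
    by (simp add: d(2) det_mul det_matrix_inv G(1) det_diag_mat)
  hence dets0: "det ?s \<noteq> 0" using \<sigma> d0 G(1) by simp
  have sg: "sgn (det M) * sgn (det ?s) = sgn (det \<sigma>)"
  proof -
    have "sgn (det M) * sgn (x * y / det M) = sgn x" if "y > 0" for x y
      using that G(1) by (cases "det M > 0") (simp_all add: sgn_mult sgn_divide)
    thus ?thesis using pd by (simp only: dets)
  qed
  have "matrix_inv ?s ** matrix_inv M = matrix_inv (M ** ?s)"
    by (simp add: matrix_inv_mult_distrib G(1) dets0)
  also have "\<dots> = diag_mat (\<lambda>j. 1 / d j) ** matrix_inv \<sigma>"
    by (simp add: Ms matrix_inv_mult_distrib \<sigma> detD matrix_inv_diag d0)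
  finally have inv: "matrix_inv ?s ** matrix_inv M = diag_mat (\<lambda>j. 1 / d j) ** matrix_inv \<sigma>" .
  have u': "(\<lambda>j. act_forms (matrix_inv ?s) (act_forms (matrix_inv M) Q) $ i $ j > 0) = u i" for i
    unfolding act_forms_mult inv act_forms_diag_nth u_def using d(1) order_less_not_sym[OF d(1)]
    by (simp add: fun_eq_iff zero_less_mult_iff)
  have smooth: "smoothed_functional l (mat 1) ?s (u i) (act_poly (transpose M) P) (matrix_inv M *v w)
      = (\<Sum>b\<in>B. level_functional l p \<sigma> (u i) k P (w + b))" for i
  proof -
    have "smoothed_functional l (mat 1) ?s (u i) (act_poly (transpose M) P) (matrix_inv M *v w)
        = smoothed_functional l M (\<sigma> ** diag_mat d) (u i) P w"
      using smoothed_functional_image[OF l0 dets0 G(1), of "mat 1" "u i" P "matrix_inv M *v w"]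
      by (simp add: Ms matrix_inv_vec G(1))
    also have "\<dots> = (\<Sum>b\<in>B. level_functional l p \<sigma> (u i) k P (w + b))"
    proof (rule smoothed_functional_eq_level_sum[OF cop l0 p G(2,1) k \<sigma> un' d(1) _ B])
      show "matrix_lattice (\<sigma> ** diag_mat d) \<subseteq> matrix_lattice M"
        unfolding Ms[symmetric] matrix_lattice_mult unfolding matrix_lattice_def[of M] using d(3) by (rule image_mono)
    qed
    finally show ?thesis .
  qed
  have "det (matrix_inv M) \<noteq> 0" using G(1) by (simp add: det_matrix_inv)
  hence Q': "act_forms (matrix_inv M) Q \<in> linear_forms" by (rule act_forms_linear_forms[OF Q])
  have "sgn (det M) * Psi l (\<lambda>i. matrix_inv M ** A i) (act_poly (transpose M) P)
      (act_forms (matrix_inv M) Q) (matrix_inv M *v w)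
    = (- 1) ^ CARD('n) * (sgn (det M) * sgn (det ?s)) / of_nat CARD('m) *
      (\<Sum>i\<in>UNIV. \<Sum>b\<in>B. level_functional l p \<sigma> (u i) k P (w + b))"
    unfolding Psi_eq[OF l0 d(3,4) Q' refl] u' smooth by simp
  also have "\<dots> = (\<Sum>b\<in>B. level_value k P (w + b))"
    unfolding sg level_value_def sum_distrib_left[symmetric] by (subst sum.swap) (rule refl)
  finally show ?thesis .
qed

end

section \<open>Congruences between the moments\<close>

locale submultiplicative_norm =
  fixes N :: "'a::comm_ring_1 \<Rightarrow> real"
  assumes norm_nonneg: "N x \<ge> 0" and norm_zero: "N 0 = 0"
    and norm_triangle: "N (x + y) \<le> N x + N y" and norm_submult: "N (x * y) \<le> N x * N y"
    and norm_minus: "N (- x) = N x"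
begin

text \<open>Bounded families which agree up to \<open>O(e)\<close>.\<close>

definition approx :: "'i set \<Rightarrow> ('i \<Rightarrow> real) \<Rightarrow> ('i \<Rightarrow> 'a) \<Rightarrow> ('i \<Rightarrow> 'a) \<Rightarrow> bool" where
  "approx S e f g \<longleftrightarrow> (\<exists>C. \<forall>x\<in>S. N (f x) \<le> C \<and> N (g x) \<le> C \<and> N (f x - g x) \<le> C * e x)"

lemma approxI:
  assumes "\<And>x. x \<in> S \<Longrightarrow> N (f x) \<le> C" "\<And>x. x \<in> S \<Longrightarrow> N (g x) \<le> C'"
    "\<And>x. x \<in> S \<Longrightarrow> N (f x - g x) \<le> C'' * e x" "\<And>x. x \<in> S \<Longrightarrow> e x \<ge> 0"
  shows "approx S e f g"
  unfolding approx_def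
proof (intro exI[of _ "max C (max C' C'')"] ballI conjI)
  fix x assume x: "x \<in> S"
  show "N (f x - g x) \<le> max C (max C' C'') * e x"
    using assms(3,4)[OF x] by (meson max.cobounded2 mult_right_mono order_trans)
qed (use assms in \<open>auto simp: le_max_iff_disj\<close>)

lemma approxE:
  assumes "approx S e f g"
  obtains C where "C \<ge> 0" "\<And>x. x \<in> S \<Longrightarrow> N (f x) \<le> C" "\<And>x. x \<in> S \<Longrightarrow> N (g x) \<le> C"
    "\<And>x. x \<in> S \<Longrightarrow> N (f x - g x) \<le> C * e x"
proof (cases "S = {}")
  case False
  then obtain x where x: "x \<in> S" by blast
  obtain C where C: "\<forall>x\<in>S. N (f x) \<le> C \<and> N (g x) \<le> C \<and> N (f x - g x) \<le> C * e x"
    using assms unfolding approx_def by blast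
  hence "C \<ge> 0" using x norm_nonneg[of "f x"] by force
  thus ?thesis using C that by blast
qed (use that[of 0] in auto)

lemma approx_const: "(\<And>x. x \<in> S \<Longrightarrow> e x \<ge> 0) \<Longrightarrow> approx S e (\<lambda>_. c) (\<lambda>_. c)"
  by (rule approxI[of S _ "N c" _ "N c" 0]) (auto simp: norm_zero)

lemma approx_refl:
  assumes "\<And>x. x \<in> S \<Longrightarrow> e x \<ge> 0" "\<And>x. x \<in> S \<Longrightarrow> N (f x) \<le> C"
  shows "approx S e f f"
  by (rule approxI[of S _ C _ C 0]) (use assms in \<open>auto simp: norm_zero\<close>)

lemma approx_sym: "approx S e f g \<Longrightarrow> approx S e g f"
  unfolding approx_def using norm_minus[of "f x - g x" for x] by (metis minus_diff_eq norm_minus)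

lemma approx_add:
  assumes "approx S e f g" "approx S e f' g'"
  shows "approx S e (\<lambda>x. f x + f' x) (\<lambda>x. g x + g' x)"
proof -
  obtain C where C: "C \<ge> 0" "\<And>x. x \<in> S \<Longrightarrow> N (f x) \<le> C" "\<And>x. x \<in> S \<Longrightarrow> N (g x) \<le> C" "\<And>x. x \<in> S \<Longrightarrow> N (f x - g x) \<le> C * e x"
    using approxE[OF assms(1)] by blast
  obtain D where D: "D \<ge> 0" "\<And>x. x \<in> S \<Longrightarrow> N (f' x) \<le> D" "\<And>x. x \<in> S \<Longrightarrow> N (g' x) \<le> D" "\<And>x. x \<in> S \<Longrightarrow> N (f' x - g' x) \<le> D * e x"
    using approxE[OF assms(2)] by blast
  show ?thesis unfolding approx_def
  proof (intro exI[of _ "C + D"] ballI conjI)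
    fix x assume x: "x \<in> S"
    show "N (f x + f' x) \<le> C + D" "N (g x + g' x) \<le> C + D"
      using norm_triangle[of "f x" "f' x"] norm_triangle[of "g x" "g' x"] C(2,3)[OF x] D(2,3)[OF x] by linarith+
    have "N ((f x - g x) + (f' x - g' x)) \<le> C * e x + D * e x"
      using norm_triangle[of "f x - g x" "f' x - g' x"] C(4)[OF x] D(4)[OF x] by linarith
    thus "N (f x + f' x - (g x + g' x)) \<le> (C + D) * e x" by (simp add: algebra_simps)
  qed
qed

text \<open>The product rule ff' - gg' = (f - g)f' + g(f' - g') is the reason why boundedness is
  part of \<open>approx\<close>.\<close>

lemma approx_mult:
  assumes "approx S e f g" "approx S e f' g'"
  shows "approx S e (\<lambda>x. f x * f' x) (\<lambda>x. g x * g' x)"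
proof -
  obtain C where C: "C \<ge> 0" "\<And>x. x \<in> S \<Longrightarrow> N (f x) \<le> C" "\<And>x. x \<in> S \<Longrightarrow> N (g x) \<le> C" "\<And>x. x \<in> S \<Longrightarrow> N (f x - g x) \<le> C * e x"
    using approxE[OF assms(1)] by blast
  obtain D where D: "D \<ge> 0" "\<And>x. x \<in> S \<Longrightarrow> N (f' x) \<le> D" "\<And>x. x \<in> S \<Longrightarrow> N (g' x) \<le> D" "\<And>x. x \<in> S \<Longrightarrow> N (f' x - g' x) \<le> D * e x"
    using approxE[OF assms(2)] by blast
  show ?thesis unfolding approx_def
  \<comment> \<open>CD bounds the products and 2CD their difference relative to e; the sum is one
    constant for both.\<close>
  proof (intro exI[of _ "2 * C * D + C * D"] ballI conjI)
    fix x assume x: "x \<in> S"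
    have CD: "C * D \<ge> 0" using C(1) D(1) by simp
    have "N (f x) * N (f' x) \<le> C * D" "N (g x) * N (g' x) \<le> C * D"
      using C D x norm_nonneg by (auto intro!: mult_mono)
    thus "N (f x * f' x) \<le> 2 * C * D + C * D" "N (g x * g' x) \<le> 2 * C * D + C * D"
      using norm_submult[of "f x" "f' x"] norm_submult[of "g x" "g' x"] CD by linarith+
    have "N (f x - g x) * N (f' x) \<le> (C * e x) * D" "N (g x) * N (f' x - g' x) \<le> C * (D * e x)"
      using C D x norm_nonneg order_trans[OF norm_nonneg C(4)[OF x]] by (auto intro!: mult_mono)
    moreover have "N ((f x - g x) * f' x + g x * (f' x - g' x)) \<le> N (f x - g x) * N (f' x) + N (g x) * N (f' x - g' x)"
      using norm_triangle[of "(f x - g x) * f' x" "g x * (f' x - g' x)"]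
        norm_submult[of "f x - g x" "f' x"] norm_submult[of "g x" "f' x - g' x"] by linarith
    ultimately have "N ((f x - g x) * f' x + g x * (f' x - g' x)) \<le> 2 * C * D * e x"
      by (simp add: mult_ac)
    moreover have "C * D * e x \<ge> 0" using order_trans[OF norm_nonneg C(4)[OF x]] D(1)
      by (metis mult.assoc mult.commute mult_nonneg_nonneg)
    ultimately show "N (f x * f' x - g x * g' x) \<le> (2 * C * D + C * D) * e x"
      by (simp add: algebra_simps)
  qed
qed

lemma approx_sum:
  assumes "\<And>x. x \<in> S \<Longrightarrow> e x \<ge> 0" "\<And>a. a \<in> A \<Longrightarrow> approx S e (f a) (g a)"
  shows "approx S e (\<lambda>x. \<Sum>a\<in>A. f a x) (\<lambda>x. \<Sum>a\<in>A. g a x)"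
  using assms(2)
proof (induction A rule: infinite_finite_induct)
  case (insert a F)
  thus ?case using approx_add[of S e "f a" "g a"] by simp
qed (simp_all add: approx_const assms)

lemma approx_prod:
  assumes "\<And>x. x \<in> S \<Longrightarrow> e x \<ge> 0" "\<And>a. a \<in> A \<Longrightarrow> approx S e (f a) (g a)"
  shows "approx S e (\<lambda>x. \<Prod>a\<in>A. f a x) (\<lambda>x. \<Prod>a\<in>A. g a x)"
  using assms(2)
proof (induction A rule: infinite_finite_induct)
  case (insert a F)
  thus ?case using approx_mult[of S e "f a" "g a"] by simp
qed (simp_all add: approx_const assms)

lemma approx_power:
  assumes "\<And>x. x \<in> S \<Longrightarrow> e x \<ge> 0" "approx S e f g"
  shows "approx S e (\<lambda>x. f x ^ n) (\<lambda>x. g x ^ n)"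
  using approx_prod[of S e "{..<n}" "\<lambda>_. f" "\<lambda>_. g"] assms by simp

lemma approx_trans:
  assumes "approx S e f g" "approx S e g h"
  shows "approx S e f h"
proof -
  obtain C where C: "C \<ge> 0" "\<And>x. x \<in> S \<Longrightarrow> N (f x) \<le> C" "\<And>x. x \<in> S \<Longrightarrow> N (g x) \<le> C" "\<And>x. x \<in> S \<Longrightarrow> N (f x - g x) \<le> C * e x"
    using approxE[OF assms(1)] by blast
  obtain D where D: "D \<ge> 0" "\<And>x. x \<in> S \<Longrightarrow> N (g x) \<le> D" "\<And>x. x \<in> S \<Longrightarrow> N (h x) \<le> D" "\<And>x. x \<in> S \<Longrightarrow> N (g x - h x) \<le> D * e x"
    using approxE[OF assms(2)] by blast
  show ?thesis unfolding approx_def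
  proof (intro exI[of _ "C + D"] ballI conjI)
    fix x assume x: "x \<in> S"
    show "N (f x) \<le> C + D" "N (h x) \<le> C + D" using C(1) D(1) C(2)[OF x] D(3)[OF x] by linarith+
    have "N ((f x - g x) + (g x - h x)) \<le> C * e x + D * e x"
      using norm_triangle[of "f x - g x" "g x - h x"] C(4)[OF x] D(4)[OF x] by linarith
    thus "N (f x - h x) \<le> (C + D) * e x" by (simp add: algebra_simps)
  qed
qed

end

lemma submultiplicative_norm_padic_abs: "prime p \<Longrightarrow> submultiplicative_norm (padic_abs p)"
  by unfold_locales (auto simp: padic_abs_triangle padic_abs_mult)

lemma submultiplicative_norm_padic_norm: "submultiplicative_norm (padic_norm :: 'p::prime_card padic \<Rightarrow> real)"
  by unfold_locales (auto simp: padic_norm_triangle padic_norm_mult)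

lemma padic_abs_of_int_le_1:
  assumes "prime p" shows "padic_abs p (of_int z) \<le> 1"
proof (cases "z = 0")
  case False
  have "padic_abs p (of_int z / of_int 1) = real p powi (int (multiplicity (int p) 1) - int (multiplicity (int p) z))"
    by (rule padic_abs_frac[OF assms False]) simp
  also have "\<dots> \<le> 1"
  proof -
    have "real p powi (- int (multiplicity (int p) z)) \<le> real p powi 0"
      by (rule power_int_increasing) (use prime_ge_1_nat[OF assms] in auto)
    thus ?thesis by simp
  qed
  finally show ?thesis by simp
qed simp

lemma padic_abs_Ints_le_1: "prime p \<Longrightarrow> x \<in> \<int> \<Longrightarrow> padic_abs p x \<le> 1"
  using padic_abs_of_int_le_1 by (auto elim!: Ints_cases)


lemma padic_abs_power: "prime p \<Longrightarrow> padic_abs p (x ^ n) = padic_abs p x ^ n"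
  by (induction n) (simp_all add: padic_abs_mult)

lemma padic_abs_prime:
  assumes "prime p" shows "padic_abs p (of_nat p) = 1 / real p"
proof -
  have "padic_abs p (of_int (int p) / of_int 1) = real p powi (int (multiplicity (int p) 1) - int (multiplicity (int p) (int p)))"
    by (rule padic_abs_frac[OF assms]) (use prime_gt_0_nat[OF assms] in auto)
  also have "multiplicity (int p) (int p) = 1"
    by (rule multiplicity_self) (use prime_gt_1_nat[OF assms] in auto)
  finally show ?thesis by (simp add: power_int_minus inverse_eq_divide)
qed

lemma padic_abs_prime_power:
  assumes "prime p" shows "padic_abs p (of_nat p ^ k) = 1 / real p ^ k"
  by (simp add: padic_abs_power assms padic_abs_prime power_one_over)

text \<open>
  Replacing \<open>b(z)\<close> by \<open>b(z + \<delta>) - b(z)\<close> kills the constant term; of what remains, scaled by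
  \<open>p\<^sup>k\<^sup>r\<close> with \<open>z\<close> of denominator \<open>p\<^sup>k\<close>, only the part linear in \<open>\<delta>\<close> of the leading term survives.
\<close>

lemma bernoulli_difference_approx:
  fixes z \<delta> \<omega> :: "'i \<Rightarrow> rat" and k :: "'i \<Rightarrow> nat"
  assumes p: "prime p" and \<delta>: "\<And>x. x \<in> S \<Longrightarrow> padic_abs p (\<delta> x) \<le> D"
    and \<omega>: "submultiplicative_norm.approx (padic_abs p) S (\<lambda>x. 1 / real p ^ k x) (\<lambda>x. of_nat p ^ k x * z x) \<omega>"
  shows "submultiplicative_norm.approx (padic_abs p) S (\<lambda>x. 1 / real p ^ k x)
    (\<lambda>x. (of_nat p ^ k x) ^ r * (bernoulli_poly (Suc r) (z x + \<delta> x) - bernoulli_poly (Suc r) (z x)) / of_nat (Suc r))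
    (\<lambda>x. \<delta> x * \<omega> x ^ r)"
proof -
  interpret submultiplicative_norm "padic_abs p" by (rule submultiplicative_norm_padic_abs[OF p])
  let ?e = "\<lambda>x. 1 / real p ^ k x" and ?q = "\<lambda>x. of_nat p ^ k x :: rat"
  have e0: "?e x \<ge> 0" for x by simp
  have \<delta>': "approx S ?e \<delta> \<delta>" using \<delta> by (rule approx_refl[OF e0])
  have q0: "approx S ?e ?q (\<lambda>_. 0)"
    by (rule approxI[of _ _ 1 _ 0 1])
      (auto simp: padic_abs_prime_power[OF p] prime_ge_1_nat[OF p] divide_le_eq)
  \<comment> \<open>p^(kr) z^i = p^(k(r-i)) (p^k z)^i: the second factor is bounded, and the first
    is divisible by p^k unless i = r.\<close>
  have mon: "approx S ?e (\<lambda>x. ?q x ^ r * z x ^ i) (\<lambda>x. if i = r then \<omega> x ^ r else 0)" if i: "i \<le> r" for i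
  proof -
    have "approx S ?e (\<lambda>x. ?q x ^ (r - i) * (?q x * z x) ^ i) (\<lambda>x. 0 ^ (r - i) * \<omega> x ^ i)"
      by (intro approx_mult approx_power q0 \<omega> e0)
    moreover have "?q x ^ (r - i) * (?q x * z x) ^ i = ?q x ^ r * z x ^ i" for x
      using i by (simp add: power_mult_distrib mult.assoc[symmetric] power_add[symmetric])
    moreover have "(0::rat) ^ (r - i) * \<omega> x ^ i = (if i = r then \<omega> x ^ r else 0)" for x
      using i by auto
    ultimately show ?thesis by simp
  qed
  let ?b = "\<lambda>i. of_nat (Suc r choose i) * bernoulli_poly (Suc r - i) (0::rat)"
  have pw: "(y + d) ^ Suc i - y ^ Suc i = (\<Sum>j\<le>i. of_nat (Suc i choose j) * y ^ j * d ^ (Suc i - j))" for y d :: rat and i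
    unfolding binomial_ring[of y d "Suc i"] sum.atMost_Suc by simp
  \<comment> \<open>In (z + \<delta>)^(i+1) - z^(i+1) the power z^(i+1), unbounded for i = r, has
    cancelled; of the rest only j = i = r survives, with binomial coefficient r + 1.\<close>
  have mono_diff: "approx S ?e (\<lambda>x. ?q x ^ r * ((z x + \<delta> x) ^ Suc i - z x ^ Suc i))
      (\<lambda>x. if i = r then of_nat (Suc r) * (\<delta> x * \<omega> x ^ r) else 0)" if i: "i \<le> r" for i
  proof -
    have "approx S ?e (\<lambda>x. \<Sum>j\<le>i. of_nat (Suc i choose j) * (?q x ^ r * z x ^ j) * \<delta> x ^ (Suc i - j))
        (\<lambda>x. \<Sum>j\<le>i. of_nat (Suc i choose j) * (if j = r then \<omega> x ^ r else 0) * \<delta> x ^ (Suc i - j))"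
      by (intro approx_sum approx_mult approx_power approx_const mon e0 \<delta>') (use i in auto)
    moreover have "(\<Sum>j\<le>i. of_nat (Suc i choose j) * (if j = r then \<omega> x ^ r else 0) * \<delta> x ^ (Suc i - j))
        = (if i = r then of_nat (Suc r) * (\<delta> x * \<omega> x ^ r) else 0)" for x
    proof (cases "i = r")
      case True
      have "(\<Sum>j\<le>i. of_nat (Suc i choose j) * (if j = r then \<omega> x ^ r else 0) * \<delta> x ^ (Suc i - j))
          = (\<Sum>j\<le>r. if j = r then of_nat (Suc r) * (\<omega> x ^ r * \<delta> x) else 0)"
        by (intro sum.cong) (auto simp: True)
      thus ?thesis using True by (simp add: mult_ac)
    qed (use i in \<open>auto intro!: sum.neutral\<close>)
    ultimately show ?thesis unfolding pw by (simp add: sum_distrib_left mult_ac)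
  qed
  have bern: "bernoulli_poly (Suc r) (y + d) - bernoulli_poly (Suc r) y
      = (\<Sum>i\<le>r. ?b (Suc i) * ((y + d) ^ Suc i - y ^ Suc i))" for y d :: rat
    unfolding bernoulli_poly_eq_sum[of "Suc r" "y + d"] bernoulli_poly_eq_sum[of "Suc r" y]
    by (simp only: sum.atMost_Suc_shift right_diff_distrib sum_subtractf) simp
  have "approx S ?e (\<lambda>x. 1 / of_nat (Suc r) * (\<Sum>i\<le>r. ?b (Suc i) * (?q x ^ r * ((z x + \<delta> x) ^ Suc i - z x ^ Suc i))))
      (\<lambda>x. 1 / of_nat (Suc r) * (\<Sum>i\<le>r. ?b (Suc i) * (if i = r then of_nat (Suc r) * (\<delta> x * \<omega> x ^ r) else 0)))"
    by (intro approx_sum approx_mult approx_const mono_diff e0) auto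
  moreover have "1 / of_nat (Suc r) * (\<Sum>i\<le>r. ?b (Suc i) * (if i = r then of_nat (Suc r) * (\<delta> x * \<omega> x ^ r) else 0))
      = \<delta> x * \<omega> x ^ r" for x
  proof -
    have "(\<Sum>i\<le>r. ?b (Suc i) * (if i = r then of_nat (Suc r) * (\<delta> x * \<omega> x ^ r) else 0))
        = (\<Sum>i\<le>r. if i = r then of_nat (Suc r) * (\<delta> x * \<omega> x ^ r) else 0)"
      by (intro sum.cong) (auto simp: bernoulli_poly_0)
    thus ?thesis by simp
  qed
  moreover have "1 / of_nat (Suc r) * (\<Sum>i\<le>r. ?b (Suc i) * (?q x ^ r * ((z x + \<delta> x) ^ Suc i - z x ^ Suc i)))
      = ?q x ^ r * (bernoulli_poly (Suc r) (z x + \<delta> x) - bernoulli_poly (Suc r) (z x)) / of_nat (Suc r)" for x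
    unfolding bern sum_distrib_left sum_divide_distrib by (intro sum.cong refl) (simp add: mult_ac del: power_Suc)
  ultimately show ?thesis by simp
qed

text \<open>Fubini along the coordinate j: \<open>H\<close> is constant on each slice, so the slice
  contributes a multiple of the sum of \<open>f\<close> over it.\<close>

lemma sum_int_box_slices:
  fixes f :: "int^'n \<Rightarrow> 'b::comm_semiring_0"
  assumes H: "\<And>t s. H (\<chi> i. if i = j then s else t $ i) = H t"
    and c: "\<And>t. (\<Sum>s\<in>{0..<int (d j)}. f (\<chi> i. if i = j then s else t $ i)) = 0"
  shows "(\<Sum>t\<in>int_box d. f t * H t) = 0"
proof -
  define \<pi> where "\<pi> t = (\<chi> i. if i = j then 0 else t $ i)" for t :: "int^'n"
  define up where "up t s = (\<chi> i. if i = j then s else t $ i)" for t :: "int^'n" and s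
  have "(\<Sum>t\<in>int_box d. f t * H t) = (\<Sum>r\<in>\<pi> ` int_box d. \<Sum>t\<in>{t \<in> int_box d. \<pi> t = r}. f t * H t)"
    by (rule sum.image_gen) simp
  also have "\<dots> = 0"
  proof (rule sum.neutral, rule ballI)
    fix r assume "r \<in> \<pi> ` int_box d"
    then obtain t where t: "t \<in> int_box d" "r = \<pi> t" by blast
    have set: "{t' \<in> int_box d. \<pi> t' = r} = up r ` {0..<int (d j)}"
    proof (intro equalityI subsetI)
      fix t' assume t': "t' \<in> {t' \<in> int_box d. \<pi> t' = r}"
      hence "r = \<pi> t'" by simp
      hence "t' = up r (t' $ j)" by (simp add: up_def \<pi>_def vec_eq_iff)
      moreover have "t' $ j \<in> {0..<int (d j)}" using t' by (simp add: int_box_def)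
      ultimately show "t' \<in> up r ` {0..<int (d j)}" by blast
    qed (use t in \<open>auto simp: up_def \<pi>_def int_box_def vec_eq_iff\<close>)
    have "inj_on (up r) {0..<int (d j)}"
    proof (rule inj_onI)
      fix s s' assume "up r s = up r s'"
      hence "up r s $ j = up r s' $ j" by simp
      thus "s = s'" by (simp add: up_def)
    qed
    hence "(\<Sum>t\<in>{t \<in> int_box d. \<pi> t = r}. f t * H t) = (\<Sum>s\<in>{0..<int (d j)}. f (up r s)) * H r"
      unfolding set by (subst sum.reindex) (simp_all add: sum_distrib_right up_def H)
    thus "(\<Sum>t\<in>{t \<in> int_box d. \<pi> t = r}. f t * H t) = 0"
      using c[of r] by (simp add: up_def)
  qed
  finally show ?thesis .
qed

text \<open>The coordinates are treated one at a time, \<open>J\<close> being those already shifted.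
  Subtracting a_k from factor k changes the sum by a term whose remaining product does not involve
  t_k, and \<open>c\<close> sums to zero in that direction.\<close>

lemma sum_int_box_shift_factors:
  fixes c :: "int^'n::finite \<Rightarrow> 'b::comm_ring_1"
  assumes c: "\<And>j t. (\<Sum>s\<in>{0..<int (d j)}. c (\<chi> i. if i = j then s else t $ i)) = 0"
  shows "(\<Sum>t\<in>int_box d. c t * (\<Prod>j\<in>UNIV. g j (t $ j))) = (\<Sum>t\<in>int_box d. c t * (\<Prod>j\<in>UNIV. g j (t $ j) - a j))"
proof -
  have "(\<Sum>t\<in>int_box d. c t * (\<Prod>j\<in>UNIV. g j (t $ j)))
      = (\<Sum>t\<in>int_box d. c t * (\<Prod>j\<in>UNIV. g j (t $ j) - (if j \<in> J then a j else 0)))" if "finite J" for J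
    using that
  proof induction
    case (insert k J)
    let ?h = "\<lambda>J t j. g j (t $ j) - (if j \<in> J then a j else 0)"
    have split: "(\<Prod>j\<in>UNIV. ?h (insert k J) t j) = (\<Prod>j\<in>UNIV. ?h J t j) - a k * (\<Prod>j\<in>UNIV - {k}. ?h J t j)" for t
    proof -
      have "(\<Prod>j\<in>UNIV - {k}. ?h (insert k J) t j) = (\<Prod>j\<in>UNIV - {k}. ?h J t j)" by (intro prod.cong) auto
      hence "(\<Prod>j\<in>UNIV. ?h (insert k J) t j) = (g k (t $ k) - a k) * (\<Prod>j\<in>UNIV - {k}. ?h J t j)"
        by (subst prod.remove[of UNIV k]) auto
      moreover have "(\<Prod>j\<in>UNIV. ?h J t j) = g k (t $ k) * (\<Prod>j\<in>UNIV - {k}. ?h J t j)"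
        using insert.hyps by (subst prod.remove[of UNIV k]) auto
      ultimately show ?thesis by (simp add: left_diff_distrib)
    qed
    have "(\<Sum>t\<in>int_box d. c t * (a k * (\<Prod>j\<in>UNIV - {k}. ?h J t j))) = 0"
    proof (rule sum_int_box_slices[where j = k])
      fix t s
      show "a k * (\<Prod>j\<in>UNIV - {k}. ?h J (\<chi> i. if i = k then s else t $ i) j) = a k * (\<Prod>j\<in>UNIV - {k}. ?h J t j)"
        by (intro arg_cong[of _ _ "(*) (a k)"] prod.cong) auto
    qed (rule c)
    thus ?case unfolding split right_diff_distrib sum_subtractf using insert.IH by simp
  qed simp
  from this[of UNIV] show ?thesis by simp
qed

definition index_weight :: "nat \<Rightarrow> rat^'n \<Rightarrow> rat" where
  "index_weight l x = (if x \<in> int_lattice then 1 - of_nat l else 1)"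

text \<open>The extended lattice modulo \<sigma>L is represented by the points y + \<sigma>t/l with
  0 \<le> t_j < l, where y runs through the classes modulo (\<sigma>/l)L. Those of them that lie in
  Z^n represent Z^n modulo \<sigma>L, so the two lattice sums merge into a single weighted
  sum.\<close>

lemma smoothed_lattice_sum_eq:
  fixes \<sigma> :: "'n::{finite,linorder} qmat"
  assumes l: "l > 0" and \<sigma>: "det \<sigma> \<noteq> 0" "matrix_lattice \<sigma> \<subseteq> int_lattice"
    "matrix_lattice (\<sigma> ** mat (1 / of_nat l)) \<subseteq> ext_lattice l"
    and Y: "transversal Y (ext_lattice l) (matrix_lattice (\<sigma> ** mat (1 / of_nat l)))"
  shows "lattice_sum (ext_lattice l) \<sigma> u r v - of_nat l * lattice_sum int_lattice \<sigma> u r v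
    = (\<Sum>y\<in>Y. \<Sum>t\<in>int_box (\<lambda>_. l). index_weight l (y + (\<sigma> ** mat (1 / of_nat l)) *v rat_vec t) *
        (\<Prod>j\<in>UNIV. periodic_bernoulli (u j) (Suc (r j)) ((matrix_inv \<sigma> *v (y + v)) $ j + of_int (t $ j) / of_nat l)))"
proof -
  let ?s = "\<sigma> ** mat (1 / of_nat l)" and ?D = "diag_mat (\<lambda>_. of_nat l) :: 'n qmat"
  have sD: "?s ** ?D = \<sigma>"
    using l by (simp add: diag_mat_mult flip: diag_mat_const matrix_mul_assoc) (simp add: diag_mat_const)
  have dets: "det ?s \<noteq> 0" using \<sigma>(1) l by (simp add: det_mul det_mat_nonzero)
  let ?T = "(*v) ?s ` rat_vec ` int_box (\<lambda>_. l)"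
  have T: "transversal ?T (matrix_lattice ?s) (matrix_lattice \<sigma>)"
  proof -
    have "matrix_lattice \<sigma> = (*v) ?s ` matrix_lattice ?D" by (simp add: sD flip: matrix_lattice_mult)
    thus ?thesis unfolding matrix_lattice_def[of ?s]
      using transversal_image[OF transversal_int_box[of "\<lambda>_. l"] _ inj_matrix_vec[OF dets]] l
      by (simp add: matrix_vector_mult_diff_distrib)
  qed
  have DL: "matrix_lattice ?D \<subseteq> int_lattice" by (auto simp: matrix_lattice_def int_lattice_def)
  have sub: "matrix_lattice \<sigma> \<subseteq> matrix_lattice ?s"
  proof -
    have "matrix_lattice (?s ** ?D) \<subseteq> matrix_lattice ?s"
      unfolding matrix_lattice_mult[of ?s ?D] matrix_lattice_def[of ?s] using DL by (rule image_mono)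
    thus ?thesis by (simp only: sD)
  qed
  have sg: "add_subgroup (ext_lattice l :: 'n qvec set)" by (simp add: ext_lattice_eq l)
  let ?R = "(\<lambda>(s, t). s + t) ` (Y \<times> ?T)"
  note R = transversal_tower[OF sg add_subgroup_matrix_lattice add_subgroup_matrix_lattice sub \<sigma>(3) Y T]
  have "transversal {x \<in> ?R. x \<in> int_lattice} int_lattice (matrix_lattice \<sigma>)"
  proof (rule transversalI)
    show "finite {x \<in> ?R. x \<in> int_lattice}" using transversalD(1)[OF R(1)] by auto
    fix x :: "'n qvec" assume x: "x \<in> int_lattice"
    have "\<exists>s\<in>?R. x - s \<in> matrix_lattice \<sigma>"
      by (rule transversalD(3)[OF R(1) subsetD[OF int_lattice_subset_ext x]])
    then obtain s where s: "s \<in> ?R" "x - s \<in> matrix_lattice \<sigma>" by (elim bexE) (rule that)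
    have "x - (x - s) \<in> int_lattice"
      by (rule add_subgroupD(2)[OF add_subgroup_int_lattice x subsetD[OF \<sigma>(2) s(2)]])
    hence "s \<in> int_lattice" by simp
    hence "s \<in> {x \<in> ?R. x \<in> int_lattice}" using s(1) by (intro CollectI conjI)
    thus "\<exists>s\<in>{x \<in> ?R. x \<in> int_lattice}. x - s \<in> matrix_lattice \<sigma>" using s(2) by (rule bexI[rotated])
  next
    fix s t assume "s \<in> {x \<in> ?R. x \<in> int_lattice}" "t \<in> {x \<in> ?R. x \<in> int_lattice}" "s - t \<in> matrix_lattice \<sigma>"
    thus "s = t" using transversalD(4)[OF R(1)] add_subgroupD(1)[OF add_subgroup_matrix_lattice] by blast
  qed auto
  note int = lattice_sum_eq[OF \<sigma>(1) this]
  let ?F = "\<lambda>x. bernoulli_prod u r (matrix_inv \<sigma> *v (x + v))"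
  have F: "?F (y + ?s *v rat_vec t) = (\<Prod>j\<in>UNIV. periodic_bernoulli (u j) (Suc (r j)) ((matrix_inv \<sigma> *v (y + v)) $ j + of_int (t $ j) / of_nat l))" for y t
  proof -
    have "y + ?s *v rat_vec t + v = (y + v) + \<sigma> *v ((1 / of_nat l) *s rat_vec t)"
      by (simp add: mat_vector_mult add_ac flip: matrix_vector_mul_assoc)
    hence "matrix_inv \<sigma> *v (y + ?s *v rat_vec t + v) = matrix_inv \<sigma> *v (y + v) + (1 / of_nat l) *s rat_vec t"
      by (simp only: matrix_vector_right_distrib matrix_inv_vec[OF \<sigma>(1)])
    thus ?thesis by (simp add: bernoulli_prod_def rat_vec_def)
  qed
  have "lattice_sum (ext_lattice l) \<sigma> u r v - of_nat l * lattice_sum int_lattice \<sigma> u r v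
      = (\<Sum>x\<in>?R. ?F x) - of_nat l * (\<Sum>x\<in>?R. if x \<in> int_lattice then ?F x else 0)"
    unfolding lattice_sum_eq[OF \<sigma>(1) R(1)] int
    using transversalD(1)[OF R(1)] by (simp only: sum.inter_filter)
  also have "\<dots> = (\<Sum>x\<in>?R. index_weight l x * ?F x)"
    unfolding sum_distrib_left sum_subtractf[symmetric]
    by (intro sum.cong refl) (simp add: index_weight_def algebra_simps)
  also have "\<dots> = (\<Sum>y\<in>Y. \<Sum>t\<in>?T. index_weight l (y + t) * ?F (y + t))"
    by (subst sum.reindex[OF R(2)]) (simp add: sum.cartesian_product case_prod_beta o_def)
  also have "\<dots> = (\<Sum>y\<in>Y. \<Sum>t\<in>int_box (\<lambda>_. l). index_weight l (y + ?s *v rat_vec t) * ?F (y + ?s *v rat_vec t))"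
    by (intro sum.cong refl, subst image_image, subst sum.reindex)
      (auto simp: inj_on_def dest: injD[OF inj_matrix_vec[OF dets]])
  finally show ?thesis unfolding F .
qed

lemma ext_lattice_int_iff:
  assumes "x \<in> ext_lattice l" shows "x \<in> int_lattice \<longleftrightarrow> x $ first_index \<in> \<int>"
  using assms unfolding int_lattice_def ext_lattice_def mem_Collect_eq by metis

text \<open>
  The points \<open>y + s \<sigma>\<^sub>j / l\<close> with \<open>0 \<le> s < l\<close> run through the classes of \<open>\<pi>\<^sub>l\<^sup>-\<^sup>1 \<int>\<^sup>n\<close> modulo \<open>\<int>\<^sup>n\<close>
  because \<open>\<sigma>\<^sub>j\<close> is a unit multiple of the first unit vector modulo \<open>l\<close>. This is where the
  smoothing removes the denominators.
\<close>

lemma index_weight_sum_zero: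
  fixes \<sigma> :: "'n::{finite,linorder} qmat"
  assumes l: "prime l" and \<sigma>: "unit_column_matrix l \<sigma>" and y: "y \<in> ext_lattice l"
  shows "(\<Sum>s\<in>{0..<int l}. index_weight l (y + (\<sigma> ** mat (1 / of_nat l)) *v rat_vec (\<chi> i. if i = j then s else t $ i))) = 0"
proof -
  let ?s = "\<sigma> ** mat (1 / of_nat l)"
  have l0: "(of_nat l :: rat) \<noteq> 0" "l > 0" using prime_gt_0_nat[OF l] by auto
  have sg: "add_subgroup (ext_lattice l :: 'n qvec set)" by (simp add: ext_lattice_eq l0)
  have \<sigma>': "matrix_lattice \<sigma> \<subseteq> int_lattice" "matrix_lattice ?s \<subseteq> ext_lattice l"
    "\<sigma> $ first_index $ k / of_nat l \<notin> \<int>" for k using \<sigma> by (auto simp: unit_column_matrix_def)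
  have col: "column k \<sigma> \<in> int_lattice" for k
    using \<sigma>'(1) unfolding matrix_lattice_subset_iff_columns[OF add_subgroup_int_lattice] by (rule spec)
  define a where "a k = \<lfloor>\<sigma> $ first_index $ k\<rfloor>" for k
  have a: "\<sigma> $ first_index $ k = of_int (a k)" for k
    using col[of k] by (simp add: a_def int_lattice_def column_def)
  obtain m where m: "of_nat l * y $ first_index = of_int m" using y by (auto simp: ext_lattice_def elim: Ints_cases)
  have na: "\<not> int l dvd a j"
  proof
    assume "int l dvd a j"
    then obtain z where "a j = int l * z" by auto
    hence "\<sigma> $ first_index $ j / of_nat l = of_int z" using l0 a by simp
    thus False using \<sigma>'(3)[of j] by simp
  qed
  define b where "b = m + (\<Sum>k\<in>UNIV - {j}. a k * t $ k)"
  let ?t = "\<lambda>s. \<chi> i. if i = j then s else t $ i"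
  \<comment> \<open>Membership is decided by the first coordinate. Multiplied by l it is b + a_j s,
    where \<open>b\<close> collects the contributions of y and of the other entries of t.\<close>
  have mem: "y + ?s *v rat_vec (?t s) \<in> int_lattice \<longleftrightarrow> (b + a j * s) mod int l = 0" for s
  proof -
    let ?x = "y + ?s *v rat_vec (?t s)"
    have "?s *v rat_vec (?t s) \<in> ext_lattice l" using \<sigma>'(2) by (auto simp: matrix_lattice_def)
    hence ext: "?x \<in> ext_lattice l" by (intro add_subgroupD(4)[OF sg] y)
    have "of_nat l * (?s *v rat_vec (?t s)) $ first_index = (\<Sum>k\<in>UNIV. \<sigma> $ first_index $ k * of_int (?t s $ k))"
      using l0 by (simp add: matrix_vector_mult_def mult_mat_nth rat_vec_def sum_distrib_left)
    also have "\<dots> = of_int (\<Sum>k\<in>UNIV. a k * ?t s $ k)" by (simp add: a)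
    also have "(\<Sum>k\<in>UNIV. a k * ?t s $ k) = a j * s + (\<Sum>k\<in>UNIV - {j}. a k * t $ k)"
      by (subst sum.remove[of UNIV j]) (auto intro!: sum.cong)
    finally have x1: "of_nat l * ?x $ first_index = of_int (b + a j * s)"
      by (simp add: distrib_left m b_def)
    have "?x \<in> int_lattice \<longleftrightarrow> ?x $ first_index \<in> \<int>"
      by (rule ext_lattice_int_iff[OF ext])
    also have "\<dots> \<longleftrightarrow> int l dvd b + a j * s"
    proof
      assume "?x $ first_index \<in> \<int>"
      then obtain z where "?x $ first_index = of_int z" by (auto elim: Ints_cases)
      hence "of_int (int l * z) = (of_int (b + a j * s) :: rat)" using x1 by simp
      thus "int l dvd b + a j * s" by (metis dvd_triv_left of_int_eq_iff)
    next
      assume "int l dvd b + a j * s"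
      then obtain z where "b + a j * s = int l * z" by auto
      hence "of_nat l * ?x $ first_index = of_nat l * of_int z" using x1 by simp
      hence "?x $ first_index = of_int z" using l0 by simp
      thus "?x $ first_index \<in> \<int>" by simp
    qed
    finally show ?thesis by (simp add: dvd_eq_mod_eq_0)
  qed
  let ?f = "\<lambda>s. (b + a j * s) mod int l"
  \<comment> \<open>a_j is a unit modulo l, so s runs through all residues and exactly one of the l
    points gets the weight 1 - l.\<close>
  have bij: "bij_betw ?f {0..<int l} {0..<int l}"
  proof -
    have "inj_on ?f {0..<int l}"
    proof (rule inj_onI)
      fix s s' assume s: "s \<in> {0..<int l}" "s' \<in> {0..<int l}" "?f s = ?f s'"
      hence "int l dvd (b + a j * s) - (b + a j * s')" by (simp add: mod_eq_dvd_iff)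
      hence "int l dvd a j * (s - s')" by (simp add: algebra_simps)
      hence "int l dvd s - s'" using na l by (metis prime_dvd_mult_iff prime_nat_int_transfer)
      hence "s mod int l = s' mod int l" by (simp add: mod_eq_dvd_iff)
      thus "s = s'" using s by simp
    qed
    moreover have "?f ` {0..<int l} \<subseteq> {0..<int l}" using l0 by auto
    ultimately show ?thesis by (simp add: bij_betw_def endo_inj_surj)
  qed
  have "(\<Sum>s\<in>{0..<int l}. index_weight l (y + ?s *v rat_vec (?t s)))
      = (\<Sum>s\<in>{0..<int l}. 1 - (if ?f s = 0 then of_nat l else 0))"
    unfolding index_weight_def mem by (intro sum.cong) auto
  also have "\<dots> = (\<Sum>s\<in>{0..<int l}. 1 - (if s = 0 then of_nat l else 0))"
    by (rule sum.reindex_bij_betw[OF bij, of "\<lambda>s. 1 - (if s = 0 then of_nat l else 0)"])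
  also have "\<dots> = 0" using l0 by (simp add: sum_subtractf)
  finally show ?thesis .
qed

text \<open>The value for P and P(w) times the value for 1 are both compared with P(w) \<kappa>,
  where \<kappa> is the weighted sum of the products of the increments \<delta>, the same for all
  P.\<close>

lemma level_functional_approx:
  fixes \<sigma> :: "'n::{finite,linorder} qmat" and v :: "'n qvec"
  assumes p: "prime p" and l: "prime l" and \<sigma>: "unit_column_matrix l \<sigma>" "det \<sigma> \<noteq> 0"
  defines "S \<equiv> {(k, w). w - v \<in> int_lattice}"
  shows "submultiplicative_norm.approx (padic_abs p) S (\<lambda>(k, w). 1 / real p ^ k)
    (\<lambda>(k, w). level_functional l p \<sigma> u k P w)
    (\<lambda>(k, w). mpoly_eval (\<lambda>x. x) P (($) w) * level_functional l p \<sigma> u k 1 w)"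
proof -
  interpret submultiplicative_norm "padic_abs p" by (rule submultiplicative_norm_padic_abs[OF p])
  have l0: "l > 0" and p0: "p > 0" using prime_gt_0_nat l p by auto
  let ?s = "\<sigma> ** mat (1 / of_nat l)"
  have \<sigma>': "matrix_lattice \<sigma> \<subseteq> int_lattice" "matrix_lattice ?s \<subseteq> ext_lattice l"
    using \<sigma> by (auto simp: unit_column_matrix_def)
  have dets: "det ?s \<noteq> 0" using \<sigma>(2) l0 by (simp add: det_mul det_mat_nonzero)
  obtain Y where Y: "transversal Y (ext_lattice l) (matrix_lattice ?s)"
    using ex_transversal_matrix_lattice[OF dets, of "ext_scaling l"] by (auto simp: ext_lattice_eq l0)
  define c where "c y t = index_weight l (y + ?s *v rat_vec t)" for y and t :: "(int, 'n) vec"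
  \<comment> \<open>In the basis \<sigma>, \<zeta> are the coordinates of y + w/p^k,
    \<open>z\<close> their one-sided fractional parts, \<delta> the increments of these parts under
    t/l, and \<omega> the coordinates of w itself.\<close>
  define \<zeta> where "\<zeta> y x j = (matrix_inv \<sigma> *v (y + (1 / of_nat p ^ fst x) *s snd x)) $ j" for y :: "'n qvec" and x :: "nat \<times> 'n qvec" and j
  define z where "z y x j = side_frac (u j) (\<zeta> y x j)" for y x j
  define \<delta> where "\<delta> y t x j = side_frac (u j) (\<zeta> y x j + of_int (t $ j) / of_nat l) - z y x j" for y and t :: "(int, 'n) vec" and x j
  define \<omega> where "\<omega> x j = (matrix_inv \<sigma> *v snd x) $ j" for x :: "nat \<times> 'n qvec" and j
  let ?e = "\<lambda>x :: nat \<times> 'n qvec. 1 / real p ^ fst x"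
  have e0: "?e x \<ge> 0" for x by simp
  have e: "(\<lambda>(k, w). 1 / real p ^ k) = ?e" by (simp add: fun_eq_iff)
  let ?B = "\<lambda>r y t x. \<Prod>j\<in>UNIV. bernoulli_poly (Suc (r j)) (z y x j + \<delta> y t x j) - bernoulli_poly (Suc (r j)) (z y x j)"
  have sums: "lattice_sum (ext_lattice l) \<sigma> u r ((1 / of_nat p ^ fst x) *s snd x)
      - of_nat l * lattice_sum int_lattice \<sigma> u r ((1 / of_nat p ^ fst x) *s snd x)
    = (\<Sum>y\<in>Y. \<Sum>t\<in>int_box (\<lambda>_. l). c y t * ?B r y t x)" for r x
  proof -
    \<comment> \<open>The constants subtracted are the factors at t = 0, whose argument is
      \<open>z\<close>.\<close>
    have "(\<Sum>t\<in>int_box (\<lambda>_. l). c y t * (\<Prod>j\<in>UNIV. periodic_bernoulli (u j) (Suc (r j)) (\<zeta> y x j + of_int (t $ j) / of_nat l)))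
        = (\<Sum>t\<in>int_box (\<lambda>_. l). c y t * ?B r y t x)" if "y \<in> Y" for y
    proof -
      have y: "y \<in> ext_lattice l" using that transversalD(2)[OF Y] by blast
      show ?thesis
        using sum_int_box_shift_factors[where d = "\<lambda>_. l" and c = "c y"
            and g = "\<lambda>j t. periodic_bernoulli (u j) (Suc (r j)) (\<zeta> y x j + of_int t / of_nat l)"
            and a = "\<lambda>j. bernoulli_poly (Suc (r j)) (z y x j)"] index_weight_sum_zero[OF l \<sigma>(1) y]
        by (simp add: c_def periodic_bernoulli_def \<delta>_def)
    qed
    thus ?thesis
      unfolding smoothed_lattice_sum_eq[OF l0 \<sigma>(2) \<sigma>' Y] by (simp add: c_def \<zeta>_def)
  qed
  let ?lk = "Poly_Mapping.lookup"
  \<comment> \<open>The powers p^(kr) come from the substitution of p^k X in P, which rescales the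
    coefficients at r.\<close>
  have level: "level_functional l p \<sigma> u (fst x) P (snd x) = (\<Sum>r\<in>Poly_Mapping.keys (act_poly (transpose \<sigma>) P).
      ?lk (act_poly (transpose \<sigma>) P) r * (\<Sum>y\<in>Y. \<Sum>t\<in>int_box (\<lambda>_. l). c y t *
        (\<Prod>j\<in>UNIV. (of_nat p ^ fst x) ^ ?lk r j * (bernoulli_poly (Suc (?lk r j)) (z y x j + \<delta> y t x j)
          - bernoulli_poly (Suc (?lk r j)) (z y x j)) / of_nat (Suc (?lk r j)))))" for x P
  proof -
    let ?q = "of_nat p ^ fst x :: rat" and ?R = "act_poly (transpose \<sigma>) P"
    have q0: "?q \<noteq> 0" using p0 by simp
    have R: "act_poly (transpose \<sigma>) (act_poly (mat ?q) P) = act_poly (diag_mat (\<lambda>_. ?q)) ?R"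
      by (simp only: act_poly_mult[symmetric] diag_mat_const mat_mult_commute)
    have one: "(*v) (mat 1) ` X = X" for X :: "'n qvec set" by simp
    have "level_functional l p \<sigma> u (fst x) P (snd x)
        = (\<Sum>r\<in>Poly_Mapping.keys ?R. (\<Prod>j\<in>UNIV. ?q ^ ?lk r j) * ?lk ?R r / (\<Prod>j\<in>UNIV. of_nat (Suc (?lk r j))) *
          (lattice_sum (ext_lattice l) \<sigma> u (?lk r) ((1 / of_nat p ^ fst x) *s snd x)
            - of_nat l * lattice_sum int_lattice \<sigma> u (?lk r) ((1 / of_nat p ^ fst x) *s snd x)))"
      unfolding level_functional_eq_smoothed[OF l0 p0 \<sigma>(2)] smoothed_functional_def lattice_functional_def Let_def
        R keys_act_poly_diag[of "\<lambda>_. ?q", OF q0] lookup_act_poly_diag one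
      by (simp add: right_diff_distrib sum_subtractf sum_distrib_left mult_ac)
    also have "\<dots> = (\<Sum>r\<in>Poly_Mapping.keys ?R. ?lk ?R r * (\<Sum>y\<in>Y. \<Sum>t\<in>int_box (\<lambda>_. l). c y t *
        (((\<Prod>j\<in>UNIV. ?q ^ ?lk r j) * ?B (?lk r) y t x) / (\<Prod>j\<in>UNIV. of_nat (Suc (?lk r j))))))"
      unfolding sums by (intro sum.cong refl) (simp add: sum_distrib_left sum_divide_distrib mult_ac)
    finally show ?thesis by (simp only: prod.distrib[symmetric] prod_dividef[symmetric])
  qed
  have q_approx: "approx S ?e (\<lambda>x. of_nat p ^ fst x) (\<lambda>_. 0)"
    by (rule approxI[of _ _ 1 _ 0 1])
      (auto simp: padic_abs_prime_power[OF p] prime_ge_1_nat[OF p] divide_le_eq)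
  have w_approx: "approx S ?e (\<lambda>x. snd x $ i) (\<lambda>x. snd x $ i)" for i
  proof (rule approx_refl[OF e0])
    fix x assume "x \<in> S"
    hence "snd x $ i - v $ i \<in> \<int>" by (auto simp: S_def int_lattice_def)
    hence "padic_abs p (snd x $ i - v $ i) \<le> 1" by (rule padic_abs_Ints_le_1[OF p])
    thus "padic_abs p (snd x $ i) \<le> padic_abs p (v $ i) + 1"
      using padic_abs_triangle[OF p, of "v $ i" "snd x $ i - v $ i"] by simp
  qed
  have \<omega>_approx: "approx S ?e (\<lambda>x. \<omega> x j) (\<lambda>x. \<omega> x j)" for j
    unfolding \<omega>_def matrix_vector_mult_def by (simp, intro approx_sum approx_mult approx_const w_approx e0)
  \<comment> \<open>p^k z - \<omega> is p^k times the difference of a coordinate of y and an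
    integer, which is bounded.\<close>
  have z_approx: "approx S ?e (\<lambda>x. of_nat p ^ fst x * z y x j) (\<lambda>x. \<omega> x j)" for y j
  proof -
    let ?a = "(matrix_inv \<sigma> *v y) $ j"
    have "approx S ?e (\<lambda>x. ?a - (\<zeta> y x j - z y x j)) (\<lambda>x. ?a - (\<zeta> y x j - z y x j))"
    proof (rule approx_refl[OF e0])
      fix x :: "nat \<times> 'n qvec"
      have "padic_abs p (\<zeta> y x j - z y x j) \<le> 1" unfolding z_def by (intro padic_abs_Ints_le_1[OF p] side_frac_diff_Ints)
      thus "padic_abs p (?a - (\<zeta> y x j - z y x j)) \<le> padic_abs p ?a + 1"
        using padic_abs_triangle[OF p, of ?a "- (\<zeta> y x j - z y x j)"] by (simp only: padic_abs_minus add_uminus_conv_diff)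
    qed
    hence "approx S ?e (\<lambda>x. \<omega> x j + of_nat p ^ fst x * (?a - (\<zeta> y x j - z y x j))) (\<lambda>x. \<omega> x j + 0 * (?a - (\<zeta> y x j - z y x j)))"
      by (intro approx_add approx_mult \<omega>_approx q_approx)
    moreover have "\<omega> x j + of_nat p ^ fst x * (?a - (\<zeta> y x j - z y x j)) = of_nat p ^ fst x * z y x j" for x
    proof -
      have "\<zeta> y x j = ?a + 1 / of_nat p ^ fst x * \<omega> x j"
        by (simp add: \<zeta>_def \<omega>_def matrix_vector_right_distrib vector_scalar_commute)
      thus ?thesis using p0 by (simp add: field_simps)
    qed
    ultimately show ?thesis by simp
  qed
  \<comment> \<open>Fractional parts differ from their arguments by integers and the two arguments
    differ by t/l, so l \<delta> is an integer.\<close>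
  have \<delta>_bound: "padic_abs p (\<delta> y t x j) \<le> padic_abs p (1 / of_nat l)" for y t x j
  proof -
    define a where "a = \<zeta> y x j + of_int (t $ j) / of_nat l"
    have "of_nat l * \<delta> y t x j = of_int (t $ j) - of_nat l * (a - side_frac (u j) a) + of_nat l * (\<zeta> y x j - side_frac (u j) (\<zeta> y x j))"
      using l0 by (simp add: \<delta>_def z_def a_def[symmetric] algebra_simps) (simp add: a_def algebra_simps)
    also have "\<dots> \<in> \<int>"
      by (intro Ints_add Ints_diff Ints_mult[of "of_nat l" "_ - side_frac _ _"] side_frac_diff_Ints) auto
    finally have "padic_abs p (1 / of_nat l) * padic_abs p (of_nat l * \<delta> y t x j) \<le> padic_abs p (1 / of_nat l) * 1"
      by (intro mult_left_mono padic_abs_Ints_le_1[OF p]) auto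
    thus ?thesis using l0 by (simp flip: padic_abs_mult[OF p])
  qed
  define \<kappa> where "\<kappa> x = (\<Sum>y\<in>Y. \<Sum>t\<in>int_box (\<lambda>_. l). c y t * (\<Prod>j\<in>UNIV. \<delta> y t x j))" for x
  have main: "approx S ?e (\<lambda>x. level_functional l p \<sigma> u (fst x) P (snd x))
      (\<lambda>x. mpoly_eval (\<lambda>x. x) P (($) (snd x)) * \<kappa> x)" for P
  proof -
    let ?R = "act_poly (transpose \<sigma>) P"
    have id: "rat_ring_hom (\<lambda>x::rat. x)" by (simp add: rat_ring_hom_def)
    \<comment> \<open>The transformed polynomial at the coordinates \<omega> is P at
      \<sigma>\<omega> = w.\<close>
    have "mpoly_eval (\<lambda>x. x) ?R (\<omega> x) = mpoly_eval (\<lambda>x. x) P (($) (snd x))" for x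
    proof -
      have "(\<Sum>i\<in>UNIV. \<omega> x i * transpose \<sigma> $ i $ j) = (\<sigma> *v (matrix_inv \<sigma> *v snd x)) $ j" for j
        by (simp add: \<omega>_def matrix_vector_mult_def[of \<sigma>] transpose_def mult.commute)
      thus ?thesis unfolding mpoly_eval_act_poly[OF id] by (simp add: matrix_inv_vec \<sigma>(2))
    qed
    moreover have "(\<Sum>r\<in>Poly_Mapping.keys ?R. ?lk ?R r * (\<Sum>y\<in>Y. \<Sum>t\<in>int_box (\<lambda>_. l). c y t *
        (\<Prod>j\<in>UNIV. \<delta> y t x j * \<omega> x j ^ ?lk r j))) = mpoly_eval (\<lambda>x. x) ?R (\<omega> x) * \<kappa> x" for x
      unfolding mpoly_eval_def \<kappa>_def sum_distrib_right
      by (intro sum.cong refl) (simp add: prod.distrib sum_distrib_left mult_ac)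
    moreover have "approx S ?e (\<lambda>x. level_functional l p \<sigma> u (fst x) P (snd x))
      (\<lambda>x. \<Sum>r\<in>Poly_Mapping.keys ?R. ?lk ?R r * (\<Sum>y\<in>Y. \<Sum>t\<in>int_box (\<lambda>_. l). c y t *
        (\<Prod>j\<in>UNIV. \<delta> y t x j * \<omega> x j ^ ?lk r j)))"
      unfolding level
      by (intro approx_sum approx_mult approx_prod approx_const e0
          bernoulli_difference_approx[OF p, of S, OF \<delta>_bound z_approx])
    ultimately show ?thesis by simp
  qed
  have P_approx: "approx S ?e (\<lambda>x. mpoly_eval (\<lambda>x. x) P (($) (snd x))) (\<lambda>x. mpoly_eval (\<lambda>x. x) P (($) (snd x)))"
    unfolding mpoly_eval_def by (intro approx_sum approx_mult approx_prod approx_power approx_const w_approx e0)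
  have "approx S ?e (\<lambda>x. level_functional l p \<sigma> u (fst x) 1 (snd x)) \<kappa>"
    using main[of 1] by (simp add: mpoly_eval_1 rat_ring_hom_def)
  hence "approx S ?e (\<lambda>x. mpoly_eval (\<lambda>x. x) P (($) (snd x)) * \<kappa> x)
      (\<lambda>x. mpoly_eval (\<lambda>x. x) P (($) (snd x)) * level_functional l p \<sigma> u (fst x) 1 (snd x))"
    by (intro approx_mult P_approx) (rule approx_sym)
  from approx_trans[OF main this] show ?thesis unfolding e by (simp add: case_prod_beta')
qed

section \<open>Balls in p-adic space\<close>

lemma prime_card_gt_1: "1 < CARD('p::prime_card)"
  by (rule prime_gt_1_nat) (rule prime_card)

lemma padic_norm_0 [simp]: "padic_norm (0 :: 'p::prime_card padic) = 0"
  by simp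

lemma padic_norm_sum_le:
  fixes f :: "'a \<Rightarrow> 'p::prime_card padic"
  assumes "C \<ge> 0" "\<And>x. x \<in> A \<Longrightarrow> padic_norm (f x) \<le> C"
  shows "padic_norm (sum f A) \<le> C"
  using assms(2)
proof (induction A rule: infinite_finite_induct)
  case (insert x F)
  have "max (padic_norm (f x)) (padic_norm (sum f F)) \<le> C" using insert by simp
  thus ?case
    using order_trans[OF padic_norm_add_le_max[of "f x" "sum f F"]] insert.hyps by simp
qed (use assms(1) in auto)

lemma padic_norm_diff_le_max: "padic_norm (x - z) \<le> max (padic_norm (x - y)) (padic_norm (y - z :: 'p::prime_card padic))"
  using padic_norm_add_le_max[of "x - y" "y - z"] by simp

lemma padic_abs_of_int_le_dvd:
  assumes p: "prime p" and z: "padic_abs p (of_int z) \<le> 1 / real p ^ k"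
  shows "int p ^ k dvd z"
proof (cases "z = 0")
  case False
  have "padic_abs p (of_int z / of_int 1) = real p powi (int (multiplicity (int p) 1) - int (multiplicity (int p) z))"
    by (rule padic_abs_frac[OF p False]) simp
  hence "1 / real p ^ multiplicity (int p) z \<le> 1 / real p ^ k"
    using z by (simp add: power_int_minus inverse_eq_divide)
  hence "real p ^ k \<le> real p ^ multiplicity (int p) z"
    using prime_gt_0_nat[OF p] by (simp add: field_simps)
  hence "k \<le> multiplicity (int p) z" using prime_gt_1_nat[OF p] by simp
  thus ?thesis by (rule multiplicity_dvd')
qed simp

lemma padic_abs_dvd_le:
  assumes p: "prime p" and z: "int p ^ k dvd z"
  shows "padic_abs p (of_int z) \<le> 1 / real p ^ k"
proof -
  obtain q where q: "z = int p ^ k * q" using z by blast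
  have "padic_abs p (of_int z) = 1 / real p ^ k * padic_abs p (of_int q)"
    by (simp add: q padic_abs_mult p padic_abs_prime_power)
  also have "\<dots> \<le> 1 / real p ^ k * 1" by (intro mult_left_mono padic_abs_of_int_le_1[OF p]) auto
  finally show ?thesis by simp
qed

text \<open>A rational approximation a/b of norm at most 1 in lowest terms has b prime to p; if d is
  an inverse of b modulo p^k, the integer d a is as close.\<close>

lemma padic_integer_approx:
  fixes y :: "'p::prime_card padic"
  assumes y: "padic_norm y \<le> 1"
  shows "\<exists>z. padic_norm (y - of_int z) \<le> 1 / real CARD('p) ^ k"
proof -
  let ?p = "CARD('p)"
  have p: "prime ?p" by (rule prime_card)
  have p0: "real ?p > 0" "?p \<ge> 1" using prime_gt_0_nat[OF p] by auto
  obtain q where q: "padic_norm (y - of_rat q) < 1 / real ?p ^ k"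
    using padic_rat_dense[of "1 / real ?p ^ k" y] p0 by (auto simp: dist_padic_def)
  have k1: "1 / real ?p ^ k \<le> 1" using p0 by (simp add: divide_le_eq)
  have "padic_norm (of_rat q :: 'p padic) \<le> 1"
  proof -
    have "padic_norm (of_rat q - y) \<le> 1" using q k1 padic_norm_minus_commute[of "of_rat q" y] by linarith
    thus ?thesis using padic_norm_diff_le_max[of "of_rat q" 0 y] y by (simp add: max_def split: if_splits)
  qed
  hence q1: "padic_abs ?p q \<le> 1" by (simp only: padic_norm_of_rat)
  obtain a b where ab: "quotient_of q = (a, b)" by force
  have b: "b > 0" "q = of_int a / of_int b" "coprime a b"
    using ab quotient_of_denom_pos quotient_of_div quotient_of_coprime by auto
  have nb: "\<not> int ?p dvd b"
  proof
    assume pb: "int ?p dvd b"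
    have "\<not> is_unit (int ?p)" using p0 prime_gt_1_nat[OF p] by simp
    hence na: "\<not> int ?p dvd a" using pb b(3) coprime_common_divisor by blast
    have a0: "a \<noteq> 0" using na by auto
    have "padic_abs ?p q = real ?p powi (int (multiplicity (int ?p) b) - int (multiplicity (int ?p) a))"
      unfolding b(2) by (rule padic_abs_frac[OF p a0]) (use b in simp)
    also have "multiplicity (int ?p) a = 0" using na by (rule not_dvd_imp_multiplicity_0)
    finally have "real ?p ^ multiplicity (int ?p) b \<le> 1" using q1 by simp
    moreover have "multiplicity (int ?p) b > 0"
      using pb b(1) prime_gt_1_nat[OF p] by (simp add: multiplicity_gt_zero_iff)
    ultimately show False
      using prime_gt_1_nat[OF p] one_less_power[of "real ?p" "multiplicity (int ?p) b"] by linarith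
  qed
  hence "coprime (int ?p ^ k) b"
    using p prime_imp_coprime[of "int ?p" b] by (simp add: coprime_power_left_iff)
  then obtain c d where cd: "c * int ?p ^ k + d * b = 1"
    by (metis bezout_int coprime_imp_gcd_eq_1)
  have absb: "padic_abs ?p (of_int b) = 1"
  proof -
    have "padic_abs ?p (of_int b / of_int 1) = real ?p powi (int (multiplicity (int ?p) 1) - int (multiplicity (int ?p) b))"
      by (rule padic_abs_frac[OF p]) (use b in auto)
    thus ?thesis using nb by (simp add: not_dvd_imp_multiplicity_0)
  qed
  have "a - b * (d * a) = int ?p ^ k * (c * a)"
    using cd by (metis (no_types, opaque_lifting) add_diff_cancel_right' left_diff_distrib mult.assoc mult.commute mult_1)
  hence dvd: "int ?p ^ k dvd a - b * (d * a)" by simp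
  have "padic_abs ?p (q - of_int (d * a)) = padic_abs ?p (of_int b) * padic_abs ?p (q - of_int (d * a))"
    by (simp add: absb)
  also have "\<dots> = padic_abs ?p (of_int (a - b * (d * a)))"
    using b(1) by (simp add: b(2) algebra_simps flip: padic_abs_mult[OF p])
  also have "\<dots> \<le> 1 / real ?p ^ k" by (rule padic_abs_dvd_le[OF p dvd])
  finally have "padic_norm (of_rat (q - of_int (d * a)) :: 'p padic) \<le> 1 / real ?p ^ k"
    by (simp only: padic_norm_of_rat)
  hence "padic_norm (of_rat q - of_int (d * a) :: 'p padic) \<le> 1 / real ?p ^ k"
    by (simp only: of_rat_diff of_rat_of_int_eq)
  hence "padic_norm (y - of_int (d * a)) \<le> 1 / real ?p ^ k"
    using padic_norm_diff_le_max[of y "of_int (d * a)" "of_rat q"] q by (simp add: max_def split: if_splits)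
  thus ?thesis by blast
qed

section \<open>Balls around rational centres\<close>

definition padic_ball :: "nat \<Rightarrow> 'n::finite qvec \<Rightarrow> ('p::prime_card padic, 'n) vec set" where
  "padic_ball k w = padic_coset w (mat (of_nat CARD('p) ^ k))"

definition padic_of_rat_vec :: "'n::finite qvec \<Rightarrow> ('p::prime_card padic, 'n) vec" where
  "padic_of_rat_vec w = (\<chi> i. of_rat (w $ i))"

lemma map_matrix_of_rat_vec:
  "map_matrix of_rat M *v (padic_of_rat_vec w :: ('p::prime_card padic, 'n::finite) vec) = padic_of_rat_vec (M *v w)"
  by (simp add: padic_of_rat_vec_def vec_eq_iff matrix_vector_mult_def of_rat_sum of_rat_mult)

lemma mem_padic_ball:
  "x \<in> padic_ball k w \<longleftrightarrow> (\<forall>i. padic_norm (x $ i - of_rat (w $ i)) \<le> 1 / real CARD('p) ^ k)"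
  for x :: "('p::prime_card padic, 'n::finite) vec"
proof -
  let ?q = "of_nat CARD('p) ^ k :: 'p padic"
  have p: "prime CARD('p)" by (rule prime_card)
  have nq: "padic_norm ?q = 1 / real CARD('p) ^ k"
    using padic_norm_of_rat[of "of_nat CARD('p) ^ k", where 'p = 'p] by (simp add: of_rat_power padic_abs_prime_power[OF p])
  have q0: "?q \<noteq> 0" using prime_gt_0_nat[OF p] by simp
  have "map_matrix of_rat (mat (of_nat CARD('p) ^ k) :: 'n qmat) = (mat ?q :: ('p padic, 'n) vec^'n)"
    by (simp add: vec_eq_iff mat_def of_rat_power)
  hence eq: "padic_ball k w = (\<lambda>y. (\<chi> i. of_rat (w $ i)) + ?q *s y) ` (Zp_vec :: ('p padic, 'n) vec set)"
    by (simp add: padic_ball_def padic_coset_def mat_vector_mult)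
  show ?thesis
  proof
    assume "x \<in> padic_ball k w"
    then obtain y where "y \<in> Zp_vec" "x = (\<chi> i. of_rat (w $ i)) + ?q *s y" unfolding eq by blast
    thus "\<forall>i. padic_norm (x $ i - of_rat (w $ i)) \<le> 1 / real CARD('p) ^ k"
      by (simp add: padic_norm_mult nq Zp_vec_def divide_right_mono)
  next
    assume *: "\<forall>i. padic_norm (x $ i - of_rat (w $ i)) \<le> 1 / real CARD('p) ^ k"
    define y where "y = (\<chi> i. (x $ i - of_rat (w $ i)) / ?q)"
    have "padic_norm (y $ i) \<le> 1" for i
    proof -
      have "padic_norm ?q * padic_norm (y $ i) = padic_norm (x $ i - of_rat (w $ i))"
        using q0 by (simp add: y_def flip: padic_norm_mult)
      hence "1 / real CARD('p) ^ k * padic_norm (y $ i) \<le> 1 / real CARD('p) ^ k * 1" using * nq by simp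
      thus ?thesis using prime_gt_0_nat[OF p] by (simp add: divide_le_cancel)
    qed
    hence "y \<in> Zp_vec" by (simp add: Zp_vec_def)
    moreover have "x = (\<chi> i. of_rat (w $ i)) + ?q *s y" using q0 by (simp add: vec_eq_iff y_def)
    ultimately show "x \<in> padic_ball k w" unfolding eq by blast
  qed
qed

lemma padic_ball_eq:
  assumes "(x :: ('p::prime_card padic, 'n::finite) vec) \<in> padic_ball k w" "x \<in> padic_ball k' w'" "k \<le> k'"
  shows "padic_ball k' w' \<subseteq> (padic_ball k w :: ('p padic, 'n) vec set)"
proof
  fix y :: "('p padic, 'n) vec" assume y: "y \<in> padic_ball k' w'"
  have le: "1 / real CARD('p) ^ k' \<le> 1 / real CARD('p) ^ k"
    using assms(3) prime_card_gt_1[where 'p = 'p]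
    by (intro divide_left_mono power_increasing) auto
  show "y \<in> padic_ball k w" unfolding mem_padic_ball
  proof
    fix i
    have "padic_norm (y $ i - of_rat (w' $ i)) \<le> 1 / real CARD('p) ^ k'" "padic_norm (x $ i - of_rat (w' $ i)) \<le> 1 / real CARD('p) ^ k'"
      "padic_norm (x $ i - of_rat (w $ i)) \<le> 1 / real CARD('p) ^ k"
      using y assms by (auto simp: mem_padic_ball)
    thus "padic_norm (y $ i - of_rat (w $ i)) \<le> 1 / real CARD('p) ^ k"
      using padic_norm_diff_le_max[of "y $ i" "of_rat (w $ i)" "x $ i"]
        padic_norm_diff_le_max[of "y $ i" "x $ i" "of_rat (w' $ i)"] le
      by (simp add: padic_norm_minus_commute[of "of_rat (w' $ i)" "x $ i"] max_def split: if_splits)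
  qed
qed

lemma centre_in_padic_ball [simp]: "padic_of_rat_vec w \<in> padic_ball k w"
  by (simp add: mem_padic_ball padic_of_rat_vec_def)

lemma padic_ball_nonempty: "padic_ball k w \<noteq> ({} :: ('p::prime_card padic, 'n::finite) vec set)"
  using centre_in_padic_ball by blast

lemma padic_ball_disjoint:
  assumes "padic_ball k w \<inter> padic_ball k w' \<noteq> ({} :: ('p::prime_card padic, 'n::finite) vec set)"
  shows "padic_ball k w = (padic_ball k w' :: ('p padic, 'n) vec set)"
  using assms padic_ball_eq[of _ k w k w'] padic_ball_eq[of _ k w' k w] by blast

lemma padic_ball_add:
  fixes w :: "'n::finite qvec"
  assumes "b \<in> matrix_lattice (mat (of_nat CARD('p) ^ k))" "k' \<le> k"
  shows "padic_ball k' (w + b) = (padic_ball k' w :: ('p::prime_card padic, 'n) vec set)"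
proof -
  have p: "prime CARD('p)" by (rule prime_card)
  obtain z where b: "b = mat (of_nat CARD('p) ^ k) *v rat_vec z"
    using assms by (auto simp: matrix_lattice_def int_lattice_eq_range)
  have "padic_of_rat_vec (w + b) \<in> (padic_ball k' w :: ('p padic, 'n) vec set)" unfolding mem_padic_ball
  proof
    fix i
    have "padic_abs CARD('p) (of_int (int CARD('p) ^ k * z $ i)) \<le> 1 / real CARD('p) ^ k"
      by (rule padic_abs_dvd_le[OF p]) simp
    also have "\<dots> \<le> 1 / real CARD('p) ^ k'"
      using assms(2) prime_gt_1_nat[OF p] by (intro divide_left_mono power_increasing) auto
    finally have "padic_norm (of_rat (of_int (int CARD('p) ^ k * z $ i)) :: 'p padic) \<le> 1 / real CARD('p) ^ k'"
      by (simp only: padic_norm_of_rat)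
    thus "padic_norm ((padic_of_rat_vec (w + b) :: ('p padic, 'n) vec) $ i - of_rat (w $ i)) \<le> 1 / real CARD('p) ^ k'"
      by (simp add: padic_of_rat_vec_def b mat_vector_mult rat_vec_def of_rat_add)
  qed
  thus ?thesis using padic_ball_disjoint[of k' "w + b" w] centre_in_padic_ball[of "w + b" k'] by blast
qed

text \<open>Between integers, p-adic closeness is divisibility by p^k. The opposite direction is
  \<open>padic_ball_add\<close>.\<close>

lemma padic_ball_int_cong:
  fixes w :: "'n::finite qvec"
  assumes "padic_ball k (w + rat_vec a) = (padic_ball k (w + rat_vec b) :: ('p::prime_card padic, 'n) vec set)"
  shows "rat_vec a - rat_vec b \<in> matrix_lattice (mat (of_nat CARD('p) ^ k))"
proof -
  have p: "prime CARD('p)" by (rule prime_card)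
  have mem: "padic_of_rat_vec (w + rat_vec a) \<in> (padic_ball k (w + rat_vec b) :: ('p padic, 'n) vec set)"
    using assms centre_in_padic_ball by blast
  have "int CARD('p) ^ k dvd a $ i - b $ i" for i
  proof (rule padic_abs_of_int_le_dvd[OF p])
    have "padic_norm (of_rat (w $ i + of_int (a $ i)) - of_rat (w $ i + of_int (b $ i)) :: 'p padic) \<le> 1 / real CARD('p) ^ k"
      using mem by (simp add: mem_padic_ball padic_of_rat_vec_def rat_vec_def)
    hence "padic_norm (of_rat (of_int (a $ i - b $ i)) :: 'p padic) \<le> 1 / real CARD('p) ^ k"
      by (simp flip: of_rat_diff)
    thus "padic_abs CARD('p) (of_int (a $ i - b $ i)) \<le> 1 / real CARD('p) ^ k"
      by (simp only: padic_norm_of_rat)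
  qed
  then obtain c where "\<And>i. a $ i - b $ i = int CARD('p) ^ k * c i" unfolding dvd_def by metis
  hence "rat_vec a - rat_vec b = mat (of_nat CARD('p) ^ k) *v rat_vec (\<chi> i. c i)"
    by (simp add: vec_eq_iff rat_vec_def mat_vector_mult flip: of_int_diff)
  thus ?thesis by (simp add: matrix_lattice_def)
qed

lemma padic_ball_cover:
  fixes x :: "('p::prime_card padic, 'n::finite) vec"
  assumes "x \<in> padic_ball 0 w"
  shows "\<exists>a. x \<in> padic_ball k (w + rat_vec a)"
proof -
  have "\<exists>z. padic_norm (x $ i - of_rat (w $ i) - of_int z) \<le> 1 / real CARD('p) ^ k" for i
    by (rule padic_integer_approx) (use assms in \<open>simp add: mem_padic_ball\<close>)
  then obtain z where "\<And>i. padic_norm (x $ i - of_rat (w $ i) - of_int (z i)) \<le> 1 / real CARD('p) ^ k" by metis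
  hence "x \<in> padic_ball k (w + rat_vec (\<chi> i. z i))"
    by (simp add: mem_padic_ball rat_vec_def of_rat_add diff_diff_eq)
  thus ?thesis by blast
qed

lemma padic_ball_subset:
  assumes "k \<le> k'"
  shows "padic_ball k' w \<subseteq> (padic_ball k w :: ('p::prime_card padic, 'n::finite) vec set)"
  by (rule padic_ball_eq[OF _ _ assms, of "padic_of_rat_vec w"]) auto

text \<open>The distance on vectors is the Euclidean combination of the coordinate distances.
  Bounding it by their sum gives the factor \<open>CARD('n)\<close>.\<close>

lemma dist_padic_ball_le:
  fixes x y :: "('p::prime_card padic, 'n::finite) vec"
  assumes "x \<in> padic_ball k w" "y \<in> padic_ball k w"
  shows "dist x y \<le> real CARD('n) / real CARD('p) ^ k"
proof -
  have "dist (x $ i) (y $ i) \<le> 1 / real CARD('p) ^ k" for i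
    using assms padic_norm_diff_le_max[of "x $ i" "y $ i" "of_rat (w $ i)"]
    by (auto simp: mem_padic_ball dist_padic_def padic_norm_minus_commute[of "of_rat (w $ i)"] max_def
        split: if_splits dest!: spec[of _ i])
  hence "(\<Sum>i\<in>UNIV. dist (x $ i) (y $ i)) \<le> (\<Sum>i\<in>(UNIV :: 'n set). 1 / real CARD('p) ^ k)" by (intro sum_mono)
  moreover have "dist x y \<le> (\<Sum>i\<in>UNIV. dist (x $ i) (y $ i))"
    unfolding dist_vec_def by (rule L2_set_le_sum) auto
  ultimately show ?thesis by simp
qed

lemma eventually_small_radius:
  assumes "e > 0"
  shows "\<exists>K. \<forall>k\<ge>K. C / real CARD('p::prime_card) ^ k < e"
proof -
  have "(\<lambda>k. C * (1 / real CARD('p)) ^ k) \<longlonglongrightarrow> C * 0"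
    using prime_card_gt_1[where 'p = 'p]
    by (intro tendsto_intros LIMSEQ_power_zero) auto
  hence "\<forall>\<^sub>F k in sequentially. C * (1 / real CARD('p)) ^ k < e"
    using assms by (intro order_tendstoD) auto
  thus ?thesis by (simp add: eventually_sequentially power_one_over)
qed

lemma open_padic_ball: "open (padic_ball k w :: ('p::prime_card padic, 'n::finite) vec set)"
proof (rule openI)
  fix x :: "('p padic, 'n) vec" assume x: "x \<in> padic_ball k w"
  have p: "real CARD('p) > 0" using prime_card_gt_1[where 'p = 'p] by simp
  have "ball x (1 / real CARD('p) ^ k) \<subseteq> padic_ball k w"
  proof
    fix y assume "y \<in> ball x (1 / real CARD('p) ^ k)"
    hence "dist (x $ i) (y $ i) < 1 / real CARD('p) ^ k" for i
      using dist_vec_nth_le[of x i y] by simp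
    hence d: "padic_norm (y $ i - x $ i) \<le> 1 / real CARD('p) ^ k" for i
      by (metis dist_padic_def less_imp_le padic_norm_minus_commute)
    show "y \<in> padic_ball k w" unfolding mem_padic_ball
    proof
      fix i
      have "padic_norm (x $ i - of_rat (w $ i)) \<le> 1 / real CARD('p) ^ k" using x by (simp add: mem_padic_ball)
      thus "padic_norm (y $ i - of_rat (w $ i)) \<le> 1 / real CARD('p) ^ k"
        using padic_norm_diff_le_max[of "y $ i" "of_rat (w $ i)" "x $ i"] d[of i] by linarith
    qed
  qed
  thus "\<exists>e>0. ball x e \<subseteq> padic_ball k w"
    using p by (intro exI[of _ "1 / real CARD('p) ^ k"]) auto
qed

lemma closed_padic_ball: "closed (padic_ball k w :: ('p::prime_card padic, 'n::finite) vec set)"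
  unfolding closed_def
proof (rule openI)
  fix x :: "('p padic, 'n) vec" assume x: "x \<in> - padic_ball k w"
  have p: "real CARD('p) > 0" using prime_card_gt_1[where 'p = 'p] by simp
  define r where "r = 1 / real CARD('p) ^ k"
  have "ball x r \<subseteq> - padic_ball k w"
  proof
    fix y assume "y \<in> ball x r"
    hence d: "dist (x $ i) (y $ i) < r" for i using dist_vec_nth_le[of x i y] by simp
    obtain i where i: "\<not> padic_norm (x $ i - of_rat (w $ i)) \<le> r" using x by (auto simp: mem_padic_ball r_def)
    have "\<not> padic_norm (y $ i - of_rat (w $ i)) \<le> r"
      using i d[of i] padic_norm_diff_le_max[of "x $ i" "of_rat (w $ i)" "y $ i"]
      by (auto simp: dist_padic_def max_def split: if_splits)
    thus "y \<in> - padic_ball k w" by (auto simp: mem_padic_ball r_def)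
  qed
  thus "\<exists>e>0. ball x e \<subseteq> - padic_ball k w"
    using p by (intro exI[of _ r]) (auto simp: r_def)
qed

lemma padic_ball_zero_cover:
  "padic_ball 0 w = (\<Union>a\<in>int_box (\<lambda>_. CARD('p) ^ k). padic_ball k (w + rat_vec a) :: ('p::prime_card padic, 'n::finite) vec set)"
proof (intro equalityI subsetI)
  fix x :: "('p padic, 'n) vec" assume "x \<in> padic_ball 0 w"
  then obtain a where a: "x \<in> padic_ball k (w + rat_vec a)" using padic_ball_cover by blast
  have "transversal (rat_vec ` int_box (\<lambda>_. CARD('p) ^ k)) int_lattice
      (matrix_lattice (diag_mat (\<lambda>_. of_nat (CARD('p) ^ k)) :: 'n qmat))"
    by (rule transversal_int_box) (use prime_card_gt_1[where 'p = 'p] in simp)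
  then obtain b where b: "b \<in> int_box (\<lambda>_. CARD('p) ^ k)" "rat_vec a - rat_vec b \<in> matrix_lattice (mat (of_nat CARD('p) ^ k))"
    using transversalD(3)[of _ int_lattice _ "rat_vec a"] by (fastforce simp: diag_mat_const)
  have "padic_ball k (w + rat_vec a) = (padic_ball k (w + rat_vec b) :: ('p padic, 'n) vec set)"
    using padic_ball_add[OF b(2), of k "w + rat_vec b"] by simp
  thus "x \<in> (\<Union>a\<in>int_box (\<lambda>_. CARD('p) ^ k). padic_ball k (w + rat_vec a))" using a b by auto
next
  fix x :: "('p padic, 'n) vec" assume "x \<in> (\<Union>a\<in>int_box (\<lambda>_. CARD('p) ^ k). padic_ball k (w + rat_vec a))"
  then obtain a where "x \<in> padic_ball k (w + rat_vec a)" by blast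
  hence "x \<in> padic_ball 0 (w + rat_vec a)" using padic_ball_subset[of 0 k] by blast
  also have "padic_ball 0 (w + rat_vec a) = (padic_ball 0 w :: ('p padic, 'n) vec set)"
    by (rule padic_ball_add[of _ 0]) auto
  finally show "x \<in> padic_ball 0 w" .
qed

text \<open>Level 0 is complete, being closed in a complete space, and totally bounded by the finite
  covers with balls of level k. The other balls are closed subsets of one of level 0, or contained
  in it with the same centre.\<close>

lemma compact_padic_ball: "compact (padic_ball k w :: ('p::prime_card padic, 'n::finite) vec set)"
proof -
  have "compact (padic_ball 0 w :: ('p padic, 'n) vec set)"
    unfolding compact_eq_totally_bounded
  proof (intro conjI allI impI)
    show "complete (padic_ball 0 w :: ('p padic, 'n) vec set)"
      using closed_padic_ball complete_eq_closed by blast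
    fix e :: real assume "e > 0"
    then obtain k where k: "real CARD('n) / real CARD('p) ^ k < e"
      using eventually_small_radius[of e "real CARD('n)", where 'p = 'p] by blast
    let ?F = "(\<lambda>a. padic_of_rat_vec (w + rat_vec a)) ` int_box (\<lambda>_. CARD('p) ^ k) :: ('p padic, 'n) vec set"
    have "padic_ball 0 w \<subseteq> (\<Union>x\<in>?F. ball x e)"
    proof
      fix x :: "('p padic, 'n) vec" assume "x \<in> padic_ball 0 w"
      then obtain a where a: "a \<in> int_box (\<lambda>_. CARD('p) ^ k)" "x \<in> padic_ball k (w + rat_vec a)"
        unfolding padic_ball_zero_cover[of w k] by blast
      have "dist (padic_of_rat_vec (w + rat_vec a)) x < e"
        using dist_padic_ball_le[OF centre_in_padic_ball a(2)] k by linarith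
      thus "x \<in> (\<Union>x\<in>?F. ball x e)" using a(1) by auto
    qed
    moreover have "finite ?F" by simp
    ultimately show "\<exists>F. finite F \<and> padic_ball 0 w \<subseteq> (\<Union>x\<in>F. ball x e :: ('p padic, 'n) vec set)"
      by (intro exI[of _ ?F] conjI)
  qed
  hence "compact (padic_ball 0 w \<inter> padic_ball k w :: ('p padic, 'n) vec set)"
    by (rule compact_Int_closed[OF _ closed_padic_ball])
  moreover have "padic_ball 0 w \<inter> padic_ball k w = (padic_ball k w :: ('p padic, 'n) vec set)"
    using padic_ball_subset[of 0 k w] by blast
  ultimately show ?thesis by (simp only:)
qed

section \<open>The measure determined by its values on balls\<close>

lemma compact_opens_empty: "{} \<in> compact_opens X"
  by (simp add: compact_opens_def)

lemma compact_opens_Un: "U \<in> compact_opens X \<Longrightarrow> V \<in> compact_opens X \<Longrightarrow> U \<union> V \<in> compact_opens X"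
  by (auto simp: compact_opens_def)

lemma padic_measure_empty: "padic_measure X \<mu> \<Longrightarrow> \<mu> {} = 0"
  using compact_opens_empty[of X] unfolding padic_measure_def by (metis Int_empty_left add_cancel_right_right sup_bot_right)

lemma padic_measure_UN:
  assumes \<mu>: "padic_measure X \<mu>" and "finite I" "\<And>i. i \<in> I \<Longrightarrow> A i \<in> compact_opens X"
    and "\<And>i j. i \<in> I \<Longrightarrow> j \<in> I \<Longrightarrow> i \<noteq> j \<Longrightarrow> A i \<inter> A j = {}"
  shows "\<Union>(A ` I) \<in> compact_opens X \<and> \<mu> (\<Union>(A ` I)) = (\<Sum>i\<in>I. \<mu> (A i))"
  using assms(2-)
proof (induction I)
  case (insert i I)
  have IH: "\<Union>(A ` I) \<in> compact_opens X" "\<mu> (\<Union>(A ` I)) = (\<Sum>i\<in>I. \<mu> (A i))" using insert by auto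
  have "A i \<inter> \<Union>(A ` I) = {}" using insert.prems(2) insert.hyps(2) by fastforce
  hence "\<mu> (A i \<union> \<Union>(A ` I)) = \<mu> (A i) + \<mu> (\<Union>(A ` I))"
    using \<mu> insert.prems(1) IH(1) unfolding padic_measure_def by blast
  thus ?case using insert IH compact_opens_Un[of "A i" X "\<Union>(A ` I)"] by simp
qed (simp add: compact_opens_empty padic_measure_empty[OF \<mu>])

lemma padic_ball_compact_open:
  "padic_ball k w \<subseteq> X \<Longrightarrow> padic_ball k w \<in> compact_opens (X :: ('p::prime_card padic, 'n::finite) vec set)"
  by (simp add: compact_opens_def open_padic_ball compact_padic_ball)

lemma padic_ball_subset_zero:
  "padic_ball k (v + rat_vec a) \<subseteq> (padic_ball 0 v :: ('p::prime_card padic, 'n::finite) vec set)"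
proof -
  have "padic_ball k (v + rat_vec a) \<subseteq> (padic_ball 0 (v + rat_vec a) :: ('p padic, 'n) vec set)"
    by (rule padic_ball_subset) simp
  also have "padic_ball 0 (v + rat_vec a) = (padic_ball 0 v :: ('p padic, 'n) vec set)"
    by (rule padic_ball_add[of _ 0]) auto
  finally show ?thesis .
qed

text \<open>Being a union of balls of level k is put as a dichotomy, which covers arbitrary rational
  centres and passes directly to larger k.\<close>

definition ball_union_at :: "nat \<Rightarrow> ('p::prime_card padic, 'n::finite) vec set \<Rightarrow> bool" where
  "ball_union_at k U \<longleftrightarrow> (\<forall>w. padic_ball k w \<subseteq> U \<or> padic_ball k w \<inter> U = {})"

text \<open>Compactness gives an e such that U contains the e-ball around each of its points; once
  the diameter of the balls of level k is below e, a ball meeting U lies in U.\<close>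

lemma compact_open_ball_union:
  assumes "compact U" "open U"
  shows "\<exists>K. \<forall>k\<ge>K. ball_union_at k (U :: ('p::prime_card padic, 'n::finite) vec set)"
proof -
  obtain e where e: "e > 0" "\<And>x. x \<in> U \<Longrightarrow> ball x e \<subseteq> U"
    using Heine_Borel_lemma[OF assms(1), of "{U}"] assms(2) by auto
  obtain K where K: "\<And>k. k \<ge> K \<Longrightarrow> real CARD('n) / real CARD('p) ^ k < e"
    using eventually_small_radius[OF e(1), of "real CARD('n)", where 'p = 'p] by blast
  have "(padic_ball k w :: ('p padic, 'n) vec set) \<subseteq> U" if k: "k \<ge> K" and ne: "padic_ball k w \<inter> U \<noteq> {}" for k w
  proof
    fix y :: "('p padic, 'n) vec" assume y: "y \<in> padic_ball k w"
    obtain x where x: "x \<in> padic_ball k w" "x \<in> U" using ne by blast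
    have "y \<in> ball x e" using dist_padic_ball_le[OF x(1) y] K[OF k] by simp
    thus "y \<in> U" using e(2)[OF x(2)] by blast
  qed
  thus ?thesis unfolding ball_union_at_def by blast
qed

lemma ball_union_at_mono:
  assumes "ball_union_at k U" "k \<le> k'"
  shows "ball_union_at k' U"
  using assms(1) padic_ball_subset[OF assms(2)] unfolding ball_union_at_def by blast

lemma ball_union_at_Un: "ball_union_at k U \<Longrightarrow> ball_union_at k V \<Longrightarrow> ball_union_at k (U \<union> V)"
  unfolding ball_union_at_def by blast

lemma ball_union_at_padic_ball: "ball_union_at k (padic_ball k w)"
  unfolding ball_union_at_def using padic_ball_disjoint by blast

lemma transversal_int_box_prime:
  "transversal (rat_vec ` int_box (\<lambda>_. CARD('p::prime_card) ^ k)) int_lattice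
    (matrix_lattice (mat (of_nat CARD('p) ^ k) :: 'n::finite qmat))"
  using transversal_int_box[of "\<lambda>_::'n. CARD('p) ^ k"] prime_card_gt_1[where 'p = 'p]
  by (simp add: diag_mat_const)

lemma padic_ball_box_inj:
  assumes "a \<in> int_box (\<lambda>_. CARD('p::prime_card) ^ k)" "b \<in> int_box (\<lambda>_. CARD('p) ^ k)"
    and "padic_ball k (v + rat_vec a) \<inter> padic_ball k (v + rat_vec b) \<noteq> ({} :: ('p padic, 'n::finite) vec set)"
  shows "a = b"
proof -
  have "rat_vec a - rat_vec b \<in> matrix_lattice (mat (of_nat CARD('p) ^ k) :: 'n qmat)"
    using padic_ball_int_cong[OF padic_ball_disjoint[OF assms(3)]] .
  hence "rat_vec a = (rat_vec b :: 'n qvec)"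
    using transversalD(4)[OF transversal_int_box_prime] assms(1,2) add_subgroupD(1)[OF add_subgroup_matrix_lattice] by blast
  thus ?thesis by simp
qed

lemma ball_union_eq:
  fixes U :: "('p::prime_card padic, 'n::finite) vec set"
  assumes "ball_union_at k U" "U \<subseteq> padic_ball 0 v"
  shows "U = (\<Union>a\<in>{a \<in> int_box (\<lambda>_. CARD('p) ^ k). padic_ball k (v + rat_vec a) \<subseteq> U}. padic_ball k (v + rat_vec a))"
proof (intro equalityI subsetI)
  fix x assume x: "x \<in> U"
  then obtain a where a: "a \<in> int_box (\<lambda>_. CARD('p) ^ k)" "x \<in> padic_ball k (v + rat_vec a)"
    using assms(2) unfolding padic_ball_zero_cover[of v k] by blast
  hence "padic_ball k (v + rat_vec a) \<subseteq> U" using assms(1) x unfolding ball_union_at_def by blast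
  thus "x \<in> (\<Union>a\<in>{a \<in> int_box (\<lambda>_. CARD('p) ^ k). padic_ball k (v + rat_vec a) \<subseteq> U}. padic_ball k (v + rat_vec a))"
    using a by blast
qed blast

text \<open>The balls of level k in v + Z_p^n are listed by the integral vectors with entries in [0,
  p^k), one for each ball.\<close>

definition ball_sum :: "(nat \<Rightarrow> 'n::finite qvec \<Rightarrow> 'p::prime_card padic) \<Rightarrow> 'n qvec \<Rightarrow> nat \<Rightarrow> ('p padic, 'n) vec set \<Rightarrow> 'p padic" where
  "ball_sum \<psi> v k U = (\<Sum>a\<in>int_box (\<lambda>_. CARD('p) ^ k). if padic_ball k (v + rat_vec a) \<subseteq> U then \<psi> k (v + rat_vec a) else 0)"

lemma padic_measure_eq_ball_sum:
  fixes \<mu> :: "('p::prime_card padic, 'n::finite) vec set \<Rightarrow> 'p padic"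
  assumes \<mu>: "padic_measure (padic_ball 0 v) \<mu>" and vals: "\<And>a. \<mu> (padic_ball k (v + rat_vec a)) = \<psi> k (v + rat_vec a)"
    and U: "ball_union_at k U" "U \<subseteq> padic_ball 0 v"
  shows "\<mu> U = ball_sum \<psi> v k U"
proof -
  let ?I = "{a \<in> int_box (\<lambda>_. CARD('p) ^ k). padic_ball k (v + rat_vec a) \<subseteq> U}"
  have "\<mu> (\<Union>a\<in>?I. padic_ball k (v + rat_vec a)) = (\<Sum>a\<in>?I. \<mu> (padic_ball k (v + rat_vec a)))"
    by (rule conjunct2[OF padic_measure_UN[OF \<mu>]])
      (auto intro!: padic_ball_compact_open subsetD[OF padic_ball_subset_zero] dest: padic_ball_box_inj[of _ k _ v, where 'p = 'p])
  thus ?thesis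
    unfolding ball_union_eq[OF U, symmetric] vals ball_sum_def by (simp add: sum.inter_filter)
qed

text \<open>A ball of level k' lies in U exactly when the ball of level k around it does, so
  grouping the fine balls by the coarse ones reduces the claim to additivity of \<psi>.\<close>

lemma ball_sum_refine:
  fixes \<psi> :: "nat \<Rightarrow> 'n::finite qvec \<Rightarrow> 'p::prime_card padic"
  assumes per: "\<And>k w b. w - v \<in> int_lattice \<Longrightarrow> b \<in> matrix_lattice (mat (of_nat CARD('p) ^ k)) \<Longrightarrow> \<psi> k (w + b) = \<psi> k w"
    and refine: "\<And>k k' w B. w - v \<in> int_lattice \<Longrightarrow> k \<le> k' \<Longrightarrow>
      transversal B (matrix_lattice (mat (of_nat CARD('p) ^ k))) (matrix_lattice (mat (of_nat CARD('p) ^ k'))) \<Longrightarrow>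
      \<psi> k w = (\<Sum>b\<in>B. \<psi> k' (w + b))"
    and U: "ball_union_at k U" and k: "k \<le> k'"
  shows "ball_sum \<psi> v k' U = ball_sum \<psi> v k U"
proof -
  let ?L = "\<lambda>k. matrix_lattice (mat (of_nat CARD('p) ^ k) :: 'n qmat)"
  define g where "g k x = (if padic_ball k (v + x) \<subseteq> U then \<psi> k (v + x) else 0)" for k x
  have bs: "ball_sum \<psi> v k U = (\<Sum>x\<in>rat_vec ` int_box (\<lambda>_. CARD('p) ^ k). g k x)" for k
    unfolding ball_sum_def g_def by (subst sum.reindex) (auto simp: inj_on_def)
  have "det (mat (of_nat CARD('p) ^ k') :: 'n qmat) \<noteq> 0" by (rule det_mat_nonzero) simp
  then obtain T where T: "transversal T (?L k) (?L k')" using ex_transversal_matrix_lattice by blast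
  have sub: "?L k' \<subseteq> ?L k" "?L k \<subseteq> int_lattice"
  proof -
    show L: "?L k \<subseteq> int_lattice" for k
      by (auto simp: matrix_lattice_def mat_vector_mult int_lattice_def intro!: Ints_mult Ints_power)
    have "mat (of_nat CARD('p) ^ k') = (mat (of_nat CARD('p) ^ k) ** mat (of_nat CARD('p) ^ (k' - k)) :: 'n qmat)"
      using k by (simp add: diag_mat_mult flip: diag_mat_const power_add)
    hence "?L k' = (*v) (mat (of_nat CARD('p) ^ k)) ` ?L (k' - k)" by (simp only: matrix_lattice_mult)
    thus "?L k' \<subseteq> ?L k"
      unfolding matrix_lattice_def[of "mat (of_nat CARD('p) ^ k)"] using L image_mono by (metis (no_types, lifting))
  qed
  have v: "v + x - v \<in> int_lattice \<longleftrightarrow> x \<in> int_lattice" for x by simp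
  have "ball_sum \<psi> v k' U = (\<Sum>s\<in>rat_vec ` int_box (\<lambda>_. CARD('p) ^ k). \<Sum>t\<in>T. g k' (s + t))"
    unfolding bs
  proof (rule transversal_tower_sum[OF _ _ _ sub transversal_int_box_prime T transversal_int_box_prime])
    fix x y :: "'n qvec" assume *: "x \<in> int_lattice" "y \<in> int_lattice" "x - y \<in> ?L k'"
    have xy: "v + x = (v + y) + (x - y)" by simp
    have "\<psi> k' (v + x) = \<psi> k' (v + y)" unfolding xy by (rule per) (use * in simp_all)
    moreover have "padic_ball k' (v + x) = (padic_ball k' (v + y) :: ('p padic, 'n) vec set)"
      unfolding xy by (rule padic_ball_add[OF *(3)]) simp
    ultimately show "g k' x = g k' y" by (simp add: g_def)
  qed auto
  also have "\<dots> = (\<Sum>s\<in>rat_vec ` int_box (\<lambda>_. CARD('p) ^ k). g k s)"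
  proof (intro sum.cong refl)
    fix s :: "'n qvec" assume s: "s \<in> rat_vec ` int_box (\<lambda>_. CARD('p) ^ k)"
    have ball: "padic_ball k' (v + (s + t)) \<subseteq> U \<longleftrightarrow> padic_ball k (v + s) \<subseteq> U" if t: "t \<in> T" for t
    proof -
      have "padic_ball k (v + s + t) = (padic_ball k (v + s) :: ('p padic, 'n) vec set)"
        by (rule padic_ball_add[of _ k]) (use t transversalD(2)[OF T] in auto)
      hence sub: "padic_ball k' (v + (s + t)) \<subseteq> (padic_ball k (v + s) :: ('p padic, 'n) vec set)"
        using padic_ball_subset[OF k, of "v + (s + t)", where 'p = 'p] by (simp only: add.assoc)
      show ?thesis
        using sub U padic_ball_nonempty[of k' "v + (s + t)", where 'p = 'p] unfolding ball_union_at_def by blast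
    qed
    have "\<psi> k (v + s) = (\<Sum>t\<in>T. \<psi> k' (v + s + t))" by (rule refine[OF _ k T]) (use s in auto)
    thus "(\<Sum>t\<in>T. g k' (s + t)) = g k s" unfolding g_def by (simp add: ball add.assoc)
  qed
  finally show ?thesis by (simp add: bs)
qed

lemma ball_sum_Un:
  fixes \<psi> :: "nat \<Rightarrow> 'n::finite qvec \<Rightarrow> 'p::prime_card padic"
  assumes "ball_union_at k U" "ball_union_at k V" "U \<inter> V = {}"
  shows "ball_sum \<psi> v k (U \<union> V) = ball_sum \<psi> v k U + ball_sum \<psi> v k V"
  unfolding ball_sum_def sum.distrib[symmetric]
proof (intro sum.cong refl)
  fix a
  let ?B = "padic_ball k (v + rat_vec a) :: ('p padic, 'n) vec set"
  have "?B \<subseteq> U \<or> ?B \<inter> U = {}" "?B \<subseteq> V \<or> ?B \<inter> V = {}" "?B \<noteq> {}"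
    using assms padic_ball_nonempty unfolding ball_union_at_def by blast+
  hence "?B \<subseteq> U \<union> V \<longleftrightarrow> ?B \<subseteq> U \<or> ?B \<subseteq> V" "\<not> (?B \<subseteq> U \<and> ?B \<subseteq> V)" using assms(3) by blast+
  thus "(if ?B \<subseteq> U \<union> V then \<psi> k (v + rat_vec a) else 0)
      = (if ?B \<subseteq> U then \<psi> k (v + rat_vec a) else 0) + (if ?B \<subseteq> V then \<psi> k (v + rat_vec a) else 0)"
    by auto
qed

lemma ball_sum_padic_ball:
  fixes \<psi> :: "nat \<Rightarrow> 'n::finite qvec \<Rightarrow> 'p::prime_card padic"
  assumes per: "\<And>k w b. w - v \<in> int_lattice \<Longrightarrow> b \<in> matrix_lattice (mat (of_nat CARD('p) ^ k)) \<Longrightarrow> \<psi> k (w + b) = \<psi> k w"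
  shows "ball_sum \<psi> v k (padic_ball k (v + rat_vec a)) = \<psi> k (v + rat_vec a)"
proof -
  obtain b where b: "b \<in> int_box (\<lambda>_. CARD('p) ^ k)" "rat_vec a - rat_vec b \<in> matrix_lattice (mat (of_nat CARD('p) ^ k) :: 'n qmat)"
    using transversalD(3)[OF transversal_int_box_prime[where 'p = 'p], of "rat_vec a" k] by auto
  have eq: "v + rat_vec a = (v + rat_vec b) + (rat_vec a - rat_vec b)" by simp
  have ball: "padic_ball k (v + rat_vec a) = (padic_ball k (v + rat_vec b) :: ('p padic, 'n) vec set)"
    unfolding eq by (rule padic_ball_add[OF b(2)]) simp
  have "padic_ball k (v + rat_vec c) \<subseteq> (padic_ball k (v + rat_vec a) :: ('p padic, 'n) vec set) \<longleftrightarrow> c = b"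
    if "c \<in> int_box (\<lambda>_. CARD('p) ^ k)" for c
    using padic_ball_box_inj[OF that b(1), of v] padic_ball_nonempty[of k "v + rat_vec c", where 'p = 'p] unfolding ball by blast
  hence "ball_sum \<psi> v k (padic_ball k (v + rat_vec a)) = (\<Sum>c\<in>int_box (\<lambda>_. CARD('p) ^ k). if c = b then \<psi> k (v + rat_vec b) else 0)"
    unfolding ball_sum_def by (intro sum.cong) auto
  also have "\<dots> = \<psi> k (v + rat_vec b)" using b(1) by simp
  also have "\<dots> = \<psi> k (v + rat_vec a)" unfolding eq by (rule per[symmetric]) (use b in auto)
  finally show ?thesis .
qed

text \<open>A compact open set is evaluated at any level at which it is a union of balls; additivity
  of \<psi> makes the result independent of the level. The bound on \<psi> passes to the measure
  unchanged, however many balls occur, since the norm is ultrametric.\<close>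

lemma ex1_padic_measure:
  fixes \<psi> :: "nat \<Rightarrow> 'n::finite qvec \<Rightarrow> 'p::prime_card padic"
  assumes per: "\<And>k w b. w - v \<in> int_lattice \<Longrightarrow> b \<in> matrix_lattice (mat (of_nat CARD('p) ^ k)) \<Longrightarrow> \<psi> k (w + b) = \<psi> k w"
    and refine: "\<And>k k' w B. w - v \<in> int_lattice \<Longrightarrow> k \<le> k' \<Longrightarrow>
      transversal B (matrix_lattice (mat (of_nat CARD('p) ^ k))) (matrix_lattice (mat (of_nat CARD('p) ^ k'))) \<Longrightarrow>
      \<psi> k w = (\<Sum>b\<in>B. \<psi> k' (w + b))"
    and bounded: "\<And>k w. w - v \<in> int_lattice \<Longrightarrow> padic_norm (\<psi> k w) \<le> C" and C: "C \<ge> 0"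
  shows "\<exists>!\<mu>. padic_measure (padic_ball 0 v :: ('p padic, 'n) vec set) \<mu> \<and> (\<forall>a k. \<mu> (padic_ball k (v + rat_vec a)) = \<psi> k (v + rat_vec a))"
proof (rule ex_ex1I)
  let ?X = "padic_ball 0 v :: ('p padic, 'n) vec set"
  define K where "K U = (LEAST k. ball_union_at k U)" for U :: "('p padic, 'n) vec set"
  have K: "ball_union_at (K U) U" if "U \<in> compact_opens ?X" for U
    unfolding K_def by (rule LeastI_ex) (use compact_open_ball_union[of U] that in \<open>auto simp: compact_opens_def\<close>)
  define \<mu> where "\<mu> U = (if U \<in> compact_opens ?X then ball_sum \<psi> v (K U) U else 0)" for U
  have \<mu>: "\<mu> U = ball_sum \<psi> v k U" if U: "U \<in> compact_opens ?X" "ball_union_at k U" for U k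
    using ball_sum_refine[where \<psi> = \<psi> and v = v, OF per refine K[OF U(1)], of "max k (K U)"]
      ball_sum_refine[where \<psi> = \<psi> and v = v, OF per refine U(2), of "max k (K U)"] U
    by (simp add: \<mu>_def)
  have "\<mu> (U \<union> V) = \<mu> U + \<mu> V" if UV: "U \<in> compact_opens ?X" "V \<in> compact_opens ?X" "U \<inter> V = {}" for U V
  proof -
    define k where "k = max (K U) (K V)"
    have k: "ball_union_at k U" "ball_union_at k V"
      using ball_union_at_mono[OF K] UV(1,2) by (auto simp: k_def)
    show ?thesis
      using \<mu>[OF UV(1) k(1)] \<mu>[OF UV(2) k(2)] \<mu>[OF compact_opens_Un[OF UV(1,2)] ball_union_at_Un[OF k]]
        ball_sum_Un[OF k UV(3), of \<psi> v] by simp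
  qed
  moreover have "padic_norm (\<mu> U) \<le> C" for U
    unfolding \<mu>_def ball_sum_def using C by (auto intro!: padic_norm_sum_le bounded)
  moreover have "\<mu> (padic_ball k (v + rat_vec a)) = \<psi> k (v + rat_vec a)" for a k
    using \<mu>[OF padic_ball_compact_open[OF padic_ball_subset_zero] ball_union_at_padic_ball]
      ball_sum_padic_ball[where \<psi> = \<psi> and v = v, OF per] by simp
  moreover have \<mu>_zero: "\<mu> U = 0" if "U \<notin> compact_opens ?X" for U using that by (simp add: \<mu>_def)
  ultimately show "\<exists>\<mu>. padic_measure ?X \<mu> \<and> (\<forall>a k. \<mu> (padic_ball k (v + rat_vec a)) = \<psi> k (v + rat_vec a))"
    unfolding padic_measure_def
    by (intro exI[of _ \<mu>] conjI exI[of _ C] ballI allI impI) (assumption | simp add: \<mu>_zero)+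
next
  let ?X = "padic_ball 0 v :: ('p padic, 'n) vec set"
  fix \<mu> \<nu>
  assume \<mu>: "padic_measure ?X \<mu> \<and> (\<forall>a k. \<mu> (padic_ball k (v + rat_vec a)) = \<psi> k (v + rat_vec a))"
    and \<nu>: "padic_measure ?X \<nu> \<and> (\<forall>a k. \<nu> (padic_ball k (v + rat_vec a)) = \<psi> k (v + rat_vec a))"
  show "\<mu> = \<nu>"
  proof
    fix U show "\<mu> U = \<nu> U"
    proof (cases "U \<in> compact_opens ?X")
      case True
      hence "\<exists>K. \<forall>k\<ge>K. ball_union_at k U" by (intro compact_open_ball_union) (auto simp: compact_opens_def)
      then obtain k where "ball_union_at k U" by blast
      thus ?thesis
        using padic_measure_eq_ball_sum[of v \<mu> k \<psi> U] padic_measure_eq_ball_sum[of v \<nu> k \<psi> U] \<mu> \<nu> True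
        by (simp add: compact_opens_def)
    qed (use \<mu> \<nu> in \<open>simp add: padic_measure_def\<close>)
  qed
qed

section \<open>Integration\<close>

lemma ball_sum_Union:
  assumes "finite \<C>" "disjoint \<C>" "\<And>C. C \<in> \<C> \<Longrightarrow> ball_union_at k C"
  shows "ball_union_at k (\<Union>\<C>) \<and> ball_sum \<psi> v k (\<Union>\<C>) = (\<Sum>C\<in>\<C>. ball_sum \<psi> v k C)"
  using assms
proof (induction \<C>)
  case empty
  have "\<not> padic_ball k w \<subseteq> ({} :: ('a padic, 'b) vec set)" for w using padic_ball_nonempty by blast
  thus ?case by (simp add: ball_sum_def ball_union_at_def)
next
  case (insert C \<C>)
  have IH: "ball_union_at k (\<Union>\<C>)" "ball_sum \<psi> v k (\<Union>\<C>) = (\<Sum>C\<in>\<C>. ball_sum \<psi> v k C)"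
    using insert by (auto simp: pairwise_insert disjoint_def)
  have "C \<inter> \<Union>\<C> = {}" using insert.prems(1) insert.hyps(2) by (fastforce simp: disjoint_def)
  thus ?case
    using ball_sum_Un[of k C "\<Union>\<C>" \<psi> v] ball_union_at_Un[of k C "\<Union>\<C>"] IH insert by simp
qed

text \<open>The mesh depends only on f and the bound b; the level k is chosen after the partition,
  large enough to split all its pieces into balls. On each ball the error is the oscillation of f
  times \<psi> plus the defect f \<psi> - \<theta>, and the maximum of these bounds the whole
  sum.\<close>

lemma has_padic_integral_level_sums:
  fixes f :: "('p::prime_card padic, 'n::finite) vec \<Rightarrow> 'p padic" and \<psi> \<theta> :: "nat \<Rightarrow> 'n qvec \<Rightarrow> 'p padic"
  assumes \<mu>: "padic_measure (padic_ball 0 v) \<mu>"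
    and vals: "\<And>a k. \<mu> (padic_ball k (v + rat_vec a)) = \<psi> k (v + rat_vec a)"
    and bounded: "\<And>k w. w - v \<in> int_lattice \<Longrightarrow> padic_norm (\<psi> k w) \<le> b"
    and f: "\<And>\<epsilon>. \<epsilon> > 0 \<Longrightarrow> \<exists>\<delta>>0. \<forall>x\<in>padic_ball 0 v. \<forall>y\<in>padic_ball 0 v. dist x y < \<delta> \<longrightarrow> padic_norm (f x - f y) \<le> \<epsilon>"
    and \<theta>: "\<And>\<epsilon>. \<epsilon> > 0 \<Longrightarrow> \<exists>K. \<forall>k\<ge>K. \<forall>w. w - v \<in> int_lattice \<longrightarrow>
      padic_norm (f (padic_of_rat_vec w) * \<psi> k w - \<theta> k w) \<le> \<epsilon>"
    and U: "U \<subseteq> padic_ball 0 v" and I: "\<exists>K. \<forall>k\<ge>K. I = ball_sum \<theta> v k U"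
  shows "has_padic_integral f I \<mu> U"
  unfolding has_padic_integral_def
proof (intro allI impI)
  fix \<epsilon> :: real assume \<epsilon>: "\<epsilon> > 0"
  have b: "b \<ge> 0" using order_trans[OF padic_norm_nonneg bounded[of v]] by (simp add: int_lattice_def)
  \<comment> \<open>The bound b may be zero, hence b + 1.\<close>
  hence "\<epsilon> / (2 * (b + 1)) > 0" using \<epsilon> by simp
  then obtain \<delta> where \<delta>: "\<delta> > 0" "\<And>x y. x \<in> padic_ball 0 v \<Longrightarrow> y \<in> padic_ball 0 v \<Longrightarrow> dist x y < \<delta> \<Longrightarrow>
      padic_norm (f x - f y) \<le> \<epsilon> / (2 * (b + 1))" using f by meson
  obtain K1 where K1: "\<And>k w. k \<ge> K1 \<Longrightarrow> w - v \<in> int_lattice \<Longrightarrow>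
      padic_norm (f (padic_of_rat_vec w) * \<psi> k w - \<theta> k w) \<le> \<epsilon> / 2" using \<theta>[of "\<epsilon> / 2"] \<epsilon> by auto
  obtain K2 where K2: "\<And>k. k \<ge> K2 \<Longrightarrow> I = ball_sum \<theta> v k U" using I by blast
  show "\<exists>\<delta>>0. \<forall>\<C> \<xi>. compact_open_partition \<delta> U \<C> \<and> (\<forall>C\<in>\<C>. \<xi> C \<in> C) \<longrightarrow>
      dist (\<Sum>C\<in>\<C>. f (\<xi> C) * \<mu> C) I < \<epsilon>"
  proof (intro exI[of _ \<delta>] conjI allI impI \<delta>(1))
    fix \<C> :: "('p padic, 'n) vec set set" and \<xi>
    assume "compact_open_partition \<delta> U \<C> \<and> (\<forall>C\<in>\<C>. \<xi> C \<in> C)"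
    hence \<C>: "finite \<C>" "\<Union>\<C> = U" "disjoint \<C>" "\<And>C. C \<in> \<C> \<Longrightarrow> compact C \<and> open C"
      "\<And>C x y. C \<in> \<C> \<Longrightarrow> x \<in> C \<Longrightarrow> y \<in> C \<Longrightarrow> dist x y < \<delta>" "\<And>C. C \<in> \<C> \<Longrightarrow> \<xi> C \<in> C"
      by (auto simp: compact_open_partition_def)
    have "\<forall>C\<in>\<C>. \<exists>K. \<forall>k\<ge>K. ball_union_at k C" using compact_open_ball_union \<C>(4) by blast
    then obtain K0 where K0: "\<And>C k. C \<in> \<C> \<Longrightarrow> k \<ge> K0 C \<Longrightarrow> ball_union_at k C" by metis
    define k where "k = max (max K1 K2) (Max (insert 0 (K0 ` \<C>)))"
    have k: "k \<ge> K1" "k \<ge> K2" "\<And>C. C \<in> \<C> \<Longrightarrow> k \<ge> K0 C"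
      using \<C>(1) by (auto simp: k_def le_max_iff_disj)
    have bu: "ball_union_at k C" if "C \<in> \<C>" for C using K0 k(3) that by blast
    have sub: "C \<subseteq> padic_ball 0 v" if "C \<in> \<C>" for C using U \<C>(2) that by blast
    have \<mu>C: "\<mu> C = ball_sum \<psi> v k C" if "C \<in> \<C>" for C
      by (rule padic_measure_eq_ball_sum[where \<psi> = \<psi>, OF \<mu> vals bu[OF that] sub[OF that]])
    have Isum: "I = (\<Sum>C\<in>\<C>. ball_sum \<theta> v k C)"
      using ball_sum_Union[OF \<C>(1,3) bu, of \<theta> v] K2[OF k(2)] \<C>(2) by simp
    have "(\<Sum>C\<in>\<C>. f (\<xi> C) * \<mu> C) - I = (\<Sum>C\<in>\<C>. f (\<xi> C) * ball_sum \<psi> v k C - ball_sum \<theta> v k C)"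
      unfolding Isum sum_subtractf using \<mu>C by simp
    also have "\<dots> = (\<Sum>C\<in>\<C>. \<Sum>a\<in>int_box (\<lambda>_. CARD('p) ^ k). if padic_ball k (v + rat_vec a) \<subseteq> C
        then f (\<xi> C) * \<psi> k (v + rat_vec a) - \<theta> k (v + rat_vec a) else 0)"
      unfolding ball_sum_def sum_distrib_left sum_subtractf[symmetric] by (intro sum.cong) auto
    finally have diff: "(\<Sum>C\<in>\<C>. f (\<xi> C) * \<mu> C) - I = \<dots>" .
    have "padic_norm ((\<Sum>C\<in>\<C>. f (\<xi> C) * \<mu> C) - I) \<le> \<epsilon> / 2"
      unfolding diff
    proof (intro padic_norm_sum_le)
      fix C a assume C': "C \<in> \<C>"
      let ?w = "v + rat_vec a" and ?c = "padic_of_rat_vec (v + rat_vec a) :: ('p padic, 'n) vec"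
      show "padic_norm (if padic_ball k ?w \<subseteq> C then f (\<xi> C) * \<psi> k ?w - \<theta> k ?w else 0) \<le> \<epsilon> / 2"
      proof (cases "padic_ball k ?w \<subseteq> C")
        case True
        hence c: "?c \<in> C" using centre_in_padic_ball by blast
        have "padic_norm (f (\<xi> C) - f ?c) \<le> \<epsilon> / (2 * (b + 1))"
          using \<delta>(2) sub[OF C'] c \<C>(6)[OF C'] \<C>(5)[OF C'] by blast
        hence "padic_norm (f (\<xi> C) - f ?c) * padic_norm (\<psi> k ?w) \<le> \<epsilon> / (2 * (b + 1)) * b"
          using \<epsilon> b by (intro mult_mono bounded) auto
        also have "\<dots> \<le> \<epsilon> / 2" using \<epsilon> b by (simp add: field_simps)
        finally have 1: "padic_norm ((f (\<xi> C) - f ?c) * \<psi> k ?w) \<le> \<epsilon> / 2" by (simp add: padic_norm_mult)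
        have 2: "padic_norm (f ?c * \<psi> k ?w - \<theta> k ?w) \<le> \<epsilon> / 2" by (rule K1[OF k(1)]) simp
        have "f (\<xi> C) * \<psi> k ?w - \<theta> k ?w = (f (\<xi> C) - f ?c) * \<psi> k ?w + (f ?c * \<psi> k ?w - \<theta> k ?w)"
          by (simp add: algebra_simps)
        also have "padic_norm \<dots> \<le> \<epsilon> / 2"
          by (rule order_trans[OF padic_norm_add_le_max]) (simp only: max.bounded_iff 1 2)
        finally show ?thesis using True by simp
      qed (use \<epsilon> in simp)
    qed (use \<epsilon> in auto)
    thus "dist (\<Sum>C\<in>\<C>. f (\<xi> C) * \<mu> C) I < \<epsilon>" using \<epsilon> by (simp add: dist_padic_def)
  qed
qed

section \<open>Cosets of M Z_p^n and the balls inside them\<close>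

abbreviation padic_matrix :: "'n::finite qmat \<Rightarrow> (('p::prime_card padic, 'n) vec, 'n) vec" where
  "padic_matrix M \<equiv> map_matrix of_rat M"

lemma padic_matrix_mult: "padic_matrix (A ** B) = (padic_matrix A ** padic_matrix B :: (('p::prime_card padic, 'n::finite) vec, 'n) vec)"
  by (simp add: vec_eq_iff matrix_matrix_mult_def of_rat_sum of_rat_mult)

lemma padic_of_rat_vec_add: "padic_of_rat_vec (v + w) = (padic_of_rat_vec v + padic_of_rat_vec w :: ('p::prime_card padic, 'n::finite) vec)"
  by (simp add: padic_of_rat_vec_def vec_eq_iff of_rat_add)

lemma padic_norm_of_rat_Ints_le_1: "x \<in> \<int> \<Longrightarrow> padic_norm (of_rat x :: 'p::prime_card padic) \<le> 1"
  by (simp add: padic_norm_of_rat padic_abs_Ints_le_1 prime_card)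

lemma padic_matrix_Zp_vec:
  fixes y :: "('p::prime_card padic, 'n::finite) vec"
  assumes M: "\<forall>i j. M $ i $ j \<in> \<int>" and y: "y \<in> Zp_vec"
  shows "padic_matrix M *v y \<in> Zp_vec"
  unfolding Zp_vec_def
proof safe
  fix i
  have "padic_norm (of_rat (M $ i $ j) * y $ j) \<le> 1" for j
    using padic_norm_of_rat_Ints_le_1[of "M $ i $ j", where 'p = 'p] M y
    by (simp add: padic_norm_mult Zp_vec_def mult_le_one)
  thus "padic_norm ((padic_matrix M *v y) $ i) \<le> 1"
    by (auto simp: matrix_vector_mult_def intro!: padic_norm_sum_le)
qed

lemma Zp_vec_add: "x \<in> Zp_vec \<Longrightarrow> y \<in> Zp_vec \<Longrightarrow> x + y \<in> (Zp_vec :: ('p::prime_card padic, 'n::finite) vec set)"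
  unfolding Zp_vec_def by (auto intro: order_trans[OF padic_norm_add_le_max])

lemma Zp_vec_minus: "x \<in> Zp_vec \<Longrightarrow> - x \<in> (Zp_vec :: ('p::prime_card padic, 'n::finite) vec set)"
  by (simp add: Zp_vec_def)

lemma Zp_vec_rat_vec: "padic_of_rat_vec (rat_vec z) \<in> (Zp_vec :: ('p::prime_card padic, 'n::finite) vec set)"
  using padic_norm_of_rat_Ints_le_1[OF Ints_of_int, where 'p = 'p]
  by (simp add: Zp_vec_def padic_of_rat_vec_def rat_vec_def del: of_rat_of_int_eq)

lemma padic_coset_eq:
  "padic_coset w M = (\<lambda>y. padic_of_rat_vec w + padic_matrix M *v y) ` (Zp_vec :: ('p::prime_card padic, 'n::finite) vec set)"
  by (simp add: padic_coset_def padic_of_rat_vec_def)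

context
  fixes M :: "'n::finite qmat" and a :: "(int, 'n) vec" and k :: nat and v :: "'n qvec"
    and pT :: "'p::prime_card itself"
  assumes M: "\<forall>i j. M $ i $ j \<in> \<int>" and det: "det M \<noteq> 0"
    and N: "\<forall>i j. (mat (of_nat CARD('p) ^ k) ** matrix_inv M) $ i $ j \<in> \<int>"
begin

abbreviation (input) coset :: "('p padic, 'n) vec set" where
  "coset \<equiv> padic_coset (v + rat_vec a) M"

lemma padic_matrix_scalar:
  "padic_matrix (mat (of_nat CARD('p) ^ k)) *v y
    = padic_matrix M *v (padic_matrix (mat (of_nat CARD('p) ^ k) ** matrix_inv M) *v (y :: ('p padic, 'n) vec))"
proof -
  have "M ** (mat (of_nat CARD('p) ^ k) ** matrix_inv M) = mat (of_nat CARD('p) ^ k)"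
    by (simp add: mat_mult_commute matrix_mul_assoc matrix_inv_mult det)
  thus ?thesis by (simp add: matrix_vector_mul_assoc flip: padic_matrix_mult)
qed

text \<open>An integral vector in M Z_p^n lies in M Z^n because Z[1/p] and Z_p meet in Z.
  Concretely, for the integral matrix N = p^k M^{-1} the vector N(c - a) is integral and lies in p^k
  Z_p^n, hence in p^k Z^n.\<close>

lemma centre_in_coset_iff:
  "padic_of_rat_vec (v + rat_vec c) \<in> coset \<longleftrightarrow> rat_vec c - rat_vec a \<in> matrix_lattice M"
proof
  let ?N = "mat (of_nat CARD('p) ^ k) ** matrix_inv M"
  have p: "prime CARD('p)" by (rule prime_card)
  assume "padic_of_rat_vec (v + rat_vec c) \<in> coset"
  then obtain y :: "('p padic, 'n) vec" where y: "y \<in> Zp_vec" "padic_of_rat_vec (v + rat_vec c) = padic_of_rat_vec (v + rat_vec a) + padic_matrix M *v y"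
    by (auto simp: padic_coset_eq)
  hence "padic_of_rat_vec (rat_vec (c - a)) = padic_matrix M *v y"
    by (simp add: padic_of_rat_vec_def vec_eq_iff rat_vec_def of_rat_add of_rat_diff algebra_simps)
  hence "padic_matrix ?N *v padic_of_rat_vec (rat_vec (c - a)) = padic_matrix (?N ** M) *v y"
    by (simp add: padic_matrix_mult matrix_vector_mul_assoc)
  also have "?N ** M = mat (of_nat CARD('p) ^ k)" by (simp add: matrix_inv_mult det flip: matrix_mul_assoc)
  finally have eq: "padic_of_rat_vec (?N *v rat_vec (c - a)) = padic_matrix (mat (of_nat CARD('p) ^ k)) *v y"
    by (simp add: map_matrix_of_rat_vec)
  have "?N *v rat_vec (c - a) \<in> int_lattice" by (rule int_matrix_lattice) (use N in auto)
  then obtain z where z: "?N *v rat_vec (c - a) = rat_vec z" by (auto simp: int_lattice_eq_range)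
  have "padic_of_rat_vec (rat_vec z) \<in> (padic_ball k (rat_vec 0) :: ('p padic, 'n) vec set)"
    unfolding padic_ball_def padic_coset_eq
    by (rule image_eqI[OF _ y(1)]) (simp add: z[symmetric] eq, simp add: padic_of_rat_vec_def rat_vec_def vec_eq_iff)
  hence "padic_ball k (0 + rat_vec z) = (padic_ball k (0 + rat_vec 0) :: ('p padic, 'n) vec set)"
    using padic_ball_disjoint[of k "rat_vec z" "rat_vec 0", where 'p = 'p] centre_in_padic_ball[of "rat_vec z" k]
    unfolding add_0_left by blast
  hence "rat_vec z - rat_vec 0 \<in> matrix_lattice (mat (of_nat CARD('p) ^ k) :: 'n qmat)"
    by (rule padic_ball_int_cong)
  then obtain q where q: "rat_vec z = (of_nat CARD('p) ^ k) *s rat_vec q"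
    unfolding rat_vec_diff[symmetric] diff_0_right
    by (auto simp: matrix_lattice_def int_lattice_eq_range mat_vector_mult)
  have "(of_nat CARD('p) ^ k) *s rat_vec (c - a) = M *v (?N *v rat_vec (c - a))"
  proof -
    have "M ** ?N = mat (of_nat CARD('p) ^ k)"
      by (simp add: mat_mult_commute matrix_mul_assoc matrix_inv_mult det)
    thus ?thesis by (simp add: matrix_vector_mul_assoc mat_vector_mult)
  qed
  also have "\<dots> = (of_nat CARD('p) ^ k) *s (M *v rat_vec q)" by (simp only: z q vector_scalar_commute)
  finally have "rat_vec (c - a) = M *v rat_vec q" using prime_gt_0_nat[OF p] by (simp add: vec_eq_iff)
  thus "rat_vec c - rat_vec a \<in> matrix_lattice M" by (simp add: matrix_lattice_def rat_vec_diff[symmetric])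
next
  assume "rat_vec c - rat_vec a \<in> matrix_lattice M"
  then obtain z where z: "rat_vec c - rat_vec a = M *v rat_vec z" by (auto simp: matrix_lattice_def int_lattice_eq_range)
  have "v + rat_vec c = (v + rat_vec a) + M *v rat_vec z" by (simp flip: z)
  thus "padic_of_rat_vec (v + rat_vec c) \<in> coset"
    unfolding padic_coset_eq
    by (intro image_eqI[OF _ Zp_vec_rat_vec[of z]]) (simp add: padic_of_rat_vec_add map_matrix_of_rat_vec)
qed

text \<open>p^k Z_p^n is contained in M Z_p^n because p^k M^{-1} is integral, so the coset is stable
  under translation by it.\<close>

lemma coset_add_ball:
  assumes x: "x \<in> coset" "x \<in> padic_ball k w" and y: "y \<in> padic_ball k w"
  shows "y \<in> coset"
proof -
  let ?N = "mat (of_nat CARD('p) ^ k) ** matrix_inv M"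
  obtain s where s: "s \<in> Zp_vec" "x = padic_of_rat_vec (v + rat_vec a) + padic_matrix M *v s"
    using x(1) by (auto simp: padic_coset_eq)
  obtain t where t: "t \<in> Zp_vec" "x = padic_of_rat_vec w + padic_matrix (mat (of_nat CARD('p) ^ k)) *v t"
    using x(2) by (auto simp: padic_coset_eq padic_ball_def)
  obtain r where r: "r \<in> Zp_vec" "y = padic_of_rat_vec w + padic_matrix (mat (of_nat CARD('p) ^ k)) *v r"
    using y by (auto simp: padic_coset_eq padic_ball_def)
  have "y = x + padic_matrix (mat (of_nat CARD('p) ^ k)) *v (r - t)"
    by (simp add: r(2) t(2) matrix_vector_mult_diff_distrib)
  also have "\<dots> = padic_of_rat_vec (v + rat_vec a) + padic_matrix M *v (s + padic_matrix ?N *v (r - t))"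
    unfolding padic_matrix_scalar s(2) by (simp add: matrix_vector_right_distrib)
  finally have "y = \<dots>" .
  moreover have "s + padic_matrix ?N *v (r - t) \<in> Zp_vec"
    using Zp_vec_add[OF s(1) padic_matrix_Zp_vec[OF N Zp_vec_add[OF r(1) Zp_vec_minus[OF t(1)]]]] by simp
  ultimately show ?thesis unfolding padic_coset_eq by blast
qed


lemma coset_subset: "coset \<subseteq> padic_ball 0 v"
proof
  fix x assume "x \<in> coset"
  then obtain s where s: "s \<in> Zp_vec" "x = padic_of_rat_vec (v + rat_vec a) + padic_matrix M *v s"
    by (auto simp: padic_coset_eq)
  have "x \<in> padic_ball 0 (v + rat_vec a)"
    using padic_matrix_Zp_vec[OF M s(1)] by (simp add: mem_padic_ball s(2) Zp_vec_def padic_of_rat_vec_def)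
  thus "x \<in> padic_ball 0 v" using padic_ball_subset_zero[of 0 v a, where 'p = 'p] by blast
qed

lemma ball_subset_coset_iff:
  "padic_ball k (v + rat_vec c) \<subseteq> coset \<longleftrightarrow> rat_vec c - rat_vec a \<in> matrix_lattice M"
proof
  assume "padic_ball k (v + rat_vec c) \<subseteq> coset"
  thus "rat_vec c - rat_vec a \<in> matrix_lattice M"
    using centre_in_padic_ball[of "v + rat_vec c" k] centre_in_coset_iff[of c] by blast
next
  assume "rat_vec c - rat_vec a \<in> matrix_lattice M"
  hence "padic_of_rat_vec (v + rat_vec c) \<in> coset" by (simp only: centre_in_coset_iff)
  thus "padic_ball k (v + rat_vec c) \<subseteq> coset" using coset_add_ball[OF _ centre_in_padic_ball] by blast
qed

text \<open>The balls of level k inside the coset correspond to the classes of M Z^n modulo p^k Z^n.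
  This matches the decomposition of the coset with the lattice refinement of the cocycle.\<close>

lemma transversal_coset:
  "transversal ((\<lambda>c. rat_vec c - rat_vec a) ` {c \<in> int_box (\<lambda>_. CARD('p) ^ k). padic_ball k (v + rat_vec c) \<subseteq> coset})
    (matrix_lattice M) (matrix_lattice (mat (of_nat CARD('p) ^ k)))"
proof (rule transversalI)
  let ?L = "matrix_lattice (mat (of_nat CARD('p) ^ k)) :: 'n qvec set"
  note box = transversal_int_box_prime[where 'p = 'p and 'n = 'n and k = k]
  fix x assume x: "x \<in> matrix_lattice M"
  have "x \<in> int_lattice" using x M by (auto simp: matrix_lattice_def intro: int_matrix_lattice)
  hence "x + rat_vec a \<in> int_lattice" by (intro add_subgroupD(4)) auto
  then obtain c where c: "c \<in> int_box (\<lambda>_. CARD('p) ^ k)" "x + rat_vec a - rat_vec c \<in> ?L"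
    using transversalD(3)[OF box] by blast
  have "?L \<subseteq> matrix_lattice M"
  proof -
    have "M ** (mat (of_nat CARD('p) ^ k) ** matrix_inv M) = mat (of_nat CARD('p) ^ k)"
      by (simp add: mat_mult_commute matrix_mul_assoc matrix_inv_mult det)
    hence "?L = (*v) M ` matrix_lattice (mat (of_nat CARD('p) ^ k) ** matrix_inv M)"
      by (simp flip: matrix_lattice_mult)
    also have "\<dots> \<subseteq> matrix_lattice M"
      unfolding matrix_lattice_def using N by (auto intro!: int_matrix_lattice)
    finally show ?thesis .
  qed
  hence "x - (x + rat_vec a - rat_vec c) \<in> matrix_lattice M"
    by (intro add_subgroupD(2)[OF add_subgroup_matrix_lattice x] subsetD[OF _ c(2)])
  hence "rat_vec c - rat_vec a \<in> matrix_lattice M" by simp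
  hence "padic_ball k (v + rat_vec c) \<subseteq> coset" by (simp only: ball_subset_coset_iff)
  moreover have "x - (rat_vec c - rat_vec a) \<in> ?L" using c(2) by (simp add: algebra_simps)
  ultimately show "\<exists>s\<in>(\<lambda>c. rat_vec c - rat_vec a) ` {c \<in> int_box (\<lambda>_. CARD('p) ^ k). padic_ball k (v + rat_vec c) \<subseteq> coset}. x - s \<in> ?L"
    using c(1) by blast
next
  fix s t :: "'n qvec"
  assume st: "s \<in> (\<lambda>c. rat_vec c - rat_vec a) ` {c \<in> int_box (\<lambda>_. CARD('p) ^ k). padic_ball k (v + rat_vec c) \<subseteq> coset}"
    "t \<in> (\<lambda>c. rat_vec c - rat_vec a) ` {c \<in> int_box (\<lambda>_. CARD('p) ^ k). padic_ball k (v + rat_vec c) \<subseteq> coset}"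
    "s - t \<in> matrix_lattice (mat (of_nat CARD('p) ^ k))"
  then obtain c d where cd: "c \<in> int_box (\<lambda>_. CARD('p) ^ k)" "d \<in> int_box (\<lambda>_. CARD('p) ^ k)" "s = rat_vec c - rat_vec a" "t = rat_vec d - rat_vec a"
    by blast
  hence "rat_vec c - rat_vec d \<in> matrix_lattice (mat (of_nat CARD('p) ^ k) :: 'n qmat)" using st(3) by simp
  hence "rat_vec c = (rat_vec d :: 'n qvec)"
    using transversalD(4)[OF transversal_int_box_prime[where 'p = 'p]] cd add_subgroupD(1)[OF add_subgroup_matrix_lattice] by blast
  thus "s = t" using cd by simp
qed (auto simp: ball_subset_coset_iff)

lemma ball_sum_coset:
  assumes "transversal B (matrix_lattice M) (matrix_lattice (mat (of_nat CARD('p) ^ k)))"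
    and per: "\<And>w b. w - v \<in> int_lattice \<Longrightarrow> b \<in> matrix_lattice (mat (of_nat CARD('p) ^ k)) \<Longrightarrow> \<theta> k (w + b) = \<theta> k w"
  shows "ball_sum \<theta> v k coset = (\<Sum>b\<in>B. \<theta> k (v + rat_vec a + b))"
proof -
  let ?I = "{c \<in> int_box (\<lambda>_. CARD('p) ^ k). padic_ball k (v + rat_vec c) \<subseteq> coset}"
  have "(\<Sum>b\<in>B. \<theta> k (v + rat_vec a + b)) = (\<Sum>b\<in>(\<lambda>c. rat_vec c - rat_vec a) ` ?I. \<theta> k (v + rat_vec a + b))"
  proof (rule transversal_sum_eq[OF add_subgroup_matrix_lattice assms(1) transversal_coset])
    fix x y assume xy: "x \<in> matrix_lattice M" "y \<in> matrix_lattice M" "x - y \<in> matrix_lattice (mat (of_nat CARD('p) ^ k))"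
    have "y \<in> int_lattice" using xy(2) M by (auto simp: matrix_lattice_def intro: int_matrix_lattice)
    hence "v + rat_vec a + y - v \<in> int_lattice"
      using add_subgroupD(4)[OF add_subgroup_int_lattice, of "rat_vec a" y] by simp
    from per[OF this xy(3)] show "\<theta> k (v + rat_vec a + x) = \<theta> k (v + rat_vec a + y)" by (simp add: add.assoc)
  qed
  also have "\<dots> = (\<Sum>c\<in>?I. \<theta> k (v + rat_vec c))"
    by (subst sum.reindex) (auto simp: inj_on_def)
  finally show ?thesis unfolding ball_sum_def by (simp add: sum.inter_filter)
qed

end

text \<open>Average over the forms of the congruence for each of them. The case P = 1 supplies the
  boundedness of the measure, which \<open>approx\<close> includes.\<close>

lemma level_value_approx:
  fixes A :: "'n::{finite,linorder} \<Rightarrow> 'n qmat" and Q :: "((real, 'n) vec, 'm::finite) vec" and v :: "'n qvec"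
  assumes l: "prime l" and p: "prime p" and cop: "coprime (int p) (int l)"
    and A: "\<forall>i. A i \<in> Gamma_lp l p" and Q: "Q \<in> linear_forms" and \<sigma>: "sigma_mat A = \<sigma>" "det \<sigma> \<noteq> 0"
  obtains C where "C \<ge> 0"
    "\<And>k w. w - v \<in> int_lattice \<Longrightarrow> padic_abs p (level_value l p Q \<sigma> k P w) \<le> C"
    "\<And>k w. w - v \<in> int_lattice \<Longrightarrow>
      padic_abs p (mpoly_eval (\<lambda>x. x) P (($) w) * level_value l p Q \<sigma> k 1 w - level_value l p Q \<sigma> k P w) \<le> C / real p ^ k"
proof -
  interpret submultiplicative_norm "padic_abs p" by (rule submultiplicative_norm_padic_abs[OF p])
  have p0: "p > 0" by (rule prime_gt_0_nat[OF p])
  have un: "unit_column_matrix l \<sigma>" using unit_column_matrix_sigma_mat[OF l p0 cop A] \<sigma>(1) by simp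
  note lv = level_value_def[OF l p0 cop A Q \<sigma>]
  let ?S = "{(k :: nat, w). w - v \<in> int_lattice}" and ?e = "\<lambda>(k :: nat, w :: 'n qvec). 1 / real p ^ k"
  have "approx ?S ?e (\<lambda>x. (- 1) ^ CARD('n) * sgn (det \<sigma>) / of_nat CARD('m) *
        (\<Sum>i\<in>UNIV. (case x of (k, w) \<Rightarrow> level_functional l p \<sigma> (\<lambda>j. act_forms (matrix_inv \<sigma>) Q $ i $ j > 0) k P w)))
      (\<lambda>x. (- 1) ^ CARD('n) * sgn (det \<sigma>) / of_nat CARD('m) *
        (\<Sum>i\<in>UNIV. (case x of (k, w) \<Rightarrow> mpoly_eval (\<lambda>x. x) P (($) w) *
          level_functional l p \<sigma> (\<lambda>j. act_forms (matrix_inv \<sigma>) Q $ i $ j > 0) k 1 w)))"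
    by (intro approx_mult approx_const approx_sum level_functional_approx[OF p l un \<sigma>(2)]) auto
  hence "approx ?S ?e (\<lambda>(k, w). level_value l p Q \<sigma> k P w)
      (\<lambda>(k, w). mpoly_eval (\<lambda>x. x) P (($) w) * level_value l p Q \<sigma> k 1 w)"
    unfolding lv by (simp add: case_prod_beta' sum_distrib_left[symmetric] mult.left_commute)
  from approx_sym[OF this] show ?thesis
  proof (rule approxE, goal_cases)
    case (1 C)
    show ?case by (rule that[of C]) (use 1(1) 1(3,4)[of "(k, w)" for k w] in auto)
  qed
qed

text \<open>A polynomial is Lipschitz on a bounded set: \<open>approx\<close> is applied to pairs of
  points, with their distance as the error.\<close>

lemma mpoly_eval_uniformly_continuous:
  fixes P :: "'n::finite rat_mpoly"
  assumes "\<epsilon> > 0"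
  shows "\<exists>\<delta>>0. \<forall>x\<in>padic_ball 0 v. \<forall>y\<in>padic_ball 0 v. dist x y < \<delta> \<longrightarrow>
    padic_norm (mpoly_eval of_rat P (($) x) - mpoly_eval of_rat P (($) y) :: 'p::prime_card padic) \<le> \<epsilon>"
proof -
  interpret submultiplicative_norm "padic_norm :: 'p padic \<Rightarrow> real" by (rule submultiplicative_norm_padic_norm)
  let ?X = "padic_ball 0 v :: ('p padic, 'n) vec set"
  let ?e = "\<lambda>xy :: ('p padic, 'n) vec \<times> ('p padic, 'n) vec. dist (fst xy) (snd xy)"
  have bd: "padic_norm (x $ i) \<le> max 1 (padic_norm (of_rat (v $ i) :: 'p padic))" if "x \<in> ?X" for x i
    using padic_norm_add_le_max[of "x $ i - of_rat (v $ i)" "of_rat (v $ i)"] that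
    by (auto simp: mem_padic_ball max_def split: if_splits dest!: spec[of _ i])
  have dl: "padic_norm (x $ i - y $ i) \<le> dist x y" for x y :: "('p padic, 'n) vec" and i
    using dist_vec_nth_le[of x i y] by (simp only: dist_padic_def)
  have "approx (?X \<times> ?X) ?e (\<lambda>xy. fst xy $ i) (\<lambda>xy. snd xy $ i)" for i
    by (rule approxI[of _ _ _ _ _ 1]) (use bd dl in auto)
  hence "approx (?X \<times> ?X) ?e (\<lambda>xy. mpoly_eval of_rat P (($) (fst xy))) (\<lambda>xy. mpoly_eval of_rat P (($) (snd xy)))"
    unfolding mpoly_eval_def by (intro approx_sum approx_mult approx_prod approx_power approx_const) auto
  then obtain C where C: "C \<ge> 0" "\<And>xy. xy \<in> ?X \<times> ?X \<Longrightarrow>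
      padic_norm (mpoly_eval of_rat P (($) (fst xy)) - mpoly_eval of_rat P (($) (snd xy)) :: 'p padic) \<le> C * ?e xy"
    by (rule approxE) (rule that)
  show ?thesis
  proof (intro exI[of _ "\<epsilon> / (C + 1)"] conjI ballI impI)
    fix x y assume xy: "x \<in> ?X" "y \<in> ?X" "dist x y < \<epsilon> / (C + 1)"
    have "padic_norm (mpoly_eval of_rat P (($) x) - mpoly_eval of_rat P (($) y) :: 'p padic) \<le> C * dist x y"
      using C(2)[of "(x, y)"] xy by simp
    also have "\<dots> \<le> (C + 1) * (\<epsilon> / (C + 1))" using C(1) xy(3) by (intro mult_mono) auto
    finally show "padic_norm (mpoly_eval of_rat P (($) x) - mpoly_eval of_rat P (($) y) :: 'p padic) \<le> \<epsilon>"
      using C(1) by simp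
  qed (use assms C(1) in auto)
qed

lemma mpoly_eval_padic_of_rat_vec:
  "mpoly_eval of_rat P (($) (padic_of_rat_vec w :: ('p::prime_card padic, 'n::finite) vec)) = of_rat (mpoly_eval (\<lambda>x. x) P (($) w))"
proof -
  have pr: "of_rat (prod f I) = (\<Prod>i\<in>I. of_rat (f i) :: 'p padic)" for f :: "'n \<Rightarrow> rat" and I
    by (induction I rule: infinite_finite_induct) (simp_all add: of_rat_mult)
  show ?thesis
    by (simp add: mpoly_eval_def padic_of_rat_vec_def of_rat_sum of_rat_mult pr of_rat_power)
qed

theorem theorem4p3:
  fixes l :: nat
    and A :: "'n::{finite,linorder} \<Rightarrow> 'n qmat"
    and Q :: "((real, 'n) vec, 'm::finite) vec"
    and v :: "'n qvec"
    and P :: "'n rat_mpoly"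
    and a :: "(int, 'n) vec"
    and M :: "'n qmat"
  assumes "prime l" and "l \<noteq> CARD('p::prime_card)"
    and "\<forall>i. A i \<in> Gamma_lp l CARD('p)"
    and "Q \<in> linear_forms"
    and "\<forall>i j. M $ i $ j \<in> \<int>" and "M \<in> Gamma_lp l CARD('p)"
  shows "has_padic_integral
           (\<lambda>x :: ('p padic, 'n) vec. mpoly_eval of_rat P (($) x))
           (of_rat (sgn (det M) *
              Psi l (\<lambda>i. matrix_inv M ** A i) (act_poly (transpose M) P)
                (act_forms (matrix_inv M) Q) (matrix_inv M *v (v + rat_vec a))))
           (mu_l l A Q v)
           (padic_coset (v + rat_vec a) M)"
proof -
  let ?p = "CARD('p)" and ?\<sigma> = "sigma_mat A"
  let ?X = "padic_ball 0 v :: ('p padic, 'n) vec set" and ?U = "padic_coset (v + rat_vec a) M :: ('p padic, 'n) vec set"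
  have p: "prime ?p" by (rule prime_card)
  have p0: "?p > 0" by (rule prime_gt_0_nat[OF p])
  have cop: "coprime (int ?p) (int l)"
    using primes_coprime[OF p assms(1)] assms(2) by simp
  have X: "padic_coset v (mat 1) = ?X" by (simp add: padic_ball_def)
  note G = int_Gamma0_inverse[OF assms(1) p0 cop assms(5,6)]
  obtain K where K: "\<And>k. k \<ge> K \<Longrightarrow> int_Gamma0 l (mat (of_nat ?p ^ k) ** matrix_inv M)" using G(3) by blast
  show ?thesis
  proof (cases "det ?\<sigma> = 0")
    case True
    \<comment> \<open>In the singular case the measure is zero by definition, and the matrix for
      M^{-1}A is singular as well.\<close>
    have "mu_l l A Q v = (\<lambda>_. 0 :: 'p padic)"
      unfolding mu_l_def using True by (intro the_equality) (auto simp: padic_measure_def intro: exI[of _ 0])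
    moreover obtain d where "sigma_mat (\<lambda>i. matrix_inv M ** A i) = matrix_inv M ** (?\<sigma> ** diag_mat d)"
      using sigma_mat_inverse[OF assms(1) p0 cop assms(3,5,6)] by metis
    hence "Psi l (\<lambda>i. matrix_inv M ** A i) (act_poly (transpose M) P)
        (act_forms (matrix_inv M) Q) (matrix_inv M *v (v + rat_vec a)) = 0"
      using True by (simp add: Psi_def det_mul)
    ultimately show ?thesis by (auto simp: has_padic_integral_def intro: exI[of _ 1])
  next
    case False
    define lv where "lv = level_value l ?p Q ?\<sigma>"
    note ctx = assms(1) p0 cop assms(3,4) refl False
    note per = level_value_add[OF ctx, folded lv_def]
    note refine = level_value_refine[OF ctx, folded lv_def]
    define \<psi> :: "nat \<Rightarrow> 'n qvec \<Rightarrow> 'p padic" where "\<psi> k w = of_rat (lv k 1 w)" for k w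
    define \<theta> :: "nat \<Rightarrow> 'n qvec \<Rightarrow> 'p padic" where "\<theta> k w = of_rat (lv k P w)" for k w
    note appr = level_value_approx[OF assms(1) p cop assms(3,4) refl False, folded lv_def]
    obtain C1 where C1': "C1 \<ge> 0" "\<And>k w. w - v \<in> int_lattice \<Longrightarrow> padic_abs ?p (lv k 1 w) \<le> C1"
      by (rule appr[of v 1]) (rule that)
    hence C1: "C1 \<ge> 0" "\<And>k w. w - v \<in> int_lattice \<Longrightarrow> padic_norm (\<psi> k w) \<le> C1"
      by (simp_all add: \<psi>_def padic_norm_of_rat)
    obtain C where C': "\<And>k w. w - v \<in> int_lattice \<Longrightarrow>
        padic_abs ?p (mpoly_eval (\<lambda>x. x) P (($) w) * lv k 1 w - lv k P w) \<le> C / real ?p ^ k"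
      by (rule appr[of v P]) (rule that)
    have C: "padic_norm (mpoly_eval of_rat P (($) (padic_of_rat_vec w)) * \<psi> k w - \<theta> k w) \<le> C / real ?p ^ k"
      if "w - v \<in> int_lattice" for k w
      unfolding \<psi>_def \<theta>_def mpoly_eval_padic_of_rat_vec of_rat_mult[symmetric] of_rat_diff[symmetric] padic_norm_of_rat
      by (rule C'[OF that])
    have ex1: "\<exists>!\<mu>. padic_measure ?X \<mu> \<and> (\<forall>a k. \<mu> (padic_ball k (v + rat_vec a)) = \<psi> k (v + rat_vec a))"
      by (rule ex1_padic_measure[OF _ _ C1(2,1)]) (simp_all add: \<psi>_def per refine of_rat_sum)
    have "mu_l l A Q v = (THE \<mu>. padic_measure ?X \<mu> \<and> (\<forall>a k. \<mu> (padic_ball k (v + rat_vec a)) = \<psi> k (v + rat_vec a)))"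
      using False unfolding mu_l_def X \<psi>_def lv_def Psi_one_eq_level_value[OF ctx] padic_ball_def by simp
    hence \<mu>: "padic_measure ?X (mu_l l A Q v)" "\<And>a k. mu_l l A Q v (padic_ball k (v + rat_vec a)) = \<psi> k (v + rat_vec a)"
      using theI'[OF ex1] by simp_all
    show ?thesis
    proof (rule has_padic_integral_level_sums[OF \<mu> C1(2) mpoly_eval_uniformly_continuous])
      fix \<epsilon> :: real assume "\<epsilon> > 0"
      then obtain K where "\<And>k. k \<ge> K \<Longrightarrow> C / real ?p ^ k < \<epsilon>" using eventually_small_radius[of \<epsilon> C, where 'p = 'p] by blast
      thus "\<exists>K. \<forall>k\<ge>K. \<forall>w. w - v \<in> int_lattice \<longrightarrow>
          padic_norm (mpoly_eval of_rat P (($) (padic_of_rat_vec w)) * \<psi> k w - \<theta> k w) \<le> \<epsilon>"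
        using C by (meson le_less_trans less_imp_le)
    next
      have N: "\<forall>i j. (mat (of_nat ?p ^ k) ** matrix_inv M) $ i $ j \<in> \<int>" if "k \<ge> K" for k
        using K[OF that] by (simp add: int_Gamma0_def)
      show "?U \<subseteq> ?X" by (rule coset_subset[OF assms(5) G(1) N[OF order_refl]])
      \<comment> \<open>At every level k \<ge> K this identity is exact; only the comparison with
        Riemann sums is approximate.\<close>
      have "of_rat (sgn (det M) * Psi l (\<lambda>i. matrix_inv M ** A i) (act_poly (transpose M) P)
          (act_forms (matrix_inv M) Q) (matrix_inv M *v (v + rat_vec a))) = ball_sum \<theta> v k ?U" if k: "k \<ge> K" for k
      proof -
        have "det (mat (of_nat ?p ^ k) :: 'n qmat) \<noteq> 0" by (rule det_mat_nonzero) simp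
        then obtain B where B: "transversal B (matrix_lattice M) (matrix_lattice (mat (of_nat ?p ^ k)))"
          using ex_transversal_matrix_lattice by blast
        show ?thesis
          unfolding Psi_inverse_eq_level_sum[OF ctx assms(5,6) K[OF k] B]
          by (subst ball_sum_coset[OF assms(5) G(1) N[OF k] B]) (simp_all add: \<theta>_def lv_def[symmetric] per of_rat_sum)
      qed
      thus "\<exists>K. \<forall>k\<ge>K. of_rat (sgn (det M) * Psi l (\<lambda>i. matrix_inv M ** A i) (act_poly (transpose M) P)
          (act_forms (matrix_inv M) Q) (matrix_inv M *v (v + rat_vec a))) = ball_sum \<theta> v k ?U" by blast
    qed
  qed
qed

end
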